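(* Let $v\in\widehat{\mathcal{D}}$ satisfy $$\int_0^1\frac{(1-s)^2}{\widehat{v}(s)}\,ds<\infty\quad\text{and}\quad M_1(v)=\sup_{0<r<1}\left(\int_r^1\frac{\widehat{v}(s)}{(1-s)^2}\,ds\right)^{1/2}\left(\int_0^r\frac{1}{\widehat{v}(s)}\,ds\right)^{1/2}<\infty.$$ Then the following assertions are equivalent: (i) $\mathcal{H}:L^2_{\widehat{V}_2}\to\mathcal{D}_v$ is bounded; (ii) $\widetilde{\mathcal{H}}:L^2_{\widehat{V}_2}\to\mathcal{D}_v$ is bounded; (iii) $v$ satisfies the Muckenhoupt type condition $$M_2(v)=\sup_{0<r<1}\left(\int_0^r\frac{\widehat{v}(s)}{(1-s)^4}\,ds\right)^{1/2}\left(\int_r^1\frac{(1-s)^2}{\widehat{v}(s)}\,ds\right)^{1/2}<\infty.$$ Moreover, if $M_2(v)<\infty$, then $$\frac{M_2(v)}{M_1(v)}\lesssim\|\mathcal{H}\|_{(L^2_{\widehat{V}_2},\mathcal{D}_v)}\asymp\|\widetilde{\mathcal{H}}\|_{(L^2_{\widehat{V}_2},\mathcal{D}_v)}\lesssim M_1(v)M_2(v).$$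
   Context: $\mathbb{D}$ is the open unit disc and $H(\mathbb{D})$ the space of analytic functions on $\mathbb{D}$; $dA=\frac{dx\,dy}{\pi}$. A weight is a function $v:\mathbb{D}\to(0,\infty)$ integrable over $\mathbb{D}$; it is radial if $v(z)=v(|z|)$ for all $z\in\mathbb{D}$. For a radial weight $v$ put $\widehat{v}(r)=\int_r^1 v(s)\,ds$ and $\widehat{V}_2(r)=\frac{\widehat{v}(r)}{(1-r)^2}$. The class $\widehat{\mathcal{D}}$ consists of the radial weights $v$ with $\sup_{0<r<1}\frac{\widehat v(r)}{\widehat v\left(\frac{1+r}{2}\right)}<\infty$. The weighted Dirichlet space $\mathcal{D}_v$ consists of $f\in H(\mathbb{D})$ with $\|f\|_{\mathcal{D}_v}^2=|f(0)|^2+\int_{\mathbb{D}}|f'(z)|^2v(z)\,dA(z)<\infty$. $L^2_{\widehat{V}_2}$ is the space of measurable functions $\phi$ on $[0,1)$ with $\|\phi\|^2_{L^2_{\widehat{V}_2}}=\int_0^1|\phi(t)|^2\widehat{V}_2(t)\,dt<\infty$. The Hilbert operator is $\mathcal{H}(f)(z)=\int_0^1\frac{f(t)}{1-tz}\,dt$ and the sublinear Hilbert operator is $\widetilde{\mathcal{H}}(f)(z)=\int_0^1\frac{|f(t)|}{1-tz}\,dt$, $z\in\mathbb{D}$. For $T\in\{\mathcal{H},\widetilde{\mathcal{H}}\}$, $T:X\to Y$ is bounded if $\|T\|_{(X,Y)}=\sup_{\|\phi\|_X\le1}\|T\phi\|_Y<\infty$. Convention on constants: $C=C(\cdot)$ denotes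 an absolute constant whose value depends on the parameters indicated in the parenthesis. The notation $a\lesssim b$ means that there exists a constant $C=C(\cdot)>0$ such that $a\le Cb$; $a\gtrsim b$ is understood analogously, and $a\asymp b$ means $a\lesssim b$ and $a\gtrsim b$.
   Formalization: In the last estimate, by M_1(v)M_2(v), the implied constant depends on the doubling constant of v and on the total mass v^(0); no absolute constant works, since scaling v by a→0 keeps M_1, M_2 fixed while the norm blows up. The other constants are absolute. *)

theory Defs
  imports "HOL-Analysis.Analysis"
begin

text \<open>
  Norms, suprema and integrals of nonnegative functions that may be infinite take values in
  \<^typ>\<open>ennreal\<close>, so that finiteness is the condition \<open>< \<infinity>\<close>.
\<close>

definition ennsqrt :: "ennreal \<Rightarrow> ennreal" where
  "ennsqrt x = (if x = \<infinity> then \<infinity> else ennreal (sqrt (enn2real x)))"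

text \<open>Only the values of a weight on the unit disc are relevant.\<close>

definition weight :: "(complex \<Rightarrow> real) \<Rightarrow> bool" where
  "weight v \<longleftrightarrow> (\<forall>z\<in>ball 0 1. 0 < v z) \<and> set_integrable lebesgue (ball 0 1) v"

definition radial_weight :: "(complex \<Rightarrow> real) \<Rightarrow> bool" where
  "radial_weight v \<longleftrightarrow> weight v \<and> (\<forall>z\<in>ball 0 1. v z = v (complex_of_real (cmod z)))"

text \<open>
  For a radial weight the integrand is integrable on \<open>[r,1)\<close> for every \<open>0 < r < 1\<close>. It may fail to
  be integrable on \<open>[0,1)\<close>, but not if the weight lies in the class \<open>D_hat\<close> below.
\<close>

definition v_hat :: "(complex \<Rightarrow> real) \<Rightarrow> real \<Rightarrow> real" where
  "v_hat v r = (LINT s:{r..<1}|lebesgue. v (complex_of_real s))"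

definition V2_hat :: "(complex \<Rightarrow> real) \<Rightarrow> real \<Rightarrow> real" where
  "V2_hat v r = v_hat v r / (1 - r)\<^sup>2"

definition doubling_const :: "(complex \<Rightarrow> real) \<Rightarrow> ennreal" where
  "doubling_const v = (SUP r\<in>{0<..<1}. ennreal (v_hat v r / v_hat v ((1 + r) / 2)))"

definition D_hat :: "(complex \<Rightarrow> real) set" where
  "D_hat = {v. radial_weight v \<and> doubling_const v < \<infinity>}"

text \<open>The division by \<open>pi\<close> accounts for the normalised area measure \<open>dA = dx dy / pi\<close>.\<close>

definition dirichlet_norm :: "(complex \<Rightarrow> real) \<Rightarrow> (complex \<Rightarrow> complex) \<Rightarrow> ennreal" where
  "dirichlet_norm v f = ennsqrt (ennreal ((cmod (f 0))\<^sup>2) +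
     (\<integral>\<^sup>+z\<in>ball 0 1. ennreal ((cmod (deriv f z))\<^sup>2 * v z / pi) \<partial>lebesgue))"

definition dirichlet_space :: "(complex \<Rightarrow> real) \<Rightarrow> (complex \<Rightarrow> complex) set" where
  "dirichlet_space v = {f. f holomorphic_on ball 0 1 \<and> dirichlet_norm v f < \<infinity>}"

definition L2_norm :: "(complex \<Rightarrow> real) \<Rightarrow> (real \<Rightarrow> complex) \<Rightarrow> ennreal" where
  "L2_norm v \<phi> = ennsqrt (\<integral>\<^sup>+t\<in>{0..<1}. ennreal ((cmod (\<phi> t))\<^sup>2 * V2_hat v t) \<partial>lebesgue)"

definition L2_space :: "(complex \<Rightarrow> real) \<Rightarrow> (real \<Rightarrow> complex) set" where
  "L2_space v = {\<phi>. \<phi> \<in> borel_measurable (lebesgue_on {0..<1}) \<and> L2_norm v \<phi> < \<infinity>}"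

definition hilbert_op :: "(real \<Rightarrow> complex) \<Rightarrow> complex \<Rightarrow> complex" where
  "hilbert_op f z = (LINT t:{0..<1}|lebesgue. f t / (1 - complex_of_real t * z))"

definition sublinear_hilbert_op :: "(real \<Rightarrow> complex) \<Rightarrow> complex \<Rightarrow> complex" where
  "sublinear_hilbert_op f z =
     (LINT t:{0..<1}|lebesgue. complex_of_real (cmod (f t)) / (1 - complex_of_real t * z))"

definition op_norm ::
  "(complex \<Rightarrow> real) \<Rightarrow> ((real \<Rightarrow> complex) \<Rightarrow> complex \<Rightarrow> complex) \<Rightarrow> ennreal" where
  "op_norm v T = (SUP \<phi>\<in>{\<phi>\<in>L2_space v. L2_norm v \<phi> \<le> 1}. dirichlet_norm v (T \<phi>))"

definition bounded_op ::
  "(complex \<Rightarrow> real) \<Rightarrow> ((real \<Rightarrow> complex) \<Rightarrow> complex \<Rightarrow> complex) \<Rightarrow> bool" where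
  "bounded_op v T \<longleftrightarrow> T ` L2_space v \<subseteq> dirichlet_space v \<and> op_norm v T < \<infinity>"

definition M1 :: "(complex \<Rightarrow> real) \<Rightarrow> ennreal" where
  "M1 v = (SUP r\<in>{0<..<1}.
     ennsqrt (\<integral>\<^sup>+s\<in>{r..<1}. ennreal (v_hat v s / (1 - s)\<^sup>2) \<partial>lebesgue) *
     ennsqrt (\<integral>\<^sup>+s\<in>{0..r}. ennreal (1 / v_hat v s) \<partial>lebesgue))"

definition M2 :: "(complex \<Rightarrow> real) \<Rightarrow> ennreal" where
  "M2 v = (SUP r\<in>{0<..<1}.
     ennsqrt (\<integral>\<^sup>+s\<in>{0..r}. ennreal (v_hat v s / (1 - s) ^ 4) \<partial>lebesgue) *
     ennsqrt (\<integral>\<^sup>+s\<in>{r..<1}. ennreal ((1 - s)\<^sup>2 / v_hat v s) \<partial>lebesgue))"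

end

theory Submission
  imports Defs
begin

text \<open>
  For nonnegative \<open>\<phi>\<close> the Dirichlet norm of the Hilbert transform is computed exactly. Rotation
  invariance makes the monomials orthogonal, so the area integral of \<open>|f'|\<^sup>2 v\<close> is a double integral
  of \<open>\<phi>(t) \<phi>(s) t s S(t s r\<^sup>2) 2 r v(r)\<close> with \<open>S x = (1 + x) / (1 - x)^3\<close>. Since
  \<open>S(t s r\<^sup>2) \<le> 2 / (1 - min)^3 = 2 + 6 \<integral> (1 - \<rho>)^-4\<close> with \<open>\<rho>\<close> ranging up to \<open>min t s r\<close>, Tonelli turns
  the upper bound into \<open>\<integral> v_hat(\<rho>) (1 - \<rho>)^-4 (\<integral>_\<rho>^1 \<phi>)\<^sup>2\<close> plus a multiple of \<open>(\<integral> \<phi>)\<^sup>2\<close>, which is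
  controlled by Muckenhoupt's form of Hardy's inequality with constant \<open>M2 v\<close>. Testing on
  \<open>(1 - t)\<^sup>2 / v_hat(t)\<close> restricted to \<open>[r, 1)\<close> gives the converse. The integrability hypothesis
  forces \<open>M1 v\<close> to be bounded below by an absolute constant, so both bounds in terms of \<open>M2 v\<close> alone
  imply the stated ones. Signed \<open>\<phi>\<close> are reduced to \<open>|\<phi>|\<close> coefficient by coefficient.
\<close>

section \<open>Integration over the disc in terms of the modulus\<close>

text \<open>The weight is merely Lebesgue measurable on the disc, whereas \<open>v_hat\<close>
  samples it along a radius, a planar null set. Radial symmetry reconciles the two: a Borel profile
  \<open>u\<close> of the modulus agrees with \<open>v\<close> almost everywhere both on the radius
  and on the disc, and it is \<open>u\<close> to which Tonelli is applied. The kernel S(t s r^2)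
  couples three variables. Passing from the product to the minimum decouples them, since
  \<open>\<rho>\<close> \<le> min t s r is a conjunction of three separate conditions: the t and s
  integrals become tails of \<open>\<phi>\<close>, the r integral becomes \<open>v_hat\<close>.
  Multiplying \<open>v\<close> by a constant leaves \<open>M1 v\<close> and \<open>M2 v\<close>
  unchanged and rescales the squared norm of \<open>\<phi>\<close> and the area integral alike, but
  not |f(0)|. Hence the constant of the upper bound depends on the size of \<open>v\<close>, here
  through \<open>v_hat v 0\<close>. The doubling constant enters because \<open>v_hat v 0\<close>
  times the whole dual integral has to be bounded by the square of \<open>M2 v\<close>; this is a
  Muckenhoupt condition at the endpoint r = 0, where the first factor of \<open>M2 v\<close>
  degenerates.\<close>

lemma ennsqrt_power2: "(ennsqrt x)\<^sup>2 = x"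
  by (cases x) (auto simp: ennsqrt_def ennreal_power)

lemma ennreal_power2_le_iff: "(x::ennreal)\<^sup>2 \<le> y\<^sup>2 \<longleftrightarrow> x \<le> y"
  by (cases x; cases y) (auto simp: ennreal_power power2_le_iff_abs_le top_unique)

section \<open>Planar Lebesgue measure as a product, and its invariance under rotations\<close>

lemma lborel_complex_eq: "distr (lborel \<Otimes>\<^sub>M lborel) borel (\<lambda>(x, y). Complex x y) = lborel"
proof (rule lborel_eqI[symmetric])
  fix l u :: complex assume "\<And>b. b \<in> Basis \<Longrightarrow> l \<bullet> b \<le> u \<bullet> b"
  from this[of 1] this[of \<i>] have *: "Re l \<le> Re u" "Im l \<le> Im u" by (auto simp: Basis_complex_def)
  have "(\<lambda>(x, y). Complex x y) -` box l u \<inter> space (lborel \<Otimes>\<^sub>M lborel)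
      = {Re l<..<Re u} \<times> {Im l<..<Im u}"
    by (auto simp: box_def Basis_complex_def space_pair_measure)
  moreover have "(\<lambda>(x, y). Complex x y) \<in> borel_measurable (lborel \<Otimes>\<^sub>M lborel)"
    unfolding Complex_eq by measurable
  ultimately show "emeasure (distr (lborel \<Otimes>\<^sub>M lborel) borel (\<lambda>(x, y). Complex x y)) (box l u) = (\<Prod>b\<in>Basis. (u - l) \<bullet> b)"
    using * by (simp add: emeasure_distr lborel.emeasure_pair_measure_Times Basis_complex_def ennreal_mult)
qed simp

lemma measurable_Complex [measurable]:
  assumes [measurable]: "f \<in> borel_measurable M" "g \<in> borel_measurable M"
  shows "(\<lambda>x. Complex (f x) (g x)) \<in> borel_measurable M"
  unfolding Complex_eq by measurable

text \<open>Tonelli in real and imaginary part. Both orders are recorded because the two kinds of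
  shear below move points along different axes.\<close>

lemma nn_integral_lborel_complex:
  assumes [measurable]: "f \<in> borel_measurable borel"
  shows "(\<integral>\<^sup>+z. f z \<partial>lborel) = (\<integral>\<^sup>+y. \<integral>\<^sup>+x. f (Complex x y) \<partial>lborel \<partial>lborel)"
    and "(\<integral>\<^sup>+z. f z \<partial>lborel) = (\<integral>\<^sup>+x. \<integral>\<^sup>+y. f (Complex x y) \<partial>lborel \<partial>lborel)"
proof -
  have *: "(\<integral>\<^sup>+z. f z \<partial>lborel) = (\<integral>\<^sup>+p. f (Complex (fst p) (snd p)) \<partial>(lborel \<Otimes>\<^sub>M lborel))"
    by (subst lborel_complex_eq[symmetric], subst nn_integral_distr) (auto simp: split_beta')
  show "(\<integral>\<^sup>+z. f z \<partial>lborel) = (\<integral>\<^sup>+y. \<integral>\<^sup>+x. f (Complex x y) \<partial>lborel \<partial>lborel)"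
    unfolding * by (subst lborel_pair.nn_integral_snd[symmetric]) auto
  show "(\<integral>\<^sup>+z. f z \<partial>lborel) = (\<integral>\<^sup>+x. \<integral>\<^sup>+y. f (Complex x y) \<partial>lborel \<partial>lborel)"
    unfolding * by (subst lborel.nn_integral_fst[symmetric]) auto
qed

lemma nn_integral_lborel_translate:
  fixes f :: "real \<Rightarrow> ennreal"
  assumes [measurable]: "f \<in> borel_measurable borel"
  shows "(\<integral>\<^sup>+x. f (x + c) \<partial>lborel) = (\<integral>\<^sup>+x. f x \<partial>lborel)"
  using nn_integral_real_affine[of f 1 c] by (simp add: add.commute)

text \<open>On each horizontal line the shear is a translation, so the inner integral does not
  change.\<close>

lemma nn_integral_shear_Re:
  assumes [measurable]: "f \<in> borel_measurable borel"
  shows "(\<integral>\<^sup>+z. f (Complex (Re z + t * Im z) (Im z)) \<partial>lborel) = (\<integral>\<^sup>+z. f z \<partial>lborel)"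
  by (simp add: nn_integral_lborel_complex(1) nn_integral_lborel_translate[of "\<lambda>x. f (Complex x _)"])

lemma nn_integral_shear_Im:
  assumes [measurable]: "f \<in> borel_measurable borel"
  shows "(\<integral>\<^sup>+z. f (Complex (Re z) (Im z + t * Re z)) \<partial>lborel) = (\<integral>\<^sup>+z. f z \<partial>lborel)"
  by (simp add: nn_integral_lborel_complex(2) nn_integral_lborel_translate[of "\<lambda>x. f (Complex _ x)"])

text \<open>A rotation by an angle other than \<open>\<pi>\<close> is a composition of three shears.\<close>

lemma nn_integral_rotate:
  assumes [measurable]: "f \<in> borel_measurable borel" and c: "cmod c = 1" "c \<noteq> -1"
  shows "(\<integral>\<^sup>+z. f (c * z) \<partial>lborel) = (\<integral>\<^sup>+z. f z \<partial>lborel)"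
proof -
  define a b where "a = Re c" and "b = Im c"
  have ab: "a\<^sup>2 + b\<^sup>2 = 1" using c(1) by (simp add: a_def b_def cmod_def)
  have a1: "1 + a \<noteq> 0"
  proof
    assume "1 + a = 0"
    then have "a = -1" by simp
    moreover from this ab have "b = 0" by simp
    ultimately show False using c(2) by (simp add: a_def b_def complex_eq_iff)
  qed
  \<comment> \<open>For \<open>c\<close> = exp(i \<theta>) this is minus tan(\<theta> / 2), finite
    because \<open>c \<noteq> -1\<close>. The identities \<open>t1\<close> and \<open>t2\<close> are
    the entries of the matrix product of the shears with parameters \<open>t\<close>,
    \<open>b\<close>, \<open>t\<close>.\<close>
  define t where "t = - b / (1 + a)"
  have bb: "b * b = (1 - a) * (1 + a)" using ab by (simp add: power2_eq_square algebra_simps)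
  have t1: "1 + t * b = a" using a1 bb by (simp add: t_def field_simps)
  have "t * (1 + a) = - b" using a1 by (simp add: t_def)
  then have t2: "t + t * a = - b" by (simp add: algebra_simps)
  have "(\<integral>\<^sup>+z. f z \<partial>lborel) = (\<integral>\<^sup>+z. f (Complex (Re z + t * Im z) (Im z)) \<partial>lborel)"
    by (simp add: nn_integral_shear_Re)
  also have "\<dots> = (\<integral>\<^sup>+z. f (Complex (Re z + t * (Im z + b * Re z)) (Im z + b * Re z)) \<partial>lborel)"
    using nn_integral_shear_Im[of "\<lambda>z. f (Complex (Re z + t * Im z) (Im z))" b] by simp
  also have "\<dots> = (\<integral>\<^sup>+z. f (Complex ((Re z + t * Im z) + t * (Im z + b * (Re z + t * Im z))) (Im z + b * (Re z + t * Im z))) \<partial>lborel)"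
    using nn_integral_shear_Re[of "\<lambda>z. f (Complex (Re z + t * (Im z + b * Re z)) (Im z + b * Re z))" t] by simp
  also have "\<dots> = (\<integral>\<^sup>+z. f (c * z) \<partial>lborel)"
  proof (intro nn_integral_cong arg_cong[where f = f])
    fix z :: complex
    have 1: "(x + t * y) + t * (y + b * (x + t * y)) = a * x - b * y" for x y
    proof -
      have "(x + t * y) + t * (y + b * (x + t * y)) = (1 + t * b) * x + (t + t * (1 + t * b)) * y"
        by (simp add: algebra_simps)
      then show ?thesis unfolding t1 t2 by simp
    qed
    have 2: "y + b * (x + t * y) = a * y + b * x" for x y
    proof -
      have "y + b * (x + t * y) = (1 + t * b) * y + b * x" by (simp add: algebra_simps)
      then show ?thesis unfolding t1 .
    qed
    show "Complex ((Re z + t * Im z) + t * (Im z + b * (Re z + t * Im z))) (Im z + b * (Re z + t * Im z)) = c * z"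
      by (subst 1, subst 2) (simp add: complex_eq_iff a_def b_def)
  qed
  finally show ?thesis by simp
qed

lemma distr_lborel_rotate:
  assumes c: "cmod c = 1" "c \<noteq> -1"
  shows "distr lborel borel (\<lambda>z. c * z) = lborel"
proof (rule measure_eqI)
  fix A assume "A \<in> sets (distr lborel borel ((*) c))"
  then have A[measurable]: "A \<in> sets borel" by simp
  show "emeasure (distr lborel borel ((*) c)) A = emeasure lborel A"
    using nn_integral_rotate[of "indicator A" c] c
    by (simp add: nn_integral_distr[symmetric, of "(*) c" _ borel])
qed simp

lemma integral_rotate:
  fixes f :: "complex \<Rightarrow> complex"
  assumes [measurable]: "f \<in> borel_measurable borel" and c: "cmod c = 1" "c \<noteq> -1"
  shows "(LINT z|lborel. f (c * z)) = (LINT z|lborel. f z)"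
  by (subst (2) distr_lborel_rotate[OF c, symmetric], subst integral_distr) auto

section \<open>Polar coordinates for functions of the modulus\<close>

lemma nn_integral_FTC_interval:
  fixes F f :: "real \<Rightarrow> real"
  assumes "a \<le> b"
    and "\<And>x. x \<in> {a..b} \<Longrightarrow> (F has_real_derivative f x) (at x within {a..b})"
    and "\<And>x. x \<in> {a..b} \<Longrightarrow> 0 \<le> f x"
  shows "(\<integral>\<^sup>+x. ennreal (f x) * indicator {a..b} x \<partial>lborel) = ennreal (F b - F a)"
  using fundamental_theorem_of_calculus[of a b F f] assms
  by (intro nn_integral_has_integral_lebesgue') (auto simp: has_real_derivative_iff_has_vector_derivative)

text \<open>Both sides integrate \<open>F\<close> against a measure on the line: the image of disc
  area under \<open>cmod\<close>, and the density \<open>2 * pi * r\<close> on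
  \<open>{0..<1}\<close>. The two measures agree on all rays \<open>{x<..}\<close>, where for 0
  \<le> x < 1 each gives the annulus area \<open>pi - pi * x\<^sup>2\<close>, so they coincide. No
  angular variable is introduced.\<close>

lemma nn_integral_radial:
  fixes F :: "real \<Rightarrow> ennreal"
  assumes [measurable]: "F \<in> borel_measurable borel"
  shows "(\<integral>\<^sup>+z. F (cmod z) * indicator (ball 0 1) z \<partial>lborel)
    = (\<integral>\<^sup>+r. ennreal (2 * pi * r) * F r * indicator {0..<1} r \<partial>lborel)"
proof -
  let ?M = "distr (density lborel (indicator (ball 0 1))) borel cmod"
  let ?N = "density lborel (\<lambda>r. ennreal (2 * pi * r) * indicator {0..<1} r)"
  have ball: "emeasure lborel (ball (0::complex) r) = ennreal (pi * r\<^sup>2)"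
    and cball: "emeasure lborel (cball (0::complex) r) = ennreal (pi * r\<^sup>2)" if "0 \<le> r" for r
    using that by (simp_all add: emeasure_ball emeasure_cball unit_ball_vol_2)
  have M: "emeasure ?M {x<..} = emeasure lborel (ball (0::complex) 1 - cball 0 x)" for x
  proof -
    have [measurable]: "cmod -` {x<..} \<in> sets borel"
      by (intro borel_open open_vimage continuous_intros open_greaterThan)
    have "emeasure ?M {x<..} = (\<integral>\<^sup>+z. indicator (ball (0::complex) 1) z * indicator (cmod -` {x<..}) z \<partial>lborel)"
      using emeasure_density[of "indicator (ball 0 1)" lborel "cmod -` {x<..}", OF borel_measurable_indicator]
      by (simp add: emeasure_distr)
    also have "\<dots> = (\<integral>\<^sup>+z. indicator (ball 0 1 - cball (0::complex) x) z \<partial>lborel)"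
      by (intro nn_integral_cong) (auto simp: indicator_def)
    finally show ?thesis by simp
  qed
  have I: "(\<integral>\<^sup>+r. ennreal (2 * pi * r) * indicator {x..1} r \<partial>lborel) = ennreal (pi - pi * x\<^sup>2)" if "0 \<le> x" "x \<le> 1" for x
    by (subst nn_integral_FTC_interval[where F = "\<lambda>r. pi * r\<^sup>2"]) (use that in \<open>auto intro!: derivative_eq_intros\<close>)
  have MN: "?M = ?N"
  proof (rule measure_eqI_lessThan)
    fix x :: real
    have N: "emeasure ?N {x<..} = (\<integral>\<^sup>+r. ennreal (2 * pi * r) * indicator {max 0 x..1} r \<partial>lborel)" 
    proof -
      have "emeasure ?N {x<..} = (\<integral>\<^sup>+r. ennreal (2 * pi * r) * indicator {0..<1} r * indicator {x<..} r \<partial>lborel)"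
        by (simp add: emeasure_density)
      also have "\<dots> = (\<integral>\<^sup>+r. ennreal (2 * pi * r) * indicator {max 0 x..1} r \<partial>lborel)"
        by (intro nn_integral_cong_AE, use AE_lborel_singleton[of x] AE_lborel_singleton[of 1] in eventually_elim)
           (auto simp: indicator_def)
      finally show ?thesis .
    qed
    consider "x < 0" | "0 \<le> x" "x < 1" | "1 \<le> x" by linarith
    \<comment> \<open>The explicit value is carried along because a measure is determined by its
      values on rays only if these are finite.\<close>
    then have "emeasure ?M {x<..} = ennreal (if x < 0 then pi else if x < 1 then pi - pi * x\<^sup>2 else 0) \<and>
      emeasure ?M {x<..} = emeasure ?N {x<..}"
    proof cases
      case 1
      then show ?thesis unfolding M N using I[of 0] by (simp add: ball)
    next
      case 2
      have "emeasure lborel (ball (0::complex) 1 - cball 0 x) = ennreal pi - ennreal (pi * x\<^sup>2)"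
        using 2 by (subst emeasure_Diff) (auto simp: ball cball)
      then show ?thesis unfolding M N using 2 I[of x] by (simp add: ennreal_minus)
    next
      case 3
      then have *: "ball (0::complex) 1 - cball 0 x = {}" by (auto)
      have "(\<integral>\<^sup>+r. ennreal (2 * pi * r) * indicator {max 0 x..1} r \<partial>lborel) = (\<integral>\<^sup>+r. 0 \<partial>(lborel :: real measure))"
        using 3 by (intro nn_integral_cong_AE, use AE_lborel_singleton[of 1] in eventually_elim)
           (auto simp: indicator_def)
      then show ?thesis unfolding M N * using 3 by simp
    qed
    then show "emeasure ?M {x<..} < \<infinity>" "emeasure ?M {x<..} = emeasure ?N {x<..}" by (auto simp: less_top[symmetric])
  qed auto
  have "(\<integral>\<^sup>+z. F (cmod z) * indicator (ball 0 1) z \<partial>lborel) = (\<integral>\<^sup>+r. F r \<partial>?M)"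
    by (simp add: nn_integral_distr nn_integral_density[OF borel_measurable_indicator] mult.commute)
  also have "\<dots> = (\<integral>\<^sup>+r. ennreal (2 * pi * r) * F r * indicator {0..<1} r \<partial>lborel)"
    unfolding MN by (simp add: nn_integral_density ac_simps)
  finally show ?thesis .
qed

section \<open>Null sets of the plane and the Borel profile of a radial weight\<close>

lemma AE_lborel_complex_slices:
  assumes "AE z in lborel. P z"
  shows "AE y in lborel. AE x in lborel. P (Complex x y)"
proof -
  from AE_E[OF assms] obtain N where N: "{z. \<not> P z} \<subseteq> N" "emeasure lborel N = 0" and [measurable]: "N \<in> sets borel"
    by auto
  have "(\<integral>\<^sup>+y. \<integral>\<^sup>+x. indicator N (Complex x y) \<partial>lborel \<partial>lborel) = 0"
    using N(2) by (simp add: nn_integral_lborel_complex(1)[symmetric])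
  then have "AE y in lborel. (\<integral>\<^sup>+x. indicator N (Complex x y) \<partial>lborel) = 0"
    by (simp add: nn_integral_0_iff_AE)
  then show ?thesis
  proof eventually_elim
    case (elim y)
    then have "AE x in lborel. indicator N (Complex x y) = (0::ennreal)"
      by (simp add: nn_integral_0_iff_AE)
    then show ?case by eventually_elim (use N(1) in \<open>auto simp: indicator_def split: if_splits\<close>)
  qed
qed

text \<open>The polar formula for the indicator of a Borel null set containing the exceptional
  radii.\<close>

lemma AE_lborel_radial:
  assumes "AE r in lborel. P r"
  shows "AE z in lborel. z \<in> ball 0 1 \<longrightarrow> P (cmod z)"
proof -
  from AE_E[OF assms] obtain N where N: "{z. \<not> P z} \<subseteq> N" "emeasure lborel N = 0" and [measurable]: "N \<in> sets borel"
    by auto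
  have "AE r in lborel. r \<notin> N" using N by (intro AE_not_in) (auto simp: null_sets_def)
  then have "(\<integral>\<^sup>+r. ennreal (2 * pi * r) * indicator N r * indicator {0..<1} r \<partial>lborel) = 0"
    by (subst nn_integral_0_iff_AE) (auto elim!: eventually_mono)
  then have 0: "(\<integral>\<^sup>+z. indicator N (cmod z) * indicator (ball 0 1) z \<partial>lborel) = 0"
    by (simp add: nn_integral_radial)
  have [measurable]: "(\<lambda>z. indicator N (cmod z) :: ennreal) \<in> borel_measurable borel"
    by (rule measurable_compose[of cmod borel borel]) auto
  have "(\<lambda>z. indicator N (cmod z) * indicator (ball 0 1) z :: ennreal) \<in> borel_measurable lborel"
    by (intro borel_measurable_times_ennreal borel_measurable_indicator) auto
  from nn_integral_0_iff_AE[OF this] 0 have "AE z in lborel. indicator N (cmod z) * indicator (ball 0 1) z = (0::ennreal)"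
    by simp
  then show ?thesis
    by eventually_elim (use N in \<open>auto simp: indicator_def split: if_splits\<close>)
qed

lemma AE_lborel_ex_in_interval:
  fixes a b :: real
  assumes "AE y in lborel. P y" "a < b"
  shows "\<exists>y. a < y \<and> y < b \<and> P y"
proof (rule ccontr)
  assume "\<not> ?thesis"
  then have "AE y in lborel. y \<notin> {a<..<b}" using assms(1) by (auto elim!: eventually_mono)
  moreover have "{x. a < x \<and> x < b} = {a<..<b}" by auto
  ultimately have "emeasure lborel {a<..<b} = 0" by (subst (asm) AE_iff_measurable[OF _ refl]) auto
  then show False using assms(2) by simp
qed

text \<open>Off almost every horizontal line \<open>Im z = y\<close>, the radial function is read off at the point
  of modulus \<open>\<rho>\<close> on that line; the change of variable \<open>x \<mapsto> sqrt (x\<^sup>2 + y\<^sup>2)\<close> preserves null sets.\<close>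

lemma radial_borel_representative:
  fixes v :: "complex \<Rightarrow> real"
  assumes meas: "(\<lambda>z. indicator (ball 0 1) z * v z) \<in> borel_measurable lebesgue"
    and radial: "\<And>z. z \<in> ball 0 1 \<Longrightarrow> v z = v (complex_of_real (cmod z))"
    and pos: "\<And>z. z \<in> ball 0 1 \<Longrightarrow> 0 < v z"
  obtains u :: "real \<Rightarrow> real" where "u \<in> borel_measurable borel" "\<And>r. 0 \<le> u r"
    "AE r in lborel. 0 < r \<and> r < 1 \<longrightarrow> v (complex_of_real r) = u r"
    "AE z in lborel. z \<in> ball 0 1 \<longrightarrow> v z = u (cmod z)"
proof -
  from completion_ex_borel_measurable_real[OF meas] obtain v'
    where v'[measurable]: "v' \<in> borel_measurable borel" and
      "AE z in lborel. indicator (ball 0 1) z * v z = v' z" by auto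
  from AE_lborel_complex_slices[OF this(2)]
  have *: "AE y in lborel. AE x in lborel. indicator (ball 0 1) (Complex x y) * v (Complex x y) = v' (Complex x y)" .
  \<comment> \<open>The line at height y only meets circles of radius at least y, so good heights
    tending to 0 are required to reach every radius.\<close>
  have "\<exists>y. 0 < y \<and> y < 1 / real (Suc n) \<and>
    (AE x in lborel. indicator (ball 0 1) (Complex x y) * v (Complex x y) = v' (Complex x y))" for n
    using AE_lborel_ex_in_interval[OF *, of 0 "1 / real (Suc n)"] by auto
  then obtain y where "\<forall>n. 0 < y n \<and> y n < 1 / real (Suc n) \<and>
    (AE x in lborel. indicator (ball 0 1) (Complex x (y n)) * v (Complex x (y n)) = v' (Complex x (y n)))"
    using choice[of "\<lambda>n y. 0 < y \<and> y < 1 / real (Suc n) \<and>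
      (AE x in lborel. indicator (ball 0 1) (Complex x y) * v (Complex x y) = v' (Complex x y))"] by blast
  then have y: "0 < y n" "y n < 1 / real (Suc n)"
    "AE x in lborel. indicator (ball 0 1) (Complex x (y n)) * v (Complex x (y n)) = v' (Complex x (y n))" for n
    by blast+
  have sl: "AE \<rho> in lborel. y n < \<rho> \<and> \<rho> < 1 \<longrightarrow> v (complex_of_real \<rho>) = v' (Complex (sqrt (\<rho>\<^sup>2 - (y n)\<^sup>2)) (y n))" for n
  proof -
    from AE_E[OF y(3)[of n]] obtain N where N: "{x. indicator (ball 0 1) (Complex x (y n)) * v (Complex x (y n)) \<noteq> v' (Complex x (y n))} \<subseteq> N"
        "N \<in> null_sets lborel"
      by (auto simp: null_sets_def)
    have "negligible N" using N(2) by (simp add: negligible_iff_null_sets null_sets_completionI)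
    then have "negligible ((\<lambda>x. sqrt (x\<^sup>2 + (y n)\<^sup>2)) ` N)"
    proof (intro negligible_differentiable_image_negligible)
      show "(\<lambda>x. sqrt (x\<^sup>2 + (y n)\<^sup>2)) differentiable_on N"
        unfolding differentiable_on_def
      proof
        fix x
        have "0 < x\<^sup>2 + (y n)\<^sup>2" using y(1)[of n] by (simp add: add_nonneg_pos)
        then have "((\<lambda>x. sqrt (x\<^sup>2 + (y n)\<^sup>2)) has_real_derivative (2 * x * (inverse (sqrt (x\<^sup>2 + (y n)\<^sup>2)) / 2))) (at x within N)"
          by (auto intro!: derivative_eq_intros)
        then show "(\<lambda>x. sqrt (x\<^sup>2 + (y n)\<^sup>2)) differentiable at x within N"
          unfolding has_field_derivative_def by (rule differentiableI)
      qed
    qed auto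
    then have "AE \<rho> in lebesgue. \<rho> \<notin> (\<lambda>x. sqrt (x\<^sup>2 + (y n)\<^sup>2)) ` N"
      by (simp add: negligible_iff_null_sets AE_not_in)
    then have "AE \<rho> in lborel. \<rho> \<notin> (\<lambda>x. sqrt (x\<^sup>2 + (y n)\<^sup>2)) ` N" by (simp add: AE_completion_iff)
    then show ?thesis
    proof eventually_elim
      case (elim \<rho>)
      show ?case
      proof
        assume \<rho>: "y n < \<rho> \<and> \<rho> < 1"
        let ?x = "sqrt (\<rho>\<^sup>2 - (y n)\<^sup>2)"
        have p: "(y n)\<^sup>2 \<le> \<rho>\<^sup>2" using \<rho> y(1)[of n] by (intro power_mono) auto
        have "0 < \<rho>" using \<rho> y(1)[of n] by linarith
        have x2: "?x\<^sup>2 = \<rho>\<^sup>2 - (y n)\<^sup>2" using p by (intro real_sqrt_pow2) linarith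
        have x: "sqrt (?x\<^sup>2 + (y n)\<^sup>2) = \<rho>" unfolding x2 using \<open>0 < \<rho>\<close> by simp
        have "?x \<notin> N"
        proof
          assume "?x \<in> N"
          from imageI[OF this, of "\<lambda>x. sqrt (x\<^sup>2 + (y n)\<^sup>2)"] show False
            using elim unfolding x by blast
        qed
        then have "indicator (ball 0 1) (Complex ?x (y n)) * v (Complex ?x (y n)) = v' (Complex ?x (y n))"
          using N(1) by blast
        moreover have c: "cmod (Complex ?x (y n)) = \<rho>" unfolding cmod_def complex.sel by (fact x)
        moreover have b: "Complex ?x (y n) \<in> ball 0 1" unfolding mem_ball dist_0_norm c using \<rho> by blast
        ultimately show "v (complex_of_real \<rho>) = v' (Complex ?x (y n))"
          using radial[OF b] by (metis c indicator_simps(1) mult_1)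
      qed
    qed
  qed
  \<comment> \<open>Index of the first chosen line that meets the circle of radius
    \<open>\<rho>\<close>. Since it takes countably many values in a Borel way, gluing the slices
    along it keeps the profile Borel.\<close>
  define k where "k \<rho> = (LEAST n. y n < \<rho>)" for \<rho>
  have k: "y (k \<rho>) < \<rho>" if "0 < \<rho>" for \<rho>
    unfolding k_def
  proof (rule LeastI_ex)
    obtain n where "1 / real (Suc n) < \<rho>" using \<open>0 < \<rho>\<close> by (metis inverse_eq_divide reals_Archimedean)
    then show "\<exists>n. y n < \<rho>" using y(2)[of n] by (intro exI[of _ n]) linarith
  qed
  have [measurable]: "k \<in> measurable borel (count_space UNIV)"
    unfolding k_def by measurable
  \<comment> \<open>The maximum with 0 makes the profile nonnegative everywhere; at almost every
    radius in (0, 1) it changes nothing, because \<open>v\<close> is positive on the disc.\<close>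
  define u where "u \<rho> = max 0 (v' (Complex (sqrt (\<rho>\<^sup>2 - (y (k \<rho>))\<^sup>2)) (y (k \<rho>))))" for \<rho>
  have u1: "u \<in> borel_measurable borel"
    unfolding u_def
    by (intro borel_measurable_max borel_measurable_const measurable_compose_countable[where f = "\<lambda>n \<rho>. v' (Complex (sqrt (\<rho>\<^sup>2 - (y n)\<^sup>2)) (y n))" and g = k]) auto
  have "AE \<rho> in lborel. \<forall>n. y n < \<rho> \<and> \<rho> < 1 \<longrightarrow> v (complex_of_real \<rho>) = v' (Complex (sqrt (\<rho>\<^sup>2 - (y n)\<^sup>2)) (y n))"
    using sl by (simp add: AE_all_countable)
  then have u3: "AE r in lborel. 0 < r \<and> r < 1 \<longrightarrow> v (complex_of_real r) = u r"
  proof eventually_elim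
    case (elim r)
    show ?case
    proof
      assume r: "0 < r \<and> r < 1"
      then have "v (complex_of_real r) = v' (Complex (sqrt (r\<^sup>2 - (y (k r))\<^sup>2)) (y (k r)))" using elim k[of r] by blast
      moreover have "0 < v (complex_of_real r)" using r by (intro pos) simp
      ultimately show "v (complex_of_real r) = u r" by (simp add: u_def)
    qed
  qed
  have u4: "AE z in lborel. z \<in> ball 0 1 \<longrightarrow> v z = u (cmod z)"
    using AE_lborel_radial[OF u3] AE_lborel_singleton[of 0]
  proof eventually_elim
    case (elim z)
    then show ?case using radial[of z] by auto
  qed
  show ?thesis using that[of u] u1 u3 u4 by (simp add: u_def)
qed

section \<open>Parseval identity for radial weights\<close>

lemma measurable_cnj [measurable]: "cnj \<in> borel_measurable borel"
  by (intro borel_measurable_continuous_onI continuous_intros)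

lemma measurable_ball [measurable]: "ball a r \<in> sets borel"
  by simp

text \<open>Continuity from below of the measure with density \<open>F\<close>. It is used to
  exhaust the disc by smaller discs and half-open intervals by smaller intervals.\<close>

lemma nn_integral_UN_incseq:
  assumes [measurable]: "F \<in> borel_measurable M" and A: "range A \<subseteq> sets M" "incseq (A :: nat \<Rightarrow> _)"
  shows "(\<integral>\<^sup>+x. F x * indicator (\<Union>n. A n) x \<partial>M) = (SUP n. \<integral>\<^sup>+x. F x * indicator (A n) x \<partial>M)"
proof -
  have "(SUP n. emeasure (density M F) (A n)) = emeasure (density M F) (\<Union>n. A n)"
    using A by (intro SUP_emeasure_incseq) auto
  then show ?thesis using A by (simp add: emeasure_density)
qed

lemma ball_0_1_eq_UN: "ball (0::complex) 1 = (\<Union>n::nat. ball 0 (1 - 1 / real (Suc n)))"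
proof (intro equalityI subsetI)
  fix z :: complex assume "z \<in> ball 0 1"
  then have "0 < 1 - cmod z" by simp
  then obtain n where "1 / real (Suc n) < 1 - cmod z" by (metis inverse_eq_divide reals_Archimedean)
  then have "z \<in> ball 0 (1 - 1 / real (Suc n))" by simp
  then show "z \<in> (\<Union>n::nat. ball 0 (1 - 1 / real (Suc n)))" by blast
qed (auto simp: less_le_trans)

text \<open>Rotation by the angle pi / (2 |n - m|) multiplies the integrand by i or -i and preserves
  the integral, which must therefore vanish. The angle is at most pi / 2, so the excluded rotation
  by pi never occurs.\<close>

lemma integral_radial_monomial_eq_0:
  fixes u :: "real \<Rightarrow> real"
  assumes [measurable]: "u \<in> borel_measurable borel" and "n \<noteq> m"
  shows "(LINT z|lborel. z ^ n * cnj z ^ m * complex_of_real (indicator (ball 0 R) z * u (cmod z))) = 0"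
proof -
  define k where "k = \<bar>real n - real m\<bar>"
  have k: "1 \<le> k" using \<open>n \<noteq> m\<close> by (auto simp: k_def)
  define \<theta> where "\<theta> = pi / (2 * k)"
  define c where "c = cis \<theta>"
  have \<theta>: "0 < \<theta>" "\<theta> \<le> pi / 2" using k by (auto simp: \<theta>_def field_simps)
  then have "0 \<le> cos \<theta>" by (intro cos_ge_zero) auto
  then have c: "cmod c = 1" "c \<noteq> -1" by (auto simp: c_def complex_eq_iff)
  have e: "c ^ n * cnj c ^ m = cis ((real n - real m) * \<theta>)"
    by (simp add: c_def cis_cnj Complex.DeMoivre cis_mult algebra_simps)
  have "(real n - real m) * \<theta> = pi / 2 \<or> (real n - real m) * \<theta> = - pi / 2"
    using k by (auto simp: \<theta>_def k_def field_simps abs_if split: if_splits)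
  then have "cis ((real n - real m) * \<theta>) = \<i> \<or> cis ((real n - real m) * \<theta>) = - \<i>"
    by (elim disjE) (simp_all only: minus_divide_left[symmetric] cis_minus_pi_half cis_pi_half simp_thms)
  then have ne: "c ^ n * cnj c ^ m \<noteq> 1" unfolding e by (auto simp: complex_eq_iff)
  let ?f = "\<lambda>z. z ^ n * cnj z ^ m * complex_of_real (indicator (ball 0 R) z * u (cmod z))"
  have [measurable]: "?f \<in> borel_measurable borel"
    by measurable
  have "?f (c * z) = (c ^ n * cnj c ^ m) * ?f z" for z
    using c(1) by (simp add: power_mult_distrib norm_mult indicator_def)
  then have "(c ^ n * cnj c ^ m) * (LINT z|lborel. ?f z) = (LINT z|lborel. ?f (c * z))"
    by simp
  also have "\<dots> = (LINT z|lborel. ?f z)"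
    by (rule integral_rotate[OF _ c]) simp
  finally have "(c ^ n * cnj c ^ m - 1) * (LINT z|lborel. ?f z) = 0" by (simp only: left_diff_distrib) simp
  then show ?thesis using ne by (simp only: mult_eq_0_iff) auto
qed

text \<open>For partial sums the square expands into monomials whose off-diagonal integrals vanish.
  Summability at radius \<open>R\<close> bounds all partial sums on the ball by one constant
  \<open>B\<close>, so \<open>B\<^sup>2 * U\<close> dominates and the limit may be taken under the
  integral; the diagonal terms are nonnegative and are summed by monotone convergence.\<close>

lemma nn_integral_power_series_ball:
  fixes u :: "real \<Rightarrow> real" and b :: "nat \<Rightarrow> complex"
  assumes [measurable]: "u \<in> borel_measurable borel" and u0: "\<And>r. 0 \<le> u r"
    and R: "R \<le> 1" and int: "integrable lborel (\<lambda>z. indicator (ball (0::complex) R) z * u (cmod z))"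
    and sum: "summable (\<lambda>n. cmod (b n) * R ^ n)"
  shows "(\<integral>\<^sup>+z. ennreal ((cmod (\<Sum>n. b n * z ^ n))\<^sup>2) * ennreal (u (cmod z)) * indicator (ball 0 R) z \<partial>lborel)
    = (\<integral>\<^sup>+z. (\<Sum>n. ennreal ((cmod (b n))\<^sup>2 * cmod z ^ (2 * n))) * ennreal (u (cmod z)) * indicator (ball 0 R) z \<partial>lborel)"
proof -
  define U where "U z = indicator (ball (0::complex) R) z * u (cmod z)" for z
  have Uint: "integrable lborel U" using int by (simp add: U_def[abs_def])
  then have [measurable]: "U \<in> borel_measurable borel" using borel_measurable_integrable by fastforce
  have U0: "0 \<le> U z" for z by (simp add: U_def u0)
  have mono_int: "integrable lborel (\<lambda>z. z ^ n * cnj z ^ m * complex_of_real (U z))" for n m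
  proof (rule Bochner_Integration.integrable_bound[OF Uint])
    show "AE z in lborel. cmod (z ^ n * cnj z ^ m * complex_of_real (U z)) \<le> norm (U z)"
    proof (intro AE_I2)
      fix z :: complex
      show "cmod (z ^ n * cnj z ^ m * complex_of_real (U z)) \<le> norm (U z)"
      proof (cases "cmod z < R")
        case True
        then have "cmod z \<le> 1" using R by linarith
        then have "cmod z ^ n * cmod z ^ m \<le> 1" by (intro mult_le_one power_le_one) auto
        then show ?thesis using U0[of z] by (simp add: norm_mult norm_power mult_left_le_one_le)
      qed (simp add: U_def)
    qed
    show "(\<lambda>z. z ^ n * cnj z ^ m * complex_of_real (U z)) \<in> borel_measurable lborel"
      by measurable
  qed
  define c where "c n = (LINT z|lborel. cmod z ^ (2 * n) * U z)" for n
  have sq_int: "integrable lborel (\<lambda>z. cmod z ^ (2 * n) * U z)" for n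
    using integrable_norm[OF mono_int[of n n]] U0 by (simp add: norm_mult norm_power power_add[symmetric] mult_2)
  have part: "(LINT z|lborel. (cmod (\<Sum>n<N. b n * z ^ n))\<^sup>2 * U z) = (\<Sum>n<N. (cmod (b n))\<^sup>2 * c n)" for N
  proof -
    have "complex_of_real (LINT z|lborel. (cmod (\<Sum>n<N. b n * z ^ n))\<^sup>2 * U z)
      = (LINT z|lborel. complex_of_real ((cmod (\<Sum>n<N. b n * z ^ n))\<^sup>2 * U z))"
      by (rule integral_complex_of_real[symmetric])
    also have "\<dots> = (LINT z|lborel. (\<Sum>n<N. \<Sum>m<N. b n * cnj (b m) * (z ^ n * cnj z ^ m * complex_of_real (U z))))"
    proof (intro Bochner_Integration.integral_cong refl)
      fix z
      have "complex_of_real ((cmod (\<Sum>n<N. b n * z ^ n))\<^sup>2 * U z) 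
        = (\<Sum>n<N. b n * z ^ n) * cnj (\<Sum>n<N. b n * z ^ n) * complex_of_real (U z)"
        by (simp only: of_real_mult complex_norm_square)
      also have "\<dots> = (\<Sum>n<N. \<Sum>m<N. b n * cnj (b m) * (z ^ n * cnj z ^ m * complex_of_real (U z)))"
        unfolding cnj_sum complex_cnj_mult complex_cnj_power sum_product
        unfolding sum_distrib_right
        by (intro sum.cong refl) (simp only: mult_ac)
      finally show "complex_of_real ((cmod (\<Sum>n<N. b n * z ^ n))\<^sup>2 * U z) = \<dots>" .
    qed
    also have "\<dots> = (\<Sum>n<N. \<Sum>m<N. b n * cnj (b m) * (LINT z|lborel. z ^ n * cnj z ^ m * complex_of_real (U z)))"
      by (simp add: mono_int integrable_sum)
    also have "\<dots> = (\<Sum>n<N. \<Sum>m<N. if m = n then b n * cnj (b n) * complex_of_real (c n) else 0)"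
    proof (intro sum.cong refl)
      fix n m
      have "(LINT z|lborel. z ^ n * cnj z ^ n * complex_of_real (U z)) = complex_of_real (c n)"
        unfolding c_def integral_complex_of_real[symmetric]
        by (intro Bochner_Integration.integral_cong refl) 
           (simp add: power_mult_distrib[symmetric] complex_norm_square[symmetric] power_mult)
      moreover have "(LINT z|lborel. z ^ n * cnj z ^ m * complex_of_real (U z)) = 0" if "m \<noteq> n"
        using integral_radial_monomial_eq_0[of u n m R] that by (simp add: U_def)
      ultimately show "b n * cnj (b m) * (LINT z|lborel. z ^ n * cnj z ^ m * complex_of_real (U z))
        = (if m = n then b n * cnj (b n) * complex_of_real (c n) else 0)" by simp
    qed
    also have "\<dots> = (\<Sum>n<N. b n * cnj (b n) * complex_of_real (c n))"
      by simp
    also have "\<dots> = complex_of_real (\<Sum>n<N. (cmod (b n))\<^sup>2 * c n)"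
      unfolding of_real_sum of_real_mult complex_norm_square ..
    finally show ?thesis by (simp only: of_real_eq_iff)
  qed
  define f where "f z = (\<Sum>n. b n * z ^ n)" for z
  define B where "B = (\<Sum>n. cmod (b n) * R ^ n)"
  have bound: "summable (\<lambda>n. b n * z ^ n)" "cmod (\<Sum>n<N. b n * z ^ n) \<le> B" if "cmod z < R" for z N
  proof -
    have le: "cmod (b n * z ^ n) \<le> cmod (b n) * R ^ n" for n
      using that by (auto simp: norm_mult norm_power intro!: mult_left_mono power_mono)
    show "summable (\<lambda>n. b n * z ^ n)"
      by (rule summable_comparison_test'[OF sum, of 0]) (use le in auto)
    have "cmod (\<Sum>n<N. b n * z ^ n) \<le> (\<Sum>n<N. cmod (b n) * R ^ n)"
      by (rule order_trans[OF norm_sum]) (intro sum_mono le)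
    also have "\<dots> \<le> B" unfolding B_def
      using that by (intro sum_le_suminf sum) (auto intro!: mult_nonneg_nonneg zero_le_power intro: order_trans[OF norm_ge_zero less_imp_le])
    finally show "cmod (\<Sum>n<N. b n * z ^ n) \<le> B" .
  qed
  have ptw: "(\<lambda>N. (cmod (\<Sum>n<N. b n * z ^ n))\<^sup>2 * U z) \<longlonglongrightarrow> (cmod (f z))\<^sup>2 * U z" for z
  proof (cases "cmod z < R")
    case True
    from summable_LIMSEQ[OF bound(1)[OF True]] show ?thesis
      unfolding f_def by (intro tendsto_intros)
  qed (simp add: U_def)
  have [measurable]: "(\<lambda>z. (cmod (\<Sum>n<N. b n * z ^ n))\<^sup>2 * U z) \<in> borel_measurable borel" for N
    by measurable
  have fm[measurable]: "(\<lambda>z. (cmod (f z))\<^sup>2 * U z) \<in> borel_measurable lborel"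
    by (rule borel_measurable_LIMSEQ_real[OF ptw]) simp
  have dom: "AE z in lborel. norm ((cmod (\<Sum>n<N. b n * z ^ n))\<^sup>2 * U z) \<le> B\<^sup>2 * U z" for N
  proof (intro AE_I2)
    fix z
    show "norm ((cmod (\<Sum>n<N. b n * z ^ n))\<^sup>2 * U z) \<le> B\<^sup>2 * U z"
    proof (cases "cmod z < R")
      case True
      then show ?thesis using bound(2)[OF True, of N] U0[of z] by (auto simp: abs_mult intro!: mult_right_mono power_mono)
    qed (simp add: U_def)
  qed
  have f_int: "integrable lborel (\<lambda>z. (cmod (f z))\<^sup>2 * U z)"
    by (rule integrable_dominated_convergence[OF fm _ integrable_mult_right[OF Uint, of "B\<^sup>2"] _ dom]) (auto intro: ptw)
  have "(\<lambda>N. LINT z|lborel. (cmod (\<Sum>n<N. b n * z ^ n))\<^sup>2 * U z) \<longlonglongrightarrow> (LINT z|lborel. (cmod (f z))\<^sup>2 * U z)"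
    by (rule integral_dominated_convergence[OF fm _ integrable_mult_right[OF Uint, of "B\<^sup>2"] _ dom]) (auto intro: ptw)
  then have sums: "(\<lambda>n. (cmod (b n))\<^sup>2 * c n) sums (LINT z|lborel. (cmod (f z))\<^sup>2 * U z)"
    unfolding part sums_def .
  have c0: "0 \<le> c n" for n unfolding c_def by (rule Bochner_Integration.integral_nonneg) (simp add: U0)
  have "(\<integral>\<^sup>+z. ennreal ((cmod (f z))\<^sup>2) * ennreal (u (cmod z)) * indicator (ball 0 R) z \<partial>lborel)
     = (\<integral>\<^sup>+z. ennreal ((cmod (f z))\<^sup>2 * U z) \<partial>lborel)"
    by (intro nn_integral_cong) (auto simp: U_def indicator_def ennreal_mult u0)
  also have "\<dots> = ennreal (LINT z|lborel. (cmod (f z))\<^sup>2 * U z)"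
    by (intro nn_integral_eq_integral f_int AE_I2) (simp add: U0)
  also have "\<dots> = (\<Sum>n. ennreal ((cmod (b n))\<^sup>2 * c n))"
    using sums c0 by (intro suminf_ennreal_eq[symmetric]) auto
  also have "\<dots> = (\<Sum>n. (\<integral>\<^sup>+z. ennreal ((cmod (b n))\<^sup>2 * (cmod z ^ (2 * n) * U z)) \<partial>lborel))"
  proof (intro suminf_cong)
    fix n
    have "(\<integral>\<^sup>+z. ennreal ((cmod (b n))\<^sup>2 * (cmod z ^ (2 * n) * U z)) \<partial>lborel)
      = ennreal (LINT z|lborel. (cmod (b n))\<^sup>2 * (cmod z ^ (2 * n) * U z))"
      by (rule nn_integral_eq_integral[OF integrable_mult_right[OF sq_int]]) (simp add: U0)
    then show "ennreal ((cmod (b n))\<^sup>2 * c n) = (\<integral>\<^sup>+z. ennreal ((cmod (b n))\<^sup>2 * (cmod z ^ (2 * n) * U z)) \<partial>lborel)"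
      by (simp add: c_def)
  qed
  also have "\<dots> = (\<integral>\<^sup>+z. (\<Sum>n. ennreal ((cmod (b n))\<^sup>2 * (cmod z ^ (2 * n) * U z))) \<partial>lborel)"
    by (rule nn_integral_suminf[symmetric]) measurable
  also have "\<dots> = (\<integral>\<^sup>+z. (\<Sum>n. ennreal ((cmod (b n))\<^sup>2 * cmod z ^ (2 * n))) * ennreal (u (cmod z)) * indicator (ball 0 R) z \<partial>lborel)"
  proof (intro nn_integral_cong)
    fix z
    have "ennreal ((cmod (b n))\<^sup>2 * (cmod z ^ (2 * n) * U z))
      = ennreal ((cmod (b n))\<^sup>2 * cmod z ^ (2 * n)) * (ennreal (u (cmod z)) * indicator (ball 0 R) z)" for n
      by (cases "z \<in> ball 0 R") (simp_all add: U_def ennreal_mult[symmetric] u0 mult.assoc)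
    then show "(\<Sum>n. ennreal ((cmod (b n))\<^sup>2 * (cmod z ^ (2 * n) * U z)))
      = (\<Sum>n. ennreal ((cmod (b n))\<^sup>2 * cmod z ^ (2 * n))) * ennreal (u (cmod z)) * indicator (ball 0 R) z"
      by (simp only: ennreal_suminf_multc mult.assoc)
  qed
  finally show ?thesis unfolding f_def .
qed

text \<open>The series need not stay bounded up to the unit circle, so the identity is taken on
  balls of radius below 1. Both sides increase with the radius, which permits the limit without any
  finiteness.\<close>

lemma nn_integral_power_series_disc:
  fixes u :: "real \<Rightarrow> real" and b :: "nat \<Rightarrow> complex"
  assumes [measurable]: "u \<in> borel_measurable borel" and u0: "\<And>r. 0 \<le> u r"
    and int: "integrable lborel (\<lambda>z. indicator (ball (0::complex) 1) z * u (cmod z))"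
    and sum: "\<And>R. 0 \<le> R \<Longrightarrow> R < 1 \<Longrightarrow> summable (\<lambda>n. cmod (b n) * R ^ n)"
    and [measurable]: "(\<lambda>z. \<Sum>n. b n * z ^ n) \<in> borel_measurable borel"
  shows "(\<integral>\<^sup>+z. ennreal ((cmod (\<Sum>n. b n * z ^ n))\<^sup>2) * ennreal (u (cmod z)) * indicator (ball 0 1) z \<partial>lborel)
    = (\<integral>\<^sup>+r. ennreal (2 * pi * r) * ((\<Sum>n. ennreal ((cmod (b n))\<^sup>2 * r ^ (2 * n))) * ennreal (u r)) * indicator {0..<1} r \<partial>lborel)"
proof -
  have inc: "incseq (\<lambda>n::nat. ball (0::complex) (1 - 1 / real (Suc n)))"
    by (intro monoI subset_ball diff_left_mono divide_left_mono) auto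
  have eq: "(\<integral>\<^sup>+z. ennreal ((cmod (\<Sum>n. b n * z ^ n))\<^sup>2) * ennreal (u (cmod z)) * indicator (ball 0 R) z \<partial>lborel)
    = (\<integral>\<^sup>+z. (\<Sum>n. ennreal ((cmod (b n))\<^sup>2 * cmod z ^ (2 * n))) * ennreal (u (cmod z)) * indicator (ball 0 R) z \<partial>lborel)"
    if "0 \<le> R" "R < 1" for R
  proof (rule nn_integral_power_series_ball)
    show "integrable lborel (\<lambda>z. indicator (ball (0::complex) R) z * u (cmod z))"
    proof (rule Bochner_Integration.integrable_bound[OF int])
      show "(\<lambda>z. indicator (ball (0::complex) R) z * u (cmod z)) \<in> borel_measurable lborel" by measurable
      show "AE z in lborel. norm (indicator (ball (0::complex) R) z * u (cmod z)) \<le> norm (indicator (ball (0::complex) 1) z * u (cmod z))"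
        using \<open>R < 1\<close> u0 by (intro AE_I2) (simp add: indicator_def)
    qed
    show "R \<le> 1" "summable (\<lambda>n. cmod (b n) * R ^ n)" using that sum by simp_all
  qed (simp_all add: u0)
  have "(\<integral>\<^sup>+z. ennreal ((cmod (\<Sum>n. b n * z ^ n))\<^sup>2) * ennreal (u (cmod z)) * indicator (ball 0 1) z \<partial>lborel)
    = (\<integral>\<^sup>+z. (\<Sum>n. ennreal ((cmod (b n))\<^sup>2 * cmod z ^ (2 * n))) * ennreal (u (cmod z)) * indicator (ball 0 1) z \<partial>lborel)"
  proof -
    have r: "range (\<lambda>n::nat. ball (0::complex) (1 - 1 / real (Suc n))) \<subseteq> sets lborel" by auto
    have m1: "(\<lambda>z. ennreal ((cmod (\<Sum>n. b n * z ^ n))\<^sup>2) * ennreal (u (cmod z))) \<in> borel_measurable lborel"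
      and m2: "(\<lambda>z. (\<Sum>n. ennreal ((cmod (b n))\<^sup>2 * cmod z ^ (2 * n))) * ennreal (u (cmod z))) \<in> borel_measurable lborel"
      by measurable
    note eq1 = nn_integral_UN_incseq[OF m1 r inc]
    note eq2 = nn_integral_UN_incseq[OF m2 r inc]
    have R: "0 \<le> 1 - 1 / real (Suc n)" "1 - 1 / real (Suc n) < 1" for n by (simp_all add: field_simps)
    show ?thesis
      unfolding ball_0_1_eq_UN eq1 eq2 by (intro SUP_cong refl eq R)
  qed
  also have "\<dots> = (\<integral>\<^sup>+r. ennreal (2 * pi * r) * ((\<Sum>n. ennreal ((cmod (b n))\<^sup>2 * r ^ (2 * n))) * ennreal (u r)) * indicator {0..<1} r \<partial>lborel)"
    by (rule nn_integral_radial) measurable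
  finally show ?thesis .
qed

section \<open>The Hilbert operator as a power series\<close>

text \<open>These are the Taylor coefficients of \<open>hilbert_op \<phi>\<close> at the origin: the
  factor t^n comes from the geometric expansion of 1 / (1 - t z).\<close>

definition moment :: "(real \<Rightarrow> complex) \<Rightarrow> nat \<Rightarrow> complex" where
  "moment \<phi> n = (LINT t:{0..<1}|lebesgue. complex_of_real (t ^ n) * \<phi> t)"

lemma borel_measurable_lebesgueI: "f \<in> borel_measurable borel \<Longrightarrow> f \<in> borel_measurable lebesgue"
  by (rule measurable_completion) simp

context
  fixes \<phi> :: "real \<Rightarrow> complex"
  assumes \<phi>: "set_integrable lebesgue {0..<1} \<phi>"
begin

lemma moment_set_integrable:
  "set_integrable lebesgue {0..<1} (\<lambda>t. complex_of_real (t ^ n) * \<phi> t)"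
  unfolding set_integrable_def
proof (rule Bochner_Integration.integrable_bound[OF \<phi>[unfolded set_integrable_def]])
  have [measurable]: "(\<lambda>t. complex_of_real (t ^ n)) \<in> borel_measurable lebesgue"
    by (rule borel_measurable_lebesgueI) measurable
  have [measurable]: "(\<lambda>t. indicat_real {0..<1} t *\<^sub>R \<phi> t) \<in> borel_measurable lebesgue"
    using \<phi> unfolding set_integrable_def by (rule borel_measurable_integrable)
  have "(\<lambda>t. complex_of_real (t ^ n) * (indicat_real {0..<1} t *\<^sub>R \<phi> t)) \<in> borel_measurable lebesgue"
    by (rule borel_measurable_times) measurable
  then show "(\<lambda>t. indicat_real {0..<1} t *\<^sub>R (complex_of_real (t ^ n) * \<phi> t)) \<in> borel_measurable lebesgue"
    by simp
  show "AE t in lebesgue. norm (indicat_real {0..<1} t *\<^sub>R (complex_of_real (t ^ n) * \<phi> t)) \<le> norm (indicat_real {0..<1} t *\<^sub>R \<phi> t)"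
    by (intro AE_I2) (auto simp: indicator_def norm_mult norm_power power_le_one intro!: mult_left_le_one_le)
qed

lemma moment_bound: "cmod (moment \<phi> n) \<le> (LINT t:{0..<1}|lebesgue. cmod (\<phi> t))"
proof -
  have "cmod (moment \<phi> n) \<le> (LINT t:{0..<1}|lebesgue. cmod (complex_of_real (t ^ n) * \<phi> t))"
    unfolding moment_def by (rule set_integral_norm_bound[OF moment_set_integrable])
  also have "\<dots> \<le> (LINT t:{0..<1}|lebesgue. cmod (\<phi> t))"
    by (rule set_integral_mono[OF set_integrable_norm[OF moment_set_integrable] set_integrable_norm[OF \<phi>]])
      (auto intro!: mult_left_le_one_le simp: norm_mult norm_power power_le_one)
  finally show ?thesis .
qed

text \<open>Termwise integration of the geometric series. The integrals of the norms of the terms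
  are at most the integral of |\<open>\<phi>\<close>| times |z|^n, which is summable in the
  disc.\<close>

lemma hilbert_op_sums:
  assumes z: "cmod z < 1"
  shows "(\<lambda>n. moment \<phi> n * z ^ n) sums hilbert_op \<phi> z"
proof -
  define f where "f n t = indicat_real {0..<1} t *\<^sub>R (complex_of_real (t ^ n) * \<phi> t) * z ^ n" for n t
  have int: "integrable lebesgue (f n)" for n
    unfolding f_def[abs_def] using moment_set_integrable[of n] unfolding set_integrable_def by (rule integrable_mult_left)
  have geo: "(\<lambda>n. f n t) sums (indicat_real {0..<1} t *\<^sub>R (\<phi> t / (1 - complex_of_real t * z)))"
    and nsum: "summable (\<lambda>n. norm (f n t))" for t
  proof -
    have "(\<lambda>n. f n t) sums (indicat_real {0..<1} t *\<^sub>R (\<phi> t / (1 - complex_of_real t * z))) \<and> summable (\<lambda>n. norm (f n t))"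
    proof (cases "t \<in> {0..<1}")
      case True
      have tz: "cmod (complex_of_real t * z) < 1"
      proof -
        have "cmod (complex_of_real t * z) \<le> 1 * cmod z" unfolding norm_mult
          using True by (intro mult_right_mono) auto
        then show ?thesis using z by simp
      qed
      have f: "f n t = \<phi> t * (complex_of_real t * z) ^ n" for n
        using True by (simp add: f_def power_mult_distrib)
      have "(\<lambda>n. \<phi> t * (complex_of_real t * z) ^ n) sums (\<phi> t * (1 / (1 - complex_of_real t * z)))"
        by (intro sums_mult geometric_sums tz)
      moreover have "summable (\<lambda>n. cmod (\<phi> t) * cmod (complex_of_real t * z) ^ n)"
        using tz by (intro summable_mult summable_geometric) auto
      ultimately show ?thesis using True unfolding f by (simp add: norm_mult norm_power)
    qed (simp add: f_def)
    then show "(\<lambda>n. f n t) sums (indicat_real {0..<1} t *\<^sub>R (\<phi> t / (1 - complex_of_real t * z)))"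
      "summable (\<lambda>n. norm (f n t))" by auto
  qed
  have isum: "summable (\<lambda>n. LINT t|lebesgue. norm (f n t))"
  proof (rule summable_comparison_test'[where N = 0])
    show "summable (\<lambda>n. (LINT t:{0..<1}|lebesgue. cmod (\<phi> t)) * cmod z ^ n)"
      using z by (intro summable_mult summable_geometric) auto
    fix n
    have "(LINT t|lebesgue. norm (f n t)) \<le> (LINT t|lebesgue. indicat_real {0..<1} t *\<^sub>R cmod (\<phi> t) * cmod z ^ n)"
    proof (rule integral_mono)
      show "integrable lebesgue (\<lambda>t. norm (f n t))" by (intro integrable_norm int)
      show "integrable lebesgue (\<lambda>t. indicat_real {0..<1} t *\<^sub>R cmod (\<phi> t) * cmod z ^ n)"
        using set_integrable_norm[OF \<phi>] unfolding set_integrable_def by (rule integrable_mult_left)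
      show "norm (f n t) \<le> indicat_real {0..<1} t *\<^sub>R cmod (\<phi> t) * cmod z ^ n" for t
        by (auto simp: f_def indicator_def norm_mult norm_power power_le_one intro!: mult_right_mono mult_left_le_one_le)
    qed
    then show "norm (LINT t|lebesgue. norm (f n t)) \<le> (LINT t:{0..<1}|lebesgue. cmod (\<phi> t)) * cmod z ^ n"
      by (simp add: set_lebesgue_integral_def)
  qed
  have "(\<lambda>n. LINT t|lebesgue. f n t) sums (LINT t|lebesgue. (\<Sum>n. f n t))"
    by (rule sums_integral[OF int AE_I2[OF nsum] isum])
  moreover have "(LINT t|lebesgue. f n t) = moment \<phi> n * z ^ n" for n
    by (simp only: f_def moment_def set_lebesgue_integral_def integral_mult_left_zero)
  moreover have "(LINT t|lebesgue. (\<Sum>n. f n t)) = hilbert_op \<phi> z"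
    using geo by (simp add: sums_iff hilbert_op_def set_lebesgue_integral_def)
  ultimately show ?thesis by simp
qed

lemma hilbert_op_0: "hilbert_op \<phi> 0 = moment \<phi> 0"
  by (simp add: hilbert_op_def moment_def)

lemma moment_summable: "cmod z < 1 \<Longrightarrow> summable (\<lambda>n. moment \<phi> n * z ^ n)"
  using hilbert_op_sums by (auto simp: sums_iff)

lemma hilbert_op_has_field_derivative:
  assumes z: "cmod z < 1"
  shows "(hilbert_op \<phi> has_field_derivative (\<Sum>n. diffs (moment \<phi>) n * z ^ n)) (at z)"
proof (rule has_field_derivative_transform_within_open)
  show "((\<lambda>z. \<Sum>n. moment \<phi> n * z ^ n) has_field_derivative (\<Sum>n. diffs (moment \<phi>) n * z ^ n)) (at z)"
    by (rule termdiffs_strong'[OF moment_summable z])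
  show "(\<Sum>n. moment \<phi> n * w ^ n) = hilbert_op \<phi> w" if "w \<in> ball 0 1" for w
    using hilbert_op_sums[of w] that by (simp add: sums_iff)
qed (use z in auto)

lemma hilbert_op_holomorphic: "hilbert_op \<phi> holomorphic_on ball 0 1"
  unfolding holomorphic_on_open[OF open_ball]
  by (intro ballI exI, rule hilbert_op_has_field_derivative) simp

text \<open>The moments are bounded by the integral of |\<open>\<phi>\<close>|, so their absolute
  values are the coefficients of a real power series converging on (-1, 1), and the differentiated
  series converges there too.\<close>

lemma diffs_moment_summable:
  assumes "0 \<le> R" "R < 1"
  shows "summable (\<lambda>n. cmod (diffs (moment \<phi>) n) * R ^ n)"
proof -
  have "summable (\<lambda>n. diffs (\<lambda>n. cmod (moment \<phi> n)) n * R ^ n)"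
  proof (rule termdiff_converges[where K = 1])
    fix x :: real assume x: "norm x < 1"
    show "summable (\<lambda>n. cmod (moment \<phi> n) * x ^ n)"
    proof (rule summable_comparison_test'[where N = 0])
      show "summable (\<lambda>n. (LINT t:{0..<1}|lebesgue. cmod (\<phi> t)) * \<bar>x\<bar> ^ n)"
        using x by (intro summable_mult summable_geometric) auto
      show "norm (cmod (moment \<phi> n) * x ^ n) \<le> (LINT t:{0..<1}|lebesgue. cmod (\<phi> t)) * \<bar>x\<bar> ^ n" for n
        by (simp add: abs_mult power_abs mult_right_mono moment_bound)
    qed
  qed (use assms in auto)
  then show ?thesis by (simp only: diffs_def norm_mult norm_of_nat)
qed

end

text \<open>The two agreements serve different integrals: \<open>u_eq\<close> is what
  \<open>v_hat\<close> sees, namely \<open>v\<close> along a radius, while \<open>v_eq\<close> is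
  what the area integral sees.\<close>

locale borel_radial =
  fixes v :: "complex \<Rightarrow> real" and u :: "real \<Rightarrow> real"
  assumes v_int: "set_integrable lebesgue (ball 0 1) v"
    and v_pos: "z \<in> ball 0 1 \<Longrightarrow> 0 < v z"
    and u_meas [measurable]: "u \<in> borel_measurable borel"
    and u_nonneg: "0 \<le> u r"
    and u_eq: "AE r in lborel. 0 < r \<and> r < 1 \<longrightarrow> v (complex_of_real r) = u r"
    and v_eq: "AE z in lborel. z \<in> ball 0 1 \<longrightarrow> v z = u (cmod z)"
begin

lemma integrable_u_cmod: "integrable lborel (\<lambda>z. indicator (ball (0::complex) 1) z * u (cmod z))"
proof -
  have "integrable lebesgue (\<lambda>z. indicator (ball (0::complex) 1) z *\<^sub>R v z)"
    using v_int by (simp add: set_integrable_def)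
  moreover have "AE z in lebesgue. indicator (ball (0::complex) 1) z *\<^sub>R v z = indicator (ball (0::complex) 1) z * u (cmod z)"
    using AE_completion[OF v_eq] by eventually_elim (auto simp: indicator_def)
  moreover have m: "(\<lambda>z. indicator (ball (0::complex) 1) z * u (cmod z)) \<in> borel_measurable lborel" by measurable
  ultimately have "integrable lebesgue (\<lambda>z. indicator (ball (0::complex) 1) z * u (cmod z))"
    using integrable_cong_AE[OF borel_measurable_integrable measurable_completion[OF m]] by blast
  then show ?thesis using integrable_completion[OF m] by blast
qed

text \<open>Parseval for the derivative, whose Taylor coefficients are
  \<open>diffs (moment \<phi>)\<close>; dividing by pi turns the polar density
  \<open>2 * pi * r\<close> into \<open>2 * r\<close>.\<close>

lemma dirichlet_norm_hilbert_op:
  assumes \<phi>: "set_integrable lebesgue {0..<1} \<phi>"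
  shows "(dirichlet_norm v (hilbert_op \<phi>))\<^sup>2 = ennreal ((cmod (moment \<phi> 0))\<^sup>2) +
    (\<integral>\<^sup>+r. ennreal (2 * r) * (\<Sum>n. ennreal ((cmod (diffs (moment \<phi>) n))\<^sup>2 * r ^ (2 * n))) * ennreal (u r) * indicator {0..<1} r \<partial>lborel)"
proof -
  let ?b = "diffs (moment \<phi>)"
  let ?F = "\<lambda>z. ennreal ((cmod (\<Sum>n. ?b n * z ^ n))\<^sup>2) * ennreal (u (cmod z)) * indicator (ball 0 1) z"
  have [measurable]: "(\<lambda>z. \<Sum>n. ?b n * z ^ n) \<in> borel_measurable borel" by measurable
  have [measurable]: "?F \<in> borel_measurable borel" by measurable
  have "(\<integral>\<^sup>+z\<in>ball 0 1. ennreal ((cmod (deriv (hilbert_op \<phi>) z))\<^sup>2 * v z / pi) \<partial>lebesgue) = (\<integral>\<^sup>+z. ennreal (1 / pi) * ?F z \<partial>lebesgue)"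
  proof (rule nn_integral_cong_AE, use AE_completion[OF v_eq] in eventually_elim)
    fix z assume *: "z \<in> ball 0 1 \<longrightarrow> v z = u (cmod z)"
    show "ennreal ((cmod (deriv (hilbert_op \<phi>) z))\<^sup>2 * v z / pi) * indicator (ball 0 1) z = ennreal (1 / pi) * ?F z"
    proof (cases "z \<in> ball 0 1")
      case True
      then have d: "deriv (hilbert_op \<phi>) z = (\<Sum>n. ?b n * z ^ n)"
        by (intro DERIV_imp_deriv hilbert_op_has_field_derivative[OF \<phi>]) simp
      have e: "ennreal (a * x / pi) = ennreal (1 / pi) * (ennreal a * ennreal x)" if "0 \<le> a" "0 \<le> x" for a x
      proof -
        have "ennreal ((1 / pi) * (a * x)) = ennreal (1 / pi) * ennreal (a * x)" by (rule ennreal_mult') simp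
        also have "ennreal (a * x) = ennreal a * ennreal x" using that(1) by (rule ennreal_mult')
        finally show ?thesis by simp
      qed
      have v: "v z = u (cmod z)" using * True by blast
      show ?thesis unfolding d v e[OF zero_le_power2 u_nonneg] by (simp only: mult.assoc)
    qed simp
  qed
  also have "\<dots> = (\<integral>\<^sup>+z. ennreal (1 / pi) * ?F z \<partial>lborel)" by (rule nn_integral_completion)
  also have "\<dots> = ennreal (1 / pi) * (\<integral>\<^sup>+z. ?F z \<partial>lborel)" by (rule nn_integral_cmult) measurable
  also have "(\<integral>\<^sup>+z. ?F z \<partial>lborel) = (\<integral>\<^sup>+r. ennreal (2 * pi * r) * ((\<Sum>n. ennreal ((cmod (?b n))\<^sup>2 * r ^ (2 * n))) * ennreal (u r)) * indicator {0..<1} r \<partial>lborel)"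
    by (rule nn_integral_power_series_disc[OF u_meas u_nonneg integrable_u_cmod diffs_moment_summable[OF \<phi>]]) simp_all
  also have "ennreal (1 / pi) * \<dots> = (\<integral>\<^sup>+r. ennreal (1 / pi) * (ennreal (2 * pi * r) * ((\<Sum>n. ennreal ((cmod (?b n))\<^sup>2 * r ^ (2 * n))) * ennreal (u r)) * indicator {0..<1} r) \<partial>lborel)"
    by (rule nn_integral_cmult[symmetric]) measurable
  also have "\<dots> = (\<integral>\<^sup>+r. ennreal (2 * r) * (\<Sum>n. ennreal ((cmod (?b n))\<^sup>2 * r ^ (2 * n))) * ennreal (u r) * indicator {0..<1} r \<partial>lborel)"
  proof (intro nn_integral_cong)
    fix r :: real
    have "ennreal (1 / pi) * ennreal (2 * pi * r) = ennreal (2 * r)" if "0 \<le> r"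
      using ennreal_mult'[of "1 / pi" "2 * pi * r"] by simp
    then show "ennreal (1 / pi) * (ennreal (2 * pi * r) * ((\<Sum>n. ennreal ((cmod (?b n))\<^sup>2 * r ^ (2 * n))) * ennreal (u r)) * indicator {0..<1} r)
      = ennreal (2 * r) * (\<Sum>n. ennreal ((cmod (?b n))\<^sup>2 * r ^ (2 * n))) * ennreal (u r) * indicator {0..<1} r"
      by (cases "r \<in> {0..<1}") (simp_all add: mult.assoc[symmetric])
  qed
  finally show ?thesis
    by (simp only: dirichlet_norm_def ennsqrt_power2 hilbert_op_0[OF \<phi>])
qed

end

section \<open>Energy of a nonnegative function\<close>

definition tail :: "(real \<Rightarrow> ennreal) \<Rightarrow> real \<Rightarrow> ennreal" where
  "tail f r = (\<integral>\<^sup>+t. f t * indicator {r..<1} t \<partial>lborel)"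

definition nn_moment :: "(real \<Rightarrow> ennreal) \<Rightarrow> nat \<Rightarrow> ennreal" where
  "nn_moment g n = (\<integral>\<^sup>+t. ennreal (t ^ n) * g t \<partial>lborel)"

text \<open>With the moving interval written as a condition, the integrand is visibly jointly
  measurable in \<open>r\<close> and \<open>t\<close>.\<close>

lemma tail_alt: "tail f r = (\<integral>\<^sup>+t. f t * (if r \<le> t \<and> t < 1 then 1 else 0) \<partial>lborel)"
  unfolding tail_def by (intro nn_integral_cong) (auto simp: indicator_def)

lemma measurable_tail [measurable]:
  assumes [measurable]: "f \<in> borel_measurable borel"
  shows "tail f \<in> borel_measurable borel"
  unfolding tail_alt[abs_def] by measurable

lemma tail_antimono: "r \<le> s \<Longrightarrow> tail f s \<le> tail f r"
  unfolding tail_def by (intro nn_integral_mono) (auto simp: indicator_def)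

text \<open>Tonelli with the square of the tail written as a double integral. The two conditions
  together say \<open>\<rho>\<close> \<le> min t s, so a kernel that is an integral over such
  \<open>\<rho>\<close> turns into squared tails.\<close>

lemma nn_integral_tail_square:
  assumes [measurable]: "a \<in> borel_measurable borel" "g \<in> borel_measurable borel" 
  shows "(\<integral>\<^sup>+\<rho>. a \<rho> * (tail g \<rho>)\<^sup>2 \<partial>lborel) =
    (\<integral>\<^sup>+t. \<integral>\<^sup>+s. g t * g s * (\<integral>\<^sup>+\<rho>. a \<rho> * (if \<rho> \<le> t \<and> t < 1 then 1 else 0) * (if \<rho> \<le> s \<and> s < 1 then 1 else 0) \<partial>lborel) \<partial>lborel \<partial>lborel)"
proof -
  let ?l = "\<lambda>\<rho> t::real. (if \<rho> \<le> t \<and> t < 1 then 1 else 0) :: ennreal"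
  have "(\<integral>\<^sup>+t. \<integral>\<^sup>+s. g t * g s * (\<integral>\<^sup>+\<rho>. a \<rho> * ?l \<rho> t * ?l \<rho> s \<partial>lborel) \<partial>lborel \<partial>lborel)
    = (\<integral>\<^sup>+t. \<integral>\<^sup>+s. \<integral>\<^sup>+\<rho>. (g t * (a \<rho> * ?l \<rho> t)) * (g s * ?l \<rho> s) \<partial>lborel \<partial>lborel \<partial>lborel)"
    by (subst nn_integral_cmult[symmetric]) (auto simp: mult_ac)
  also have "\<dots> = (\<integral>\<^sup>+t. \<integral>\<^sup>+\<rho>. \<integral>\<^sup>+s. (g t * (a \<rho> * ?l \<rho> t)) * (g s * ?l \<rho> s) \<partial>lborel \<partial>lborel \<partial>lborel)"
    by (intro nn_integral_cong lborel_pair.Fubini') measurable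
  also have "\<dots> = (\<integral>\<^sup>+t. \<integral>\<^sup>+\<rho>. (g t * ?l \<rho> t) * (a \<rho> * tail g \<rho>) \<partial>lborel \<partial>lborel)"
    by (intro nn_integral_cong, subst nn_integral_cmult) (simp_all add: tail_alt mult_ac)
  also have "\<dots> = (\<integral>\<^sup>+\<rho>. \<integral>\<^sup>+t. (g t * ?l \<rho> t) * (a \<rho> * tail g \<rho>) \<partial>lborel \<partial>lborel)"
    by (intro lborel_pair.Fubini') measurable
  also have "\<dots> = (\<integral>\<^sup>+\<rho>. a \<rho> * (tail g \<rho>)\<^sup>2 \<partial>lborel)"
    by (intro nn_integral_cong, subst nn_integral_multc) (simp_all add: tail_alt mult_ac power2_eq_square)
  finally show ?thesis ..
qed

text \<open>Obtained by differentiating the series of n z^n, whose sum is z / (1 - z)^2. The weight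
  (n + 1)^2 is the squared factor that differentiation puts on Taylor coefficients.\<close>

lemma square_weighted_geometric_sums:
  fixes x :: real
  assumes x: "norm x < 1"
  shows "(\<lambda>n. (real (Suc n))\<^sup>2 * x ^ n) sums ((1 + x) / (1 - x) ^ 3)"
proof -
  have sums: "(\<lambda>n. real n * z ^ n) sums (z / (1 - z)\<^sup>2)" if "norm z < 1" for z :: real
  proof -
    have "(\<lambda>n. z * (of_nat (Suc n) * z ^ n)) sums (z * (1 / (1 - z)\<^sup>2))"
      by (intro sums_mult geometric_deriv_sums that)
    then have "(\<lambda>n. real (Suc n) * z ^ (Suc n)) sums (z / (1 - z)\<^sup>2)"
      by (simp add: mult_ac)
    then show ?thesis by (subst (asm) sums_Suc_iff) simp
  qed
  then have sm: "summable (\<lambda>n. real n * z ^ n)" if "norm z < 1" for z :: real using that by (auto simp: sums_iff)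
  have "((\<lambda>z. \<Sum>n. real n * z ^ n) has_field_derivative (\<Sum>n. diffs real n * x ^ n)) (at x)"
    by (rule termdiffs_strong'[OF sm x])
  moreover have "((\<lambda>z. z / (1 - z)\<^sup>2) has_field_derivative ((1 + x) / (1 - x) ^ 3)) (at x)"
    using x by (auto intro!: derivative_eq_intros simp: divide_simps) (simp add: power2_eq_square power3_eq_cube power4_eq_xxxx algebra_simps)
  moreover have "((\<lambda>z. \<Sum>n. real n * z ^ n) has_field_derivative ((1 + x) / (1 - x) ^ 3)) (at x)"
    using calculation(2)
    by (rule has_field_derivative_transform_within_open[of _ _ _ "ball 0 1"]) (use sums x in \<open>auto simp: sums_iff\<close>)
  ultimately have "(\<Sum>n. diffs real n * x ^ n) = (1 + x) / (1 - x) ^ 3" using DERIV_unique by blast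
  moreover have "summable (\<lambda>n. diffs real n * x ^ n)" by (rule termdiff_converges[OF x sm])
  moreover have "diffs real = (\<lambda>n. (real (Suc n))\<^sup>2)" by (simp add: diffs_def power2_eq_square fun_eq_iff)
  ultimately show ?thesis by (simp add: sums_iff)
qed

lemma suminf_square_weighted_geometric:
  assumes "0 \<le> x" "x < 1"
  shows "(\<Sum>n. ennreal ((real (Suc n))\<^sup>2 * x ^ n)) = ennreal ((1 + x) / (1 - x) ^ 3)"
  using square_weighted_geometric_sums[of x] assms by (intro suminf_ennreal_eq) auto

lemma nn_integral_inverse_power4:
  assumes "0 \<le> q" "q < 1"
  shows "(\<integral>\<^sup>+\<rho>. ennreal (1 / (1 - \<rho>) ^ 4) * indicator {0..q} \<rho> \<partial>lborel) = ennreal ((1 / (1 - q) ^ 3 - 1) / 3)"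
proof -
  have "(\<integral>\<^sup>+\<rho>. ennreal (1 / (1 - \<rho>) ^ 4) * indicator {0..q} \<rho> \<partial>lborel) = ennreal (1 / (3 * (1 - q) ^ 3) - 1 / (3 * (1 - 0) ^ 3))"
  proof (rule nn_integral_FTC_interval)
    fix x assume "x \<in> {0..q}"
    then have "1 - x \<noteq> 0" using assms by auto
    then show "((\<lambda>x. 1 / (3 * (1 - x) ^ 3)) has_real_derivative 1 / (1 - x) ^ 4) (at x within {0..q})"
      by (auto intro!: derivative_eq_intros simp: divide_simps)
  qed (use assms in auto)
  also have "1 / (3 * (1 - q) ^ 3) - 1 / (3 * (1 - 0) ^ 3) = (1 / (1 - q) ^ 3 - 1) / 3"
    by (simp add: diff_divide_distrib mult.commute)
  finally show ?thesis .
qed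

text \<open>A squared moment is a double integral of products, and the sum over n moves inside it.
  The shift to \<open>Suc n\<close>, due to differentiation, is the origin of the factor t s in
  front of the summed kernel.\<close>

lemma nn_moment_square_series:
  assumes [measurable]: "g \<in> borel_measurable borel" and g0: "\<And>t. t \<notin> {0..<1} \<Longrightarrow> g t = 0" and r: "0 \<le> r" "r < 1"
  shows "(\<Sum>n. ennreal ((real (Suc n))\<^sup>2 * r ^ (2 * n)) * (nn_moment g (Suc n))\<^sup>2)
    = (\<integral>\<^sup>+t. \<integral>\<^sup>+s. g t * g s * ennreal (t * s * (1 + t * s * r\<^sup>2) / (1 - t * s * r\<^sup>2) ^ 3) \<partial>lborel \<partial>lborel)"
proof -
  have sq: "(nn_moment g n)\<^sup>2 = (\<integral>\<^sup>+t. \<integral>\<^sup>+s. (ennreal (t ^ n) * g t) * (ennreal (s ^ n) * g s) \<partial>lborel \<partial>lborel)" for n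
    unfolding power2_eq_square nn_moment_def
    by (subst nn_integral_multc[symmetric], measurable) (intro nn_integral_cong, rule nn_integral_cmult[symmetric], measurable)
  have "(\<Sum>n. ennreal ((real (Suc n))\<^sup>2 * r ^ (2 * n)) * (nn_moment g (Suc n))\<^sup>2)
    = (\<Sum>n. (\<integral>\<^sup>+t. \<integral>\<^sup>+s. ennreal ((real (Suc n))\<^sup>2 * r ^ (2 * n)) * ((ennreal (t ^ Suc n) * g t) * (ennreal (s ^ Suc n) * g s)) \<partial>lborel \<partial>lborel))"
    unfolding sq
    by (intro suminf_cong, subst nn_integral_cmult[symmetric], measurable) (intro nn_integral_cong, rule nn_integral_cmult[symmetric], measurable)
  also have "\<dots> = (\<integral>\<^sup>+t. (\<Sum>n. \<integral>\<^sup>+s. ennreal ((real (Suc n))\<^sup>2 * r ^ (2 * n)) * ((ennreal (t ^ Suc n) * g t) * (ennreal (s ^ Suc n) * g s)) \<partial>lborel) \<partial>lborel)"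
    by (rule nn_integral_suminf[symmetric]) measurable
  also have "\<dots> = (\<integral>\<^sup>+t. \<integral>\<^sup>+s. (\<Sum>n. ennreal ((real (Suc n))\<^sup>2 * r ^ (2 * n)) * ((ennreal (t ^ Suc n) * g t) * (ennreal (s ^ Suc n) * g s))) \<partial>lborel \<partial>lborel)"
    by (intro nn_integral_cong, rule nn_integral_suminf[symmetric]) measurable
  also have "\<dots> = (\<integral>\<^sup>+t. \<integral>\<^sup>+s. g t * g s * ennreal (t * s * (1 + t * s * r\<^sup>2) / (1 - t * s * r\<^sup>2) ^ 3) \<partial>lborel \<partial>lborel)"
  proof (intro nn_integral_cong)
    fix t s :: real
    show "(\<Sum>n. ennreal ((real (Suc n))\<^sup>2 * r ^ (2 * n)) * ((ennreal (t ^ Suc n) * g t) * (ennreal (s ^ Suc n) * g s)))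
      = g t * g s * ennreal (t * s * (1 + t * s * r\<^sup>2) / (1 - t * s * r\<^sup>2) ^ 3)"
    proof (cases "t \<in> {0..<1} \<and> s \<in> {0..<1}")
      case True
      then have ts: "0 \<le> t" "t < 1" "0 \<le> s" "s < 1" by auto
      define x where "x = t * s * r\<^sup>2"
      have "t * s \<le> 1" using ts by (intro mult_le_one) auto
      moreover have "r\<^sup>2 < 1" using r by (simp add: power_less_one_iff abs_square_less_1)
      ultimately have x: "0 \<le> x" "x < 1" unfolding x_def using ts
        by (auto intro: le_less_trans[OF mult_right_mono[of "t * s" 1 "r\<^sup>2"]])
      have "ennreal ((real (Suc n))\<^sup>2 * r ^ (2 * n)) * ((ennreal (t ^ Suc n) * g t) * (ennreal (s ^ Suc n) * g s))
        = (g t * g s * ennreal (t * s)) * ennreal ((real (Suc n))\<^sup>2 * x ^ n)" for n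
      proof -
        have "ennreal ((real (Suc n))\<^sup>2 * r ^ (2 * n)) * ((ennreal (t ^ Suc n) * g t) * (ennreal (s ^ Suc n) * g s))
          = (g t * g s) * (ennreal ((real (Suc n))\<^sup>2 * r ^ (2 * n)) * (ennreal (t ^ Suc n) * ennreal (s ^ Suc n)))"
          by (simp only: mult_ac)
        also have "ennreal ((real (Suc n))\<^sup>2 * r ^ (2 * n)) * (ennreal (t ^ Suc n) * ennreal (s ^ Suc n))
           = ennreal (((real (Suc n))\<^sup>2 * r ^ (2 * n)) * (t ^ Suc n * s ^ Suc n))"
          using ts r by (subst (1 2) ennreal_mult) auto
        also have "((real (Suc n))\<^sup>2 * r ^ (2 * n)) * (t ^ Suc n * s ^ Suc n) = (t * s) * ((real (Suc n))\<^sup>2 * x ^ n)"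
          unfolding x_def power_mult[of r 2 n] power_mult_distrib power_Suc by (simp only: mult_ac)
        also have "ennreal \<dots> = ennreal (t * s) * ennreal ((real (Suc n))\<^sup>2 * x ^ n)"
          using ts x by (intro ennreal_mult) auto
        finally show ?thesis by (simp only: mult.assoc)
      qed
      then have "(\<Sum>n. ennreal ((real (Suc n))\<^sup>2 * r ^ (2 * n)) * ((ennreal (t ^ Suc n) * g t) * (ennreal (s ^ Suc n) * g s)))
        = (g t * g s * ennreal (t * s)) * (\<Sum>n. ennreal ((real (Suc n))\<^sup>2 * x ^ n))"
        by (simp only: ennreal_suminf_cmult)
      also have "\<dots> = g t * g s * (ennreal (t * s) * ennreal ((1 + x) / (1 - x) ^ 3))"
        unfolding suminf_square_weighted_geometric[OF x] by (simp only: mult.assoc)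
      also have "ennreal (t * s) * ennreal ((1 + x) / (1 - x) ^ 3) = ennreal (t * s * (1 + x) / (1 - x) ^ 3)"
        using ennreal_mult'[of "t * s" "(1 + x) / (1 - x) ^ 3"] ts by simp
      finally show ?thesis unfolding x_def .
    next
      case False
      \<comment> \<open>Outside the unit square the geometric series may diverge, but every term is
        annihilated by this factor.\<close>
      then have "g t * g s = 0" using g0 by auto
      then have "ennreal ((real (Suc n))\<^sup>2 * r ^ (2 * n)) * ((ennreal (t ^ Suc n) * g t) * (ennreal (s ^ Suc n) * g s)) = 0" for n
        by auto
      then show ?thesis using \<open>g t * g s = 0\<close> by (simp only: suminf_zero mult_zero_left)
    qed
  qed
  finally show ?thesis .
qed

lemma tail_0_eq:
  assumes "\<And>t. t \<notin> {0..<1} \<Longrightarrow> g t = 0"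
  shows "tail g 0 = (\<integral>\<^sup>+t. g t \<partial>lborel)"
  unfolding tail_def using assms by (intro nn_integral_cong) (auto simp: indicator_def)

text \<open>The kernel is at most 2 / (1 - q)^3 with \<open>q\<close> the minimum of t, s, r, and
  this is the value 2 at q = 0 plus 6 times the integral of (1 - \<rho>)^-4 over [0, q]. The value 2
  contributes a multiple of the squared total integral, the rest squared tails.\<close>

lemma nn_moment_square_series_le:
  assumes [measurable]: "g \<in> borel_measurable borel" and g0: "\<And>t. t \<notin> {0..<1} \<Longrightarrow> g t = 0" and r: "0 \<le> r" "r < 1"
  shows "(\<Sum>n. ennreal ((real (Suc n))\<^sup>2 * r ^ (2 * n)) * (nn_moment g (Suc n))\<^sup>2)
    \<le> 2 * (tail g 0)\<^sup>2 + 6 * (\<integral>\<^sup>+\<rho>. ennreal (1 / (1 - \<rho>) ^ 4) * indicator {0..r} \<rho> * (tail g \<rho>)\<^sup>2 \<partial>lborel)"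
proof -
  define a where "a \<rho> = ennreal (1 / (1 - \<rho>) ^ 4) * indicator {0..r} \<rho>" for \<rho>
  have [measurable]: "a \<in> borel_measurable borel" unfolding a_def by measurable
  define I where "I t s = (\<integral>\<^sup>+\<rho>. a \<rho> * (if \<rho> \<le> t \<and> t < 1 then 1 else 0) * (if \<rho> \<le> s \<and> s < 1 then 1 else 0) \<partial>lborel)" for t s
  have [measurable]: "(\<lambda>(t, s). I t s) \<in> borel_measurable (borel \<Otimes>\<^sub>M borel)" unfolding I_def by measurable
  have T: "tail g 0 = (\<integral>\<^sup>+t. g t \<partial>lborel)" by (rule tail_0_eq) (rule g0)
  have kernel: "ennreal (t * s * (1 + t * s * r\<^sup>2) / (1 - t * s * r\<^sup>2) ^ 3) \<le> 2 + 6 * I t s"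
    if t: "t \<in> {0..<1}" and s: "s \<in> {0..<1}" for t s
  proof -
    define q where "q = min (min t s) r"
    have q: "0 \<le> q" "q < 1" using t s r by (auto simp: q_def)
    have "I t s = (\<integral>\<^sup>+\<rho>. ennreal (1 / (1 - \<rho>) ^ 4) * indicator {0..q} \<rho> \<partial>lborel)"
      unfolding I_def a_def using t s by (intro nn_integral_cong) (auto simp: q_def indicator_def)
    then have I: "I t s = ennreal ((1 / (1 - q) ^ 3 - 1) / 3)"
      by (simp only: nn_integral_inverse_power4[OF q])
    have ts: "0 \<le> t * s" "t * s \<le> 1" using t s by (auto intro: mult_le_one)
    have r2: "0 \<le> r\<^sup>2" "r\<^sup>2 \<le> 1" "r\<^sup>2 \<le> r" using r by (auto simp: power2_eq_square mult_left_le mult_le_one)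
    have "t * s * r\<^sup>2 \<le> t" "t * s * r\<^sup>2 \<le> s" "t * s * r\<^sup>2 \<le> r"
    proof -
      have "t * (s * r\<^sup>2) \<le> t * 1" using t s r2 by (intro mult_left_mono mult_le_one) auto
      then show "t * s * r\<^sup>2 \<le> t" by (simp add: mult_ac)
      have "s * (t * r\<^sup>2) \<le> s * 1" using t s r2 by (intro mult_left_mono mult_le_one) auto
      then show "t * s * r\<^sup>2 \<le> s" by (simp add: mult_ac)
      have "(t * s) * r\<^sup>2 \<le> 1 * r" using ts r2 r by (intro mult_mono) auto
      then show "t * s * r\<^sup>2 \<le> r" by simp
    qed
    then have xq: "t * s * r\<^sup>2 \<le> q" by (simp add: q_def)
    have "t * s * (1 + t * s * r\<^sup>2) \<le> 1 * 2"
      using ts xq q r2 by (intro mult_mono) auto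
    moreover have "(1 - q) ^ 3 \<le> (1 - t * s * r\<^sup>2) ^ 3" using xq q by (intro power_mono) auto
    ultimately have "t * s * (1 + t * s * r\<^sup>2) / (1 - t * s * r\<^sup>2) ^ 3 \<le> 2 / (1 - q) ^ 3"
      using q ts r2 by (intro frac_le) auto
    also have "2 / (1 - q) ^ 3 = 2 + 6 * ((1 / (1 - q) ^ 3 - 1) / 3)" by (simp add: diff_divide_distrib)
    finally have "ennreal (t * s * (1 + t * s * r\<^sup>2) / (1 - t * s * r\<^sup>2) ^ 3) \<le> ennreal (2 + 6 * ((1 / (1 - q) ^ 3 - 1) / 3))"
      by (rule ennreal_leI)
    also have "\<dots> = 2 + 6 * I t s"
    proof -
      have "0 \<le> (1 / (1 - q) ^ 3 - 1) / 3" using q by (simp add: field_simps power_le_one)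
      moreover have "ennreal (2 + 6 * y) = 2 + 6 * ennreal y" if "0 \<le> y" for y
        using that by (simp add: ennreal_mult')
      ultimately show ?thesis unfolding I by blast
    qed
    finally show ?thesis .
  qed
  have "(\<Sum>n. ennreal ((real (Suc n))\<^sup>2 * r ^ (2 * n)) * (nn_moment g (Suc n))\<^sup>2)
    = (\<integral>\<^sup>+t. \<integral>\<^sup>+s. g t * g s * ennreal (t * s * (1 + t * s * r\<^sup>2) / (1 - t * s * r\<^sup>2) ^ 3) \<partial>lborel \<partial>lborel)"
    by (rule nn_moment_square_series[OF assms])
  also have "\<dots> \<le> (\<integral>\<^sup>+t. \<integral>\<^sup>+s. (2 * g t) * g s + 6 * (g t * g s * I t s) \<partial>lborel \<partial>lborel)"
  proof (intro nn_integral_mono)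
    fix t s :: real
    show "g t * g s * ennreal (t * s * (1 + t * s * r\<^sup>2) / (1 - t * s * r\<^sup>2) ^ 3) \<le> (2 * g t) * g s + 6 * (g t * g s * I t s)"
    proof (cases "t \<in> {0..<1} \<and> s \<in> {0..<1}")
      case True
      then have "g t * g s * ennreal (t * s * (1 + t * s * r\<^sup>2) / (1 - t * s * r\<^sup>2) ^ 3) \<le> g t * g s * (2 + 6 * I t s)"
        by (intro mult_left_mono kernel) auto
      then show ?thesis by (simp add: distrib_left mult_ac)
    next
      case False
      then have "g t * g s = 0" using g0 by auto
      then show ?thesis by (simp only: mult_zero_left zero_le)
    qed
  qed
  also have "\<dots> = (\<integral>\<^sup>+t. (2 * tail g 0) * g t + 6 * (\<integral>\<^sup>+s. g t * g s * I t s \<partial>lborel) \<partial>lborel)"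
  proof (intro nn_integral_cong)
    fix t :: real
    have "(\<integral>\<^sup>+s. (2 * g t) * g s + 6 * (g t * g s * I t s) \<partial>lborel)
      = (\<integral>\<^sup>+s. (2 * g t) * g s \<partial>lborel) + (\<integral>\<^sup>+s. 6 * (g t * g s * I t s) \<partial>lborel)"
      by (rule nn_integral_add) measurable
    also have "(\<integral>\<^sup>+s. (2 * g t) * g s \<partial>lborel) = (2 * g t) * (\<integral>\<^sup>+s. g s \<partial>lborel)" by (rule nn_integral_cmult) measurable
    also have "(\<integral>\<^sup>+s. 6 * (g t * g s * I t s) \<partial>lborel) = 6 * (\<integral>\<^sup>+s. g t * g s * I t s \<partial>lborel)" by (rule nn_integral_cmult) measurable
    finally show "(\<integral>\<^sup>+s. (2 * g t) * g s + 6 * (g t * g s * I t s) \<partial>lborel) = (2 * tail g 0) * g t + 6 * (\<integral>\<^sup>+s. g t * g s * I t s \<partial>lborel)"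
      by (simp only: T mult_ac)
  qed
  also have "\<dots> = (\<integral>\<^sup>+t. (2 * tail g 0) * g t \<partial>lborel) + (\<integral>\<^sup>+t. 6 * (\<integral>\<^sup>+s. g t * g s * I t s \<partial>lborel) \<partial>lborel)"
    by (rule nn_integral_add) measurable
  also have "(\<integral>\<^sup>+t. (2 * tail g 0) * g t \<partial>lborel) = (2 * tail g 0) * (\<integral>\<^sup>+t. g t \<partial>lborel)" by (rule nn_integral_cmult) measurable
  also have "(\<integral>\<^sup>+t. 6 * (\<integral>\<^sup>+s. g t * g s * I t s \<partial>lborel) \<partial>lborel) = 6 * (\<integral>\<^sup>+t. \<integral>\<^sup>+s. g t * g s * I t s \<partial>lborel \<partial>lborel)"
    by (rule nn_integral_cmult) measurable
  also have "(\<integral>\<^sup>+t. \<integral>\<^sup>+s. g t * g s * I t s \<partial>lborel \<partial>lborel) = (\<integral>\<^sup>+\<rho>. a \<rho> * (tail g \<rho>)\<^sup>2 \<partial>lborel)"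
    unfolding I_def by (rule nn_integral_tail_square[symmetric]) measurable
  finally show ?thesis
    unfolding a_def T by (simp only: power2_eq_square mult.assoc)
qed

text \<open>For t, s \<ge> \<open>r0\<close> the kernel is at least r0^2 / (1 - r0^2 r^2)^3, a
  constant in t and s, and the remaining double integral is the square of the integral of
  \<open>g\<close>.\<close>

lemma nn_moment_square_series_ge:
  assumes [measurable]: "g \<in> borel_measurable borel" and g0: "\<And>t. t \<notin> {r0..<1} \<Longrightarrow> g t = 0"
    and r0: "0 \<le> r0" "r0 < 1" and r: "0 \<le> r" "r < 1"
  shows "ennreal (r0\<^sup>2 / (1 - r0\<^sup>2 * r\<^sup>2) ^ 3) * (tail g 0)\<^sup>2 \<le> (\<Sum>n. ennreal ((real (Suc n))\<^sup>2 * r ^ (2 * n)) * (nn_moment g (Suc n))\<^sup>2)"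
proof -
  have g0': "g t = 0" if "t \<notin> {0..<1}" for t using g0[of t] that r0 by auto
  have T: "tail g 0 = (\<integral>\<^sup>+t. g t \<partial>lborel)" by (rule tail_0_eq) (rule g0')
  let ?k = "ennreal (r0\<^sup>2 / (1 - r0\<^sup>2 * r\<^sup>2) ^ 3)"
  have "?k * (tail g 0)\<^sup>2 = (\<integral>\<^sup>+t. (?k * tail g 0) * g t \<partial>lborel)"
    unfolding T by (subst nn_integral_cmult) (simp_all add: power2_eq_square mult.assoc)
  also have "\<dots> = (\<integral>\<^sup>+t. \<integral>\<^sup>+s. (?k * g t) * g s \<partial>lborel \<partial>lborel)"
    unfolding T by (intro nn_integral_cong, subst nn_integral_cmult) (simp_all add: mult_ac)
  also have "\<dots> \<le> (\<integral>\<^sup>+t. \<integral>\<^sup>+s. g t * g s * ennreal (t * s * (1 + t * s * r\<^sup>2) / (1 - t * s * r\<^sup>2) ^ 3) \<partial>lborel \<partial>lborel)"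
  proof (intro nn_integral_mono)
    fix t s :: real
    show "(?k * g t) * g s \<le> g t * g s * ennreal (t * s * (1 + t * s * r\<^sup>2) / (1 - t * s * r\<^sup>2) ^ 3)"
    proof (cases "t \<in> {r0..<1} \<and> s \<in> {r0..<1}")
      case True
      have ts: "r0\<^sup>2 \<le> t * s" "t * s \<le> 1" using True r0 by (auto simp: power2_eq_square intro: mult_mono mult_le_one)
      have ts0: "0 \<le> t * s" using ts zero_le_power2[of r0] by linarith
      have r2: "0 \<le> r\<^sup>2" "r\<^sup>2 < 1" using r by (auto simp: power_less_one_iff abs_square_less_1)
      have "t * s * r\<^sup>2 \<le> 1 * r\<^sup>2" using ts r2 by (intro mult_right_mono) auto
      then have x: "0 < 1 - t * s * r\<^sup>2" using r2 by linarith
      have "r0\<^sup>2 * r\<^sup>2 \<le> t * s * r\<^sup>2" using ts r2 by (intro mult_right_mono) auto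
      then have "(1 - t * s * r\<^sup>2) ^ 3 \<le> (1 - r0\<^sup>2 * r\<^sup>2) ^ 3" using x by (intro power_mono) auto
      moreover have "r0\<^sup>2 * 1 \<le> t * s * (1 + t * s * r\<^sup>2)" using ts ts0 r2 by (intro mult_mono) auto
      ultimately have "r0\<^sup>2 / (1 - r0\<^sup>2 * r\<^sup>2) ^ 3 \<le> t * s * (1 + t * s * r\<^sup>2) / (1 - t * s * r\<^sup>2) ^ 3"
        using x ts0 r2 by (intro frac_le) auto
      then have "?k \<le> ennreal (t * s * (1 + t * s * r\<^sup>2) / (1 - t * s * r\<^sup>2) ^ 3)" by (rule ennreal_leI)
      then have "(g t * g s) * ?k \<le> (g t * g s) * ennreal (t * s * (1 + t * s * r\<^sup>2) / (1 - t * s * r\<^sup>2) ^ 3)"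
        by (rule mult_left_mono) simp
      then show ?thesis by (simp only: mult_ac)
    next
      case False
      then have "g t = 0 \<or> g s = 0" using g0 by auto
      then show ?thesis by auto
    qed
  qed
  also have "\<dots> = (\<Sum>n. ennreal ((real (Suc n))\<^sup>2 * r ^ (2 * n)) * (nn_moment g (Suc n))\<^sup>2)"
    using nn_moment_square_series[OF assms(1) g0' r] by simp
  finally show ?thesis .
qed

text \<open>The Parseval expression for the area integral of |f'|^2 with radial weight
  \<open>U\<close>, where f has the moments of \<open>g\<close> as Taylor coefficients. Taking
  values in \<open>ennreal\<close>, it makes sense before any convergence is known.\<close>

definition energy :: "(real \<Rightarrow> ennreal) \<Rightarrow> (real \<Rightarrow> ennreal) \<Rightarrow> ennreal" where
  "energy U g = (\<integral>\<^sup>+r. ennreal (2 * r) * (\<Sum>n. ennreal ((real (Suc n))\<^sup>2 * r ^ (2 * n)) * (nn_moment g (Suc n))\<^sup>2)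
     * U r * indicator {0..<1} r \<partial>lborel)"

text \<open>Tonelli on the triangle 0 \<le> \<rho> \<le> r < 1: a primitive of \<open>a\<close>
  weighted by \<open>U\<close> becomes \<open>a\<close> weighted by the tail of
  \<open>U\<close>.\<close>

lemma nn_integral_tail_swap:
  assumes [measurable]: "a \<in> borel_measurable borel" "U \<in> borel_measurable borel"
  shows "(\<integral>\<^sup>+r. (\<integral>\<^sup>+\<rho>. a \<rho> * indicator {0..r} \<rho> \<partial>lborel) * U r * indicator {0..<1} r \<partial>lborel)
    = (\<integral>\<^sup>+\<rho>. a \<rho> * tail U \<rho> * indicator {0..<1} \<rho> \<partial>lborel)"
proof -
  have "(\<integral>\<^sup>+r. (\<integral>\<^sup>+\<rho>. a \<rho> * indicator {0..r} \<rho> \<partial>lborel) * U r * indicator {0..<1} r \<partial>lborel)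
    = (\<integral>\<^sup>+r. \<integral>\<^sup>+\<rho>. (a \<rho> * (if 0 \<le> \<rho> \<and> \<rho> \<le> r then 1 else 0)) * (U r * indicator {0..<1} r) \<partial>lborel \<partial>lborel)"
  proof (intro nn_integral_cong)
    fix r :: real
    have "(\<integral>\<^sup>+\<rho>. a \<rho> * indicator {0..r} \<rho> \<partial>lborel) = (\<integral>\<^sup>+\<rho>. (a \<rho> * (if 0 \<le> \<rho> \<and> \<rho> \<le> r then 1 else 0)) \<partial>lborel)"
      by (intro nn_integral_cong) (auto simp: indicator_def)
    then show "(\<integral>\<^sup>+\<rho>. a \<rho> * indicator {0..r} \<rho> \<partial>lborel) * U r * indicator {0..<1} r =
      (\<integral>\<^sup>+\<rho>. (a \<rho> * (if 0 \<le> \<rho> \<and> \<rho> \<le> r then 1 else 0)) * (U r * indicator {0..<1} r) \<partial>lborel)"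
      by (subst nn_integral_multc) (simp_all add: mult_ac)
  qed
  also have "\<dots> = (\<integral>\<^sup>+\<rho>. \<integral>\<^sup>+r. (a \<rho> * (if 0 \<le> \<rho> \<and> \<rho> \<le> r then 1 else 0)) * (U r * indicator {0..<1} r) \<partial>lborel \<partial>lborel)"
    by (intro lborel_pair.Fubini') measurable
  also have "\<dots> = (\<integral>\<^sup>+\<rho>. \<integral>\<^sup>+r. (a \<rho> * indicator {0..<1} \<rho>) * (U r * indicator {\<rho>..<1} r) \<partial>lborel \<partial>lborel)"
    by (intro nn_integral_cong) (auto simp: indicator_def)
  also have "\<dots> = (\<integral>\<^sup>+\<rho>. a \<rho> * tail U \<rho> * indicator {0..<1} \<rho> \<partial>lborel)"
    by (intro nn_integral_cong, subst nn_integral_cmult) (simp_all add: tail_def mult_ac)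
  finally show ?thesis .
qed

text \<open>The kernel bound is integrated against \<open>2 * r * U r\<close>; estimating
  \<open>2 * r\<close> by 2 doubles its constants 2 and 6.\<close>

lemma energy_le:
  assumes [measurable]: "g \<in> borel_measurable borel" "U \<in> borel_measurable borel" and g0: "\<And>t. t \<notin> {0..<1} \<Longrightarrow> g t = 0"
  shows "energy U g \<le> 4 * tail U 0 * (tail g 0)\<^sup>2 +
    12 * (\<integral>\<^sup>+\<rho>. ennreal (1 / (1 - \<rho>) ^ 4) * (tail g \<rho>)\<^sup>2 * tail U \<rho> * indicator {0..<1} \<rho> \<partial>lborel)"
proof -
  let ?a = "\<lambda>\<rho>. ennreal (1 / (1 - \<rho>) ^ 4) * (tail g \<rho>)\<^sup>2"
  let ?A = "\<lambda>r. (\<integral>\<^sup>+\<rho>. ?a \<rho> * indicator {0..r} \<rho> \<partial>lborel)"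
  have Aalt: "?A = (\<lambda>r. (\<integral>\<^sup>+\<rho>. ?a \<rho> * (if 0 \<le> \<rho> \<and> \<rho> \<le> r then 1 else 0) \<partial>lborel))"
    by (intro ext nn_integral_cong) (auto simp: indicator_def)
  have [measurable]: "?A \<in> borel_measurable borel" unfolding Aalt by measurable
  have "energy U g \<le> (\<integral>\<^sup>+r. (4 * (tail g 0)\<^sup>2) * (U r * indicator {0..<1} r) + 12 * (?A r * U r * indicator {0..<1} r) \<partial>lborel)"
    unfolding energy_def
  proof (intro nn_integral_mono)
    fix r :: real
    let ?S = "(\<Sum>n. ennreal ((real (Suc n))\<^sup>2 * r ^ (2 * n)) * (nn_moment g (Suc n))\<^sup>2)"
    show "ennreal (2 * r) * ?S * U r * indicator {0..<1} r
      \<le> (4 * (tail g 0)\<^sup>2) * (U r * indicator {0..<1} r) + 12 * (?A r * U r * indicator {0..<1} r)"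
    proof (cases "r \<in> {0..<1}")
      case True
      then have r: "0 \<le> r" "r < 1" by auto
      have "?S \<le> 2 * (tail g 0)\<^sup>2 + 6 * ?A r"
      proof -
        have "?S \<le> 2 * (tail g 0)\<^sup>2 + 6 * (\<integral>\<^sup>+\<rho>. ennreal (1 / (1 - \<rho>) ^ 4) * indicator {0..r} \<rho> * (tail g \<rho>)\<^sup>2 \<partial>lborel)"
          by (rule nn_moment_square_series_le[OF assms(1) _ r]) (rule g0)
        also have "(\<integral>\<^sup>+\<rho>. ennreal (1 / (1 - \<rho>) ^ 4) * indicator {0..r} \<rho> * (tail g \<rho>)\<^sup>2 \<partial>lborel) = ?A r"
          by (intro nn_integral_cong) (simp only: mult_ac)
        finally show ?thesis .
      qed
      moreover have "ennreal (2 * r) \<le> 2" using r ennreal_leI[of "2 * r" 2] by simp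
      ultimately have "ennreal (2 * r) * ?S * U r \<le> 2 * (2 * (tail g 0)\<^sup>2 + 6 * ?A r) * U r"
        by (intro mult_mono) auto
      also have "\<dots> = (4 * (tail g 0)\<^sup>2) * U r + 12 * (?A r * U r)"
        by (simp add: distrib_left distrib_right mult_ac)
      finally show ?thesis using True by (simp only: indicator_simps mult_1_right)
    next
      case False
      then have "indicator {0..<1} r = (0::ennreal)" by simp
      then show ?thesis by (simp only: mult_zero_right zero_le)
    qed
  qed
  also have "\<dots> = (\<integral>\<^sup>+r. (4 * (tail g 0)\<^sup>2) * (U r * indicator {0..<1} r) \<partial>lborel) + (\<integral>\<^sup>+r. 12 * (?A r * U r * indicator {0..<1} r) \<partial>lborel)"
    by (rule nn_integral_add) measurable
  also have "(\<integral>\<^sup>+r. (4 * (tail g 0)\<^sup>2) * (U r * indicator {0..<1} r) \<partial>lborel) = (4 * (tail g 0)\<^sup>2) * tail U 0"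
    unfolding tail_def[of U] by (rule nn_integral_cmult) measurable
  also have "(\<integral>\<^sup>+r. 12 * (?A r * U r * indicator {0..<1} r) \<partial>lborel) = 12 * (\<integral>\<^sup>+r. ?A r * U r * indicator {0..<1} r \<partial>lborel)"
    by (rule nn_integral_cmult) measurable
  also have "(\<integral>\<^sup>+r. ?A r * U r * indicator {0..<1} r \<partial>lborel) = (\<integral>\<^sup>+\<rho>. ?a \<rho> * tail U \<rho> * indicator {0..<1} \<rho> \<partial>lborel)"
    by (rule nn_integral_tail_swap) measurable
  finally show ?thesis by (simp only: mult_ac)
qed

text \<open>After Tonelli the claim is pointwise in r: \<open>2 * r\<close> times the lower kernel
  bound has to dominate a multiple of the primitive of (1 - \<rho>)^-4 at q = min r0 r. The powers
  match because 1 - r0^2 r^2 \<le> 1 - q^4 \<le> 4 (1 - q); cubing gives 64, and the 2 in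
  \<open>2 * r\<close> reduces this to 32.\<close>

lemma energy_ge:
  assumes [measurable]: "g \<in> borel_measurable borel" "U \<in> borel_measurable borel" and g0: "\<And>t. t \<notin> {r0..<1} \<Longrightarrow> g t = 0"
    and r0: "0 \<le> r0" "r0 < 1"
  shows "ennreal (r0\<^sup>2 / 32) * (tail g 0)\<^sup>2 * (\<integral>\<^sup>+\<rho>. ennreal (1 / (1 - \<rho>) ^ 4) * tail U \<rho> * indicator {0..r0} \<rho> \<partial>lborel) \<le> energy U g"
proof -
  let ?a = "\<lambda>\<rho>. ennreal (1 / (1 - \<rho>) ^ 4) * indicator {0..r0} \<rho>"
  let ?A = "\<lambda>r. (\<integral>\<^sup>+\<rho>. ?a \<rho> * indicator {0..r} \<rho> \<partial>lborel)"
  have Aalt: "?A = (\<lambda>r. (\<integral>\<^sup>+\<rho>. ?a \<rho> * (if 0 \<le> \<rho> \<and> \<rho> \<le> r then 1 else 0) \<partial>lborel))"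
    by (intro ext nn_integral_cong) (auto simp: indicator_def)
  have [measurable]: "?A \<in> borel_measurable borel" unfolding Aalt by measurable
  let ?c = "ennreal (r0\<^sup>2 / 32) * (tail g 0)\<^sup>2"
  have "(\<integral>\<^sup>+\<rho>. ennreal (1 / (1 - \<rho>) ^ 4) * tail U \<rho> * indicator {0..r0} \<rho> \<partial>lborel)
    = (\<integral>\<^sup>+\<rho>. ?a \<rho> * tail U \<rho> * indicator {0..<1} \<rho> \<partial>lborel)"
    using r0 by (intro nn_integral_cong) (auto simp: indicator_def)
  also have "\<dots> = (\<integral>\<^sup>+r. ?A r * U r * indicator {0..<1} r \<partial>lborel)"
    by (rule nn_integral_tail_swap[symmetric]) measurable
  finally have "?c * (\<integral>\<^sup>+\<rho>. ennreal (1 / (1 - \<rho>) ^ 4) * tail U \<rho> * indicator {0..r0} \<rho> \<partial>lborel)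
    = (\<integral>\<^sup>+r. ?c * (?A r * U r * indicator {0..<1} r) \<partial>lborel)"
    by (subst nn_integral_cmult) simp_all
  also have "\<dots> \<le> energy U g" unfolding energy_def
  proof (intro nn_integral_mono)
    fix r :: real
    let ?S = "(\<Sum>n. ennreal ((real (Suc n))\<^sup>2 * r ^ (2 * n)) * (nn_moment g (Suc n))\<^sup>2)"
    show "?c * (?A r * U r * indicator {0..<1} r) \<le> ennreal (2 * r) * ?S * U r * indicator {0..<1} r"
    proof (cases "r \<in> {0..<1}")
      case True
      then have r: "0 \<le> r" "r < 1" by auto
      define q where "q = min r0 r"
      have q: "0 \<le> q" "q < 1" "q \<le> r" "q \<le> r0" using r0 r by (auto simp: q_def)
      have "?A r = (\<integral>\<^sup>+\<rho>. ennreal (1 / (1 - \<rho>) ^ 4) * indicator {0..q} \<rho> \<partial>lborel)"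
        by (intro nn_integral_cong) (auto simp: q_def indicator_def)
      then have A: "?A r = ennreal ((1 / (1 - q) ^ 3 - 1) / 3)"
        by (simp only: nn_integral_inverse_power4[OF q(1,2)])
      have "r0\<^sup>2 * r\<^sup>2 < 1"
      proof -
        have "r\<^sup>2 < 1" "r0\<^sup>2 \<le> 1" using r r0 by (auto simp: power_le_one abs_square_less_1)
        then have "r0\<^sup>2 * r\<^sup>2 \<le> 1 * r\<^sup>2" by (intro mult_right_mono) auto
        then show ?thesis using \<open>r\<^sup>2 < 1\<close> by linarith
      qed
      then have p: "0 < 1 - r0\<^sup>2 * r\<^sup>2" by simp
      have "q\<^sup>2 * q\<^sup>2 \<le> r0\<^sup>2 * r\<^sup>2" using q by (intro mult_mono power_mono) auto
      moreover have "1 - q\<^sup>2 * q\<^sup>2 \<le> 4 * (1 - q)"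
      proof -
        have "1 - q\<^sup>2 * q\<^sup>2 = (1 - q) * ((1 + q) * (1 + q\<^sup>2))" by (simp add: power2_eq_square algebra_simps)
        also have "\<dots> \<le> (1 - q) * (2 * 2)" using q by (intro mult_left_mono mult_mono) (auto simp: power_le_one)
        finally show ?thesis by simp
      qed
      ultimately have "1 - r0\<^sup>2 * r\<^sup>2 \<le> 4 * (1 - q)" by linarith
      then have "(1 - r0\<^sup>2 * r\<^sup>2) ^ 3 \<le> (4 * (1 - q)) ^ 3" using p by (intro power_mono) auto
      then have *: "2 * q / (4 * (1 - q)) ^ 3 \<le> 2 * r / (1 - r0\<^sup>2 * r\<^sup>2) ^ 3"
        using p q r by (intro frac_le) auto
      \<comment> \<open>Since \<open>2 * r\<close> vanishes at r = 0, bounding the primitive by 1 /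
        (3 (1 - q)^3) would not suffice. Bernoulli supplies the factor \<open>q\<close>, which is at
        most \<open>r\<close>.\<close>
      have "(1 - 3 * q) \<le> (1 - q) ^ 3"
        using Bernoulli_inequality[of "- q" 3] q by simp
      moreover have "(1 / y - 1) / 3 \<le> q / y" if "0 < y" "1 - 3 * q \<le> y" for y
      proof -
        have "(1 / y - 1) / 3 = ((1 - y) / 3) / y" using that by (simp add: divide_simps)
        also have "\<dots> \<le> q / y" using that by (intro divide_right_mono) auto
        finally show ?thesis .
      qed
      ultimately have "(1 / (1 - q) ^ 3 - 1) / 3 \<le> q / (1 - q) ^ 3"
        using q by simp
      also have "\<dots> = 32 * (2 * q / (4 * (1 - q)) ^ 3)" unfolding power_mult_distrib by simp
      finally have "(1 / (1 - q) ^ 3 - 1) / 3 \<le> 32 * (2 * r / (1 - r0\<^sup>2 * r\<^sup>2) ^ 3)" using * by linarith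
      then have "r0\<^sup>2 / 32 * ((1 / (1 - q) ^ 3 - 1) / 3) \<le> r0\<^sup>2 / 32 * (32 * (2 * r / (1 - r0\<^sup>2 * r\<^sup>2) ^ 3))"
        by (rule mult_left_mono) simp
      also have "\<dots> = 2 * r * (r0\<^sup>2 / (1 - r0\<^sup>2 * r\<^sup>2) ^ 3)" by simp
      finally have "ennreal (r0\<^sup>2 / 32 * ((1 / (1 - q) ^ 3 - 1) / 3)) \<le> ennreal (2 * r * (r0\<^sup>2 / (1 - r0\<^sup>2 * r\<^sup>2) ^ 3))"
        by (rule ennreal_leI)
      moreover have "ennreal (r0\<^sup>2 / 32 * ((1 / (1 - q) ^ 3 - 1) / 3)) = ennreal (r0\<^sup>2 / 32) * ?A r"
        unfolding A by (rule ennreal_mult') simp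
      moreover have "ennreal (2 * r * (r0\<^sup>2 / (1 - r0\<^sup>2 * r\<^sup>2) ^ 3)) = ennreal (2 * r) * ennreal (r0\<^sup>2 / (1 - r0\<^sup>2 * r\<^sup>2) ^ 3)"
        using r by (intro ennreal_mult') simp
      ultimately have le: "ennreal (r0\<^sup>2 / 32) * ?A r \<le> ennreal (2 * r) * ennreal (r0\<^sup>2 / (1 - r0\<^sup>2 * r\<^sup>2) ^ 3)" by simp
      have "?c * (?A r * U r) = (ennreal (r0\<^sup>2 / 32) * ?A r) * ((tail g 0)\<^sup>2 * U r)" by (simp only: mult_ac)
      also have "\<dots> \<le> (ennreal (2 * r) * ennreal (r0\<^sup>2 / (1 - r0\<^sup>2 * r\<^sup>2) ^ 3)) * ((tail g 0)\<^sup>2 * U r)"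
        by (intro mult_right_mono le) simp
      also have "\<dots> = ennreal (2 * r) * (ennreal (r0\<^sup>2 / (1 - r0\<^sup>2 * r\<^sup>2) ^ 3) * (tail g 0)\<^sup>2) * U r" by (simp only: mult_ac)
      also have "\<dots> \<le> ennreal (2 * r) * ?S * U r"
        by (intro mult_right_mono mult_left_mono nn_moment_square_series_ge[OF assms(1) g0 r0 r]) simp_all
      finally show ?thesis using True by (simp only: indicator_simps mult_1_right)
    next
      case False
      then have "indicator {0..<1} r = (0::ennreal)" by simp
      then show ?thesis by (simp only: mult_zero_right zero_le)
    qed
  qed
  finally show ?thesis .
qed

section \<open>A weighted Hardy inequality\<close>

lemma tail_split:
  assumes [measurable]: "f \<in> borel_measurable borel" and "a \<le> r" "r < 1"
  shows "tail f a = (\<integral>\<^sup>+x. f x * indicator {a..r} x \<partial>lborel) + tail f r"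
proof -
  have "tail f a = (\<integral>\<^sup>+x. f x * indicator {a..r} x + f x * indicator {r..<1} x \<partial>lborel)"
    unfolding tail_def using assms(2,3)
    by (intro nn_integral_cong_AE, use AE_lborel_singleton[of r] in eventually_elim) (auto simp: indicator_def)
  also have "\<dots> = (\<integral>\<^sup>+x. f x * indicator {a..r} x \<partial>lborel) + tail f r"
    unfolding tail_def by (rule nn_integral_add) measurable
  finally show ?thesis .
qed

lemma tail_pos:
  assumes [measurable]: "f \<in> borel_measurable borel" and "r < 1" and ne: "AE x in lborel. r < x \<and> x < 1 \<longrightarrow> f x \<noteq> 0"
  shows "0 < tail f r"
proof (rule ccontr)
  assume "\<not> 0 < tail f r"
  then have "(\<integral>\<^sup>+x. f x * indicator {r..<1} x \<partial>lborel) = 0" by (simp add: tail_def)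
  then have "AE x in lborel. f x * indicator {r..<1} x = 0" by (subst (asm) nn_integral_0_iff_AE) measurable
  with ne have "AE x in lborel. (r < x \<and> x < 1 \<longrightarrow> f x \<noteq> 0) \<and> f x * indicator {r..<1} x = 0"
    by eventually_elim simp
  from AE_lborel_ex_in_interval[OF this \<open>r < 1\<close>] show False by auto
qed

text \<open>Exhaustion by closed intervals. It lets an estimate from the fundamental theorem of
  calculus, available on closed intervals inside [0, 1), reach the endpoint 1.\<close>

lemma nn_integral_atLeastLessThan_le:
  fixes f :: "real \<Rightarrow> ennreal"
  assumes [measurable]: "f \<in> borel_measurable borel" and "a < b"
    and le: "\<And>c. a \<le> c \<Longrightarrow> c < b \<Longrightarrow> (\<integral>\<^sup>+x. f x * indicator {a..c} x \<partial>lborel) \<le> B"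
  shows "(\<integral>\<^sup>+x. f x * indicator {a..<b} x \<partial>lborel) \<le> B"
proof -
  let ?c = "\<lambda>n::nat. b - (b - a) / real (Suc n)"
  have c: "a \<le> ?c n" "?c n < b" for n
  proof -
    have "(b - a) / real (Suc n) \<le> (b - a) / 1" using \<open>a < b\<close> by (intro divide_left_mono) auto
    then show "a \<le> ?c n" by simp
    have "0 < (b - a) / real (Suc n)" using \<open>a < b\<close> by (intro divide_pos_pos) auto
    then show "?c n < b" by simp
  qed
  have U: "{a..<b} = (\<Union>n. {a..?c n})"
  proof (intro equalityI subsetI)
    fix x assume x: "x \<in> {a..<b}"
    then have "0 < (b - x) / (b - a)" using \<open>a < b\<close> by auto
    then obtain n where "1 / real (Suc n) < (b - x) / (b - a)" by (metis inverse_eq_divide reals_Archimedean)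
    then have "(b - a) * (1 / real (Suc n)) < (b - a) * ((b - x) / (b - a))" using \<open>a < b\<close> by (intro mult_strict_left_mono) auto
    then have "(b - a) / real (Suc n) < b - x" using \<open>a < b\<close> by simp
    then have "x \<in> {a..?c n}" using x by auto
    then show "x \<in> (\<Union>n. {a..?c n})" by blast
  next
    fix x assume "x \<in> (\<Union>n. {a..?c n})"
    then obtain n where "a \<le> x" "x \<le> ?c n" by auto
    then show "x \<in> {a..<b}" using c(2)[of n] by auto
  qed
  have inc: "incseq (\<lambda>n. {a..?c n})"
    using \<open>a < b\<close> by (intro monoI atLeastatMost_subset_iff[THEN iffD2] disjI2 conjI order_refl diff_left_mono divide_left_mono) auto
  show ?thesis
  proof -
    have m: "f \<in> borel_measurable lborel" by simp
    have r: "range (\<lambda>n. {a..?c n}) \<subseteq> sets lborel" by auto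
    show ?thesis unfolding U nn_integral_UN_incseq[OF m r inc] by (intro SUP_least le c)
  qed
qed

text \<open>The integrand is the derivative of \<open>2 * sqrt (W x)\<close>; the value at the left
  end is dropped.\<close>

lemma nn_integral_inverse_sqrt_primitive_le:
  assumes W: "\<And>x. x \<in> {a..b} \<Longrightarrow> (W has_real_derivative w x) (at x within {a..b})"
    and pos: "\<And>x. x \<in> {a..b} \<Longrightarrow> 0 < W x" "\<And>x. x \<in> {a..b} \<Longrightarrow> 0 \<le> w x" and "a \<le> b"
  shows "(\<integral>\<^sup>+x. ennreal (w x / sqrt (W x)) * indicator {a..b} x \<partial>lborel) \<le> ennreal (2 * sqrt (W b))"
proof -
  have "(\<integral>\<^sup>+x. ennreal (w x / sqrt (W x)) * indicator {a..b} x \<partial>lborel) = ennreal (2 * sqrt (W b) - 2 * sqrt (W a))"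
  proof (rule nn_integral_FTC_interval[OF \<open>a \<le> b\<close>])
    fix x assume x: "x \<in> {a..b}"
    show "((\<lambda>x. 2 * sqrt (W x)) has_real_derivative w x / sqrt (W x)) (at x within {a..b})"
      using pos(1)[OF x] by (auto intro!: derivative_eq_intros W x simp: divide_simps)
    show "0 \<le> w x / sqrt (W x)" using pos[OF x] by simp
  qed
  also have "\<dots> \<le> ennreal (2 * sqrt (W b))"
    using pos(1)[of a] \<open>a \<le> b\<close> by (intro ennreal_leI) simp
  finally show ?thesis .
qed

text \<open>Counterpart for a decreasing function, with primitive \<open>- 2 * sqrt (A x)\<close>
  and the value at the right end dropped.\<close>

lemma nn_integral_inverse_sqrt_tail_le:
  assumes A: "\<And>x. x \<in> {a..b} \<Longrightarrow> (A has_real_derivative - s x) (at x within {a..b})"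
    and pos: "\<And>x. x \<in> {a..b} \<Longrightarrow> 0 < A x" "\<And>x. x \<in> {a..b} \<Longrightarrow> 0 \<le> s x" and "a \<le> b"
  shows "(\<integral>\<^sup>+x. ennreal (s x / sqrt (A x)) * indicator {a..b} x \<partial>lborel) \<le> ennreal (2 * sqrt (A a))"
proof -
  have "(\<integral>\<^sup>+x. ennreal (s x / sqrt (A x)) * indicator {a..b} x \<partial>lborel) = ennreal (- 2 * sqrt (A b) - - 2 * sqrt (A a))"
  proof (rule nn_integral_FTC_interval[OF \<open>a \<le> b\<close>])
    fix x assume x: "x \<in> {a..b}"
    show "((\<lambda>x. - 2 * sqrt (A x)) has_real_derivative s x / sqrt (A x)) (at x within {a..b})"
      using pos(1)[OF x] by (auto intro!: derivative_eq_intros A x simp: divide_simps)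
    show "0 \<le> s x / sqrt (A x)" using pos[OF x] by simp
  qed
  also have "\<dots> \<le> ennreal (2 * sqrt (A a))"
    using pos(1)[of b] \<open>a \<le> b\<close> by (intro ennreal_leI) simp
  finally show ?thesis .
qed

text \<open>Muckenhoupt's argument. Cauchy-Schwarz with the auxiliary weight sqrt A / \<sigma> gives
  (tail g)^2 \<le> 2 sqrt A times the tail of g^2 sqrt A / \<sigma>. The hypothesis W A \<le> b is
  then used twice: once to replace sqrt A by sqrt (b / W) before exchanging the integrals, once to
  bound sqrt W sqrt A at the end. Each of the integrals of \<sigma> / sqrt A and w / sqrt W
  contributes a factor 2, whence the 4.\<close>

lemma hardy_tail_inequality:
  fixes w \<sigma> :: "real \<Rightarrow> real" and g :: "real \<Rightarrow> ennreal"
  assumes [measurable]: "w \<in> borel_measurable borel" "\<sigma> \<in> borel_measurable borel" "g \<in> borel_measurable borel"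
    and w: "continuous_on {0..<1} w" "\<And>x. x \<in> {0..<1} \<Longrightarrow> 0 \<le> w x"
    and \<sigma>: "continuous_on {0..<1} \<sigma>" "\<And>x. x \<in> {0..<1} \<Longrightarrow> 0 < \<sigma> x"
    and fin: "tail (\<lambda>x. ennreal (\<sigma> x)) 0 < \<infinity>"
    and \<kappa>: "0 < \<kappa>" and b: "0 \<le> b"
    and muckenhoupt: "\<And>r. r \<in> {0..<1} \<Longrightarrow>
      (ennreal \<kappa> + (\<integral>\<^sup>+x. ennreal (w x) * indicator {0..r} x \<partial>lborel)) * tail (\<lambda>x. ennreal (\<sigma> x)) r \<le> ennreal b"
  shows "(\<integral>\<^sup>+r. ennreal (w r) * (tail g r)\<^sup>2 * indicator {0..<1} r \<partial>lborel)
    \<le> ennreal (4 * b) * (\<integral>\<^sup>+t. (g t)\<^sup>2 * ennreal (1 / \<sigma> t) * indicator {0..<1} t \<partial>lborel)"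
proof -
  \<comment> \<open>Adding \<open>\<kappa>\<close> keeps \<open>W\<close> positive even at r = 0,
    where the integral vanishes, so that \<open>w / sqrt W\<close> and its primitive are under
    control on the whole closed interval.\<close>
  define W where "W r = \<kappa> + enn2real (\<integral>\<^sup>+x. ennreal (w x) * indicator {0..r} x \<partial>lborel)" for r
  define A where "A r = enn2real (tail (\<lambda>x. ennreal (\<sigma> x)) r)" for r
  have Walt: "W r = \<kappa> + enn2real (\<integral>\<^sup>+x. ennreal (w x) * (if 0 \<le> x \<and> x \<le> r then 1 else 0) \<partial>lborel)" for r
    unfolding W_def by (intro arg_cong2[where f = "(+)"] refl arg_cong[where f = enn2real] nn_integral_cong) (auto simp: indicator_def)
  have [measurable]: "W \<in> borel_measurable borel" unfolding Walt[abs_def] by measurable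
  have [measurable]: "A \<in> borel_measurable borel" unfolding A_def[abs_def] by measurable
  have int: "(f has_integral integral {0..r} f) {0..r}" "(\<integral>\<^sup>+x. ennreal (f x) * indicator {0..r} x \<partial>lborel) = ennreal (integral {0..r} f)"
    "0 \<le> integral {0..r} f"
    if "continuous_on {0..<1} f" "\<And>x. x \<in> {0..<1} \<Longrightarrow> 0 \<le> f x" "r < 1" for f :: "real \<Rightarrow> real" and r
  proof -
    have "continuous_on {0..r} f" by (rule continuous_on_subset[OF that(1)]) (use that(3) in \<open>auto intro: le_less_trans\<close>)
    then show 1: "(f has_integral integral {0..r} f) {0..r}"
      using integrable_continuous_interval integrable_integral by blast
    show "(\<integral>\<^sup>+x. ennreal (f x) * indicator {0..r} x \<partial>lborel) = ennreal (integral {0..r} f)"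
      by (rule nn_integral_has_integral_lebesgue'[OF _ 1]) (use that in \<open>auto intro: le_less_trans\<close>)
    show "0 \<le> integral {0..r} f" using 1 by (rule has_integral_nonneg) (use that in \<open>auto intro: le_less_trans\<close>)
  qed
  have \<sigma>0: "\<And>x. x \<in> {0..<1} \<Longrightarrow> 0 \<le> \<sigma> x" using \<sigma>(2) by (auto intro: less_imp_le)
  have W: "W r = \<kappa> + integral {0..r} w" "ennreal (W r) = ennreal \<kappa> + (\<integral>\<^sup>+x. ennreal (w x) * indicator {0..r} x \<partial>lborel)" if "r < 1" for r
    using int(2,3)[OF w that] \<kappa> by (simp_all add: W_def)
  have Wpos: "0 < W r" for r using \<kappa> by (simp add: W_def add_pos_nonneg)
  have Wder: "(W has_real_derivative w x) (at x within {0..r})" if "x \<in> {0..r}" "r < 1" for x r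
  proof -
    have "((\<lambda>x. \<kappa> + integral {0..x} w) has_real_derivative 0 + w x) (at x within {0..r})"
      using that by (intro DERIV_add DERIV_const integral_has_real_derivative continuous_on_subset[OF w(1)]) auto
    then show ?thesis unfolding add_0
    proof (rule has_field_derivative_transform_within[where d = 1])
      show "\<kappa> + integral {0..y} w = W y" if "y \<in> {0..r}" for y
        by (rule W(1)[symmetric]) (use that \<open>r < 1\<close> in \<open>auto intro: le_less_trans\<close>)
    qed (use that in simp_all)
  qed
  have tail_fin: "tail (\<lambda>x. ennreal (\<sigma> x)) r < \<infinity>" if "0 \<le> r" for r
    using tail_antimono[OF that, of "\<lambda>x. ennreal (\<sigma> x)"] fin by (rule le_less_trans)
  have A: "ennreal (A r) = tail (\<lambda>x. ennreal (\<sigma> x)) r" if "0 \<le> r" for r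
    using tail_fin[OF that] by (simp add: A_def less_top)
  have A2: "A r = A 0 - integral {0..r} \<sigma>" if "0 \<le> r" "r < 1" for r
  proof -
    have i2: "ennreal (integral {0..r} \<sigma>) = (\<integral>\<^sup>+x. ennreal (\<sigma> x) * indicator {0..r} x \<partial>lborel)"
      by (rule int(2)[OF \<sigma>(1) _ that(2), symmetric]) (rule \<sigma>0)
    have i3: "0 \<le> integral {0..r} \<sigma>"
      by (rule int(3)[OF \<sigma>(1) _ that(2)]) (rule \<sigma>0)
    have "ennreal (A 0) = ennreal (integral {0..r} \<sigma>) + ennreal (A r)"
      using tail_split[of "\<lambda>x. ennreal (\<sigma> x)" 0 r] that by (simp add: A i2)
    also have "\<dots> = ennreal (integral {0..r} \<sigma> + A r)"
      using i3 by (intro ennreal_plus[symmetric]) (auto simp: A_def)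
    finally have "A 0 = integral {0..r} \<sigma> + A r"
      using i3 by (subst (asm) ennreal_inj) (auto simp: A_def)
    then show ?thesis by simp
  qed
  have Apos: "0 < A r" if "0 \<le> r" "r < 1" for r
  proof -
    have "0 < tail (\<lambda>x. ennreal (\<sigma> x)) r"
      by (rule tail_pos) (use that \<sigma>(2) in \<open>auto intro!: AE_I2 simp: ennreal_eq_0_iff not_le\<close>)
    then show ?thesis unfolding A[OF that(1), symmetric] by simp
  qed
  have Ader: "(A has_real_derivative - \<sigma> x) (at x within {a..r})" if "x \<in> {a..r}" "0 \<le> a" "r < 1" for x a r
  proof -
    have "((\<lambda>x. A 0 - integral {0..x} \<sigma>) has_real_derivative 0 - \<sigma> x) (at x within {0..r})"
      using that by (intro DERIV_diff DERIV_const integral_has_real_derivative continuous_on_subset[OF \<sigma>(1)]) auto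
    then have "((\<lambda>x. A 0 - integral {0..x} \<sigma>) has_real_derivative - \<sigma> x) (at x within {a..r})"
      using that by (auto intro: DERIV_subset)
    then show ?thesis
    proof (rule has_field_derivative_transform_within[where d = 1])
      show "A 0 - integral {0..y} \<sigma> = A y" if "y \<in> {a..r}" for y
        by (rule A2[symmetric]) (use that \<open>0 \<le> a\<close> \<open>r < 1\<close> in \<open>auto intro: le_less_trans\<close>)
    qed (use that in simp_all)
  qed
  have WA: "W r * A r \<le> b" if "0 \<le> r" "r < 1" for r
  proof -
    have "ennreal (W r * A r) = ennreal (W r) * ennreal (A r)"
      by (rule ennreal_mult'[OF less_imp_le[OF Wpos]])
    also have "\<dots> \<le> ennreal b"
      unfolding W(2)[OF that(2)] A[OF that(1)] by (rule muckenhoupt) (use that in simp)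
    finally have "ennreal (W r * A r) \<le> ennreal b" .
    then show ?thesis using b by simp
  qed
  \<comment> \<open>The square of \<open>p\<close> is the auxiliary weight of Cauchy-Schwarz; its
    reciprocal \<sigma> / sqrt A has the explicit primitive - 2 sqrt A.\<close>
  define p where "p t = sqrt (sqrt (A t) / \<sigma> t)" for t
  have [measurable]: "p \<in> borel_measurable borel" unfolding p_def by measurable
  have p: "0 < p t" "(p t)\<^sup>2 = sqrt (A t) / \<sigma> t" "(1 / p t)\<^sup>2 = \<sigma> t / sqrt (A t)" if "0 \<le> t" "t < 1" for t
    using Apos[OF that] \<sigma>(2)[of t] that by (auto simp: p_def power_divide)
  define G where "G t = (g t)\<^sup>2 * ennreal (sqrt (A t) / \<sigma> t)" for t
  have [measurable]: "G \<in> borel_measurable borel" unfolding G_def by measurable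
  have tail_sq: "(tail g r)\<^sup>2 \<le> tail G r * ennreal (2 * sqrt (A r))" if r: "0 \<le> r" "r < 1" for r
  proof -
    have "(tail g r)\<^sup>2 = (\<integral>\<^sup>+t. (g t * ennreal (p t) * indicator {r..<1} t) * (ennreal (1 / p t) * indicator {r..<1} t) \<partial>lborel)\<^sup>2"
      unfolding tail_def
    proof (intro arg_cong[where f = "\<lambda>x. x\<^sup>2"] nn_integral_cong)
      fix t
      show "g t * indicator {r..<1} t = (g t * ennreal (p t) * indicator {r..<1} t) * (ennreal (1 / p t) * indicator {r..<1} t)"
      proof (cases "t \<in> {r..<1}")
        case True
        then have "0 < p t" using p(1)[of t] r by auto
        then have "ennreal (p t) * ennreal (1 / p t) = 1" using ennreal_mult'[of "p t" "1 / p t"] by simp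
        then have "g t * (ennreal (p t) * ennreal (1 / p t)) = g t" by simp
        then show ?thesis using True by (simp add: mult.assoc)
      qed simp
    qed
    also have "\<dots> \<le> (\<integral>\<^sup>+t. (g t * ennreal (p t) * indicator {r..<1} t)\<^sup>2 \<partial>lborel) * (\<integral>\<^sup>+t. (ennreal (1 / p t) * indicator {r..<1} t)\<^sup>2 \<partial>lborel)"
      by (rule Cauchy_Schwarz_nn_integral) measurable
    also have "(\<integral>\<^sup>+t. (g t * ennreal (p t) * indicator {r..<1} t)\<^sup>2 \<partial>lborel) = tail G r"
      unfolding tail_def
    proof (intro nn_integral_cong)
      fix t
      show "(g t * ennreal (p t) * indicator {r..<1} t)\<^sup>2 = G t * indicator {r..<1} t"
      proof (cases "t \<in> {r..<1}")
        case True
        then have "(ennreal (p t))\<^sup>2 = ennreal (sqrt (A t) / \<sigma> t)" using p(1,2)[of t] r by (auto simp: ennreal_power)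
        then show ?thesis using True by (simp add: G_def power_mult_distrib)
      qed simp
    qed
    also have "(\<integral>\<^sup>+t. (ennreal (1 / p t) * indicator {r..<1} t)\<^sup>2 \<partial>lborel) = (\<integral>\<^sup>+t. ennreal (\<sigma> t / sqrt (A t)) * indicator {r..<1} t \<partial>lborel)"
    proof (intro nn_integral_cong)
      fix t
      show "(ennreal (1 / p t) * indicator {r..<1} t)\<^sup>2 = ennreal (\<sigma> t / sqrt (A t)) * indicator {r..<1} t"
      proof (cases "t \<in> {r..<1}")
        case True
        then have pt: "0 < p t" "(1 / p t)\<^sup>2 = \<sigma> t / sqrt (A t)" using p(1,3)[of t] r by auto
        have "(ennreal (1 / p t))\<^sup>2 = ennreal ((1 / p t)\<^sup>2)" using pt(1) by (intro ennreal_power) simp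
        then show ?thesis using True unfolding pt(2) by simp
      qed simp
    qed
    also have "(\<integral>\<^sup>+t. ennreal (\<sigma> t / sqrt (A t)) * indicator {r..<1} t \<partial>lborel) \<le> ennreal (2 * sqrt (A r))"
    proof (rule nn_integral_atLeastLessThan_le)
      fix c assume c: "r \<le> c" "c < 1"
      show "(\<integral>\<^sup>+t. ennreal (\<sigma> t / sqrt (A t)) * indicator {r..c} t \<partial>lborel) \<le> ennreal (2 * sqrt (A r))"
        by (rule nn_integral_inverse_sqrt_tail_le[OF _ _ _ c(1)]) (use c r \<sigma>0 in \<open>auto intro!: Ader Apos\<close>)
    qed (use r in auto)
    finally show ?thesis by (simp add: mult_left_mono)
  qed
  \<comment> \<open>Here sqrt A has been traded for sqrt b / sqrt W, so that after the exchange the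
    inner integral is that of w / sqrt W.\<close>
  define a where "a r = ennreal (2 * sqrt b * (w r / sqrt (W r)))" for r
  have [measurable]: "a \<in> borel_measurable borel" unfolding a_def by measurable
  have "(\<integral>\<^sup>+r. ennreal (w r) * (tail g r)\<^sup>2 * indicator {0..<1} r \<partial>lborel) \<le> (\<integral>\<^sup>+r. a r * tail G r * indicator {0..<1} r \<partial>lborel)"
  proof (intro nn_integral_mono)
    fix r :: real
    show "ennreal (w r) * (tail g r)\<^sup>2 * indicator {0..<1} r \<le> a r * tail G r * indicator {0..<1} r"
    proof (cases "r \<in> {0..<1}")
      case True
      then have r: "0 \<le> r" "r < 1" by auto
      have "sqrt (W r) * sqrt (A r) \<le> sqrt b" using WA[OF r] by (simp add: real_sqrt_mult[symmetric])
      then have "sqrt (A r) \<le> sqrt b / sqrt (W r)" using Wpos[of r] by (simp add: pos_le_divide_eq mult.commute)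
      then have "w r * (2 * sqrt (A r)) \<le> w r * (2 * (sqrt b / sqrt (W r)))" using w(2)[OF True] by (intro mult_left_mono) auto
      also have "\<dots> = 2 * sqrt b * (w r / sqrt (W r))" by simp
      finally have "ennreal (w r * (2 * sqrt (A r))) \<le> a r" unfolding a_def by (rule ennreal_leI)
      then have "ennreal (w r) * ennreal (2 * sqrt (A r)) \<le> a r" using ennreal_mult'[OF w(2)[OF True]] by simp
      then have "tail G r * (ennreal (w r) * ennreal (2 * sqrt (A r))) \<le> tail G r * a r" by (rule mult_left_mono) simp
      moreover have "ennreal (w r) * (tail g r)\<^sup>2 \<le> ennreal (w r) * (tail G r * ennreal (2 * sqrt (A r)))"
        by (intro mult_left_mono tail_sq r) simp
      ultimately have "ennreal (w r) * (tail g r)\<^sup>2 \<le> a r * tail G r" by (simp only: mult_ac)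
      then show ?thesis using True by (simp only: indicator_simps mult_1_right)
    qed simp
  qed
  also have "\<dots> = (\<integral>\<^sup>+r. (\<integral>\<^sup>+\<rho>. a \<rho> * indicator {0..r} \<rho> \<partial>lborel) * G r * indicator {0..<1} r \<partial>lborel)"
    by (rule nn_integral_tail_swap[symmetric]) measurable
  also have "\<dots> \<le> (\<integral>\<^sup>+r. ennreal (4 * b) * ((g r)\<^sup>2 * ennreal (1 / \<sigma> r) * indicator {0..<1} r) \<partial>lborel)"
  proof (intro nn_integral_mono)
    fix r :: real
    show "(\<integral>\<^sup>+\<rho>. a \<rho> * indicator {0..r} \<rho> \<partial>lborel) * G r * indicator {0..<1} r \<le> ennreal (4 * b) * ((g r)\<^sup>2 * ennreal (1 / \<sigma> r) * indicator {0..<1} r)"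
    proof (cases "r \<in> {0..<1}")
      case True
      then have r: "0 \<le> r" "r < 1" by auto
      have "(\<integral>\<^sup>+\<rho>. a \<rho> * indicator {0..r} \<rho> \<partial>lborel) = (\<integral>\<^sup>+\<rho>. ennreal (2 * sqrt b) * (ennreal (w \<rho> / sqrt (W \<rho>)) * indicator {0..r} \<rho>) \<partial>lborel)"
      proof (intro nn_integral_cong)
        fix \<rho> :: real
        have "a \<rho> = ennreal (2 * sqrt b) * ennreal (w \<rho> / sqrt (W \<rho>))" unfolding a_def using b by (intro ennreal_mult') simp
        then show "a \<rho> * indicator {0..r} \<rho> = ennreal (2 * sqrt b) * (ennreal (w \<rho> / sqrt (W \<rho>)) * indicator {0..r} \<rho>)"
          by (simp only: mult.assoc)
      qed
      also have "\<dots> = ennreal (2 * sqrt b) * (\<integral>\<^sup>+\<rho>. ennreal (w \<rho> / sqrt (W \<rho>)) * indicator {0..r} \<rho> \<partial>lborel)"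
        by (rule nn_integral_cmult) measurable
      also have "\<dots> \<le> ennreal (2 * sqrt b) * ennreal (2 * sqrt (W r))"
        by (intro mult_left_mono nn_integral_inverse_sqrt_primitive_le[OF _ _ _ r(1)]) (use r w(2) in \<open>auto intro!: Wder Wpos\<close>)
      also have "\<dots> = ennreal (2 * sqrt b * (2 * sqrt (W r)))" using b by (intro ennreal_mult'[symmetric]) simp
      finally have "(\<integral>\<^sup>+\<rho>. a \<rho> * indicator {0..r} \<rho> \<partial>lborel) * ennreal (sqrt (A r) / \<sigma> r)
        \<le> ennreal (2 * sqrt b * (2 * sqrt (W r))) * ennreal (sqrt (A r) / \<sigma> r)"
        by (rule mult_right_mono) simp
      also have "\<dots> = ennreal (2 * sqrt b * (2 * sqrt (W r)) * (sqrt (A r) / \<sigma> r))"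
        using b Wpos[of r] by (intro ennreal_mult'[symmetric]) auto
      also have "\<dots> \<le> ennreal (4 * b * (1 / \<sigma> r))"
      proof (rule ennreal_leI)
        have "sqrt (W r) * sqrt (A r) \<le> sqrt b" using WA[OF r] by (simp add: real_sqrt_mult[symmetric])
        then have "sqrt b * (sqrt (W r) * sqrt (A r)) \<le> sqrt b * sqrt b" using b by (intro mult_left_mono) auto
        then have "4 * (sqrt b * (sqrt (W r) * sqrt (A r))) * (1 / \<sigma> r) \<le> 4 * b * (1 / \<sigma> r)"
          using b \<sigma>0[OF True] by (intro mult_right_mono) auto
        then show "2 * sqrt b * (2 * sqrt (W r)) * (sqrt (A r) / \<sigma> r) \<le> 4 * b * (1 / \<sigma> r)" by (simp add: mult_ac)
      qed
      also have "\<dots> = ennreal (4 * b) * ennreal (1 / \<sigma> r)" using b by (intro ennreal_mult') simp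
      finally have "(g r)\<^sup>2 * ((\<integral>\<^sup>+\<rho>. a \<rho> * indicator {0..r} \<rho> \<partial>lborel) * ennreal (sqrt (A r) / \<sigma> r)) \<le> (g r)\<^sup>2 * (ennreal (4 * b) * ennreal (1 / \<sigma> r))"
        by (rule mult_left_mono) simp
      then have "(\<integral>\<^sup>+\<rho>. a \<rho> * indicator {0..r} \<rho> \<partial>lborel) * G r \<le> ennreal (4 * b) * ((g r)\<^sup>2 * ennreal (1 / \<sigma> r))"
        unfolding G_def by (simp only: mult_ac)
      then show ?thesis using True by (simp only: indicator_simps mult_1_right)
    qed simp
  qed
  also have "\<dots> = ennreal (4 * b) * (\<integral>\<^sup>+t. (g t)\<^sup>2 * ennreal (1 / \<sigma> t) * indicator {0..<1} t \<partial>lborel)"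
    by (rule nn_integral_cmult) measurable
  finally show ?thesis .
qed

section \<open>Doubling weights\<close>

lemma nn_integral_indicator_ge:
  fixes f :: "real \<Rightarrow> ennreal"
  assumes "a \<le> b" "0 \<le> c" "\<And>x. x \<in> {a..b} \<Longrightarrow> ennreal c \<le> f x"
  shows "ennreal (c * (b - a)) \<le> (\<integral>\<^sup>+x. f x * indicator {a..b} x \<partial>lborel)"
proof -
  have "ennreal (c * (b - a)) = (\<integral>\<^sup>+x. ennreal c * indicator {a..b} x \<partial>lborel)"
    using assms by (simp add: nn_integral_cmult_indicator ennreal_mult)
  also have "\<dots> \<le> (\<integral>\<^sup>+x. f x * indicator {a..b} x \<partial>lborel)"
    using assms(3) by (intro nn_integral_mono) (auto simp: indicator_def)
  finally show ?thesis .
qed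

lemma nn_integral_indicator_le:
  fixes f :: "real \<Rightarrow> ennreal"
  assumes "a \<le> b" "0 \<le> c" "\<And>x. x \<in> {a..b} \<Longrightarrow> f x \<le> ennreal c"
  shows "(\<integral>\<^sup>+x. f x * indicator {a..b} x \<partial>lborel) \<le> ennreal (c * (b - a))"
proof -
  have "(\<integral>\<^sup>+x. f x * indicator {a..b} x \<partial>lborel) \<le> (\<integral>\<^sup>+x. ennreal c * indicator {a..b} x \<partial>lborel)"
    using assms(3) by (intro nn_integral_mono) (auto simp: indicator_def)
  also have "\<dots> = ennreal (c * (b - a))"
    using assms by (simp add: nn_integral_cmult_indicator ennreal_mult)
  finally show ?thesis .
qed

section \<open>Finiteness, positivity and continuity of the tail of a weight\<close>

context borel_radial
begin

abbreviation U :: "real \<Rightarrow> ennreal" where "U r \<equiv> ennreal (u r)"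

definition h :: "real \<Rightarrow> real" where "h r = enn2real (tail U r)"

lemma measurable_h [measurable]: "h \<in> borel_measurable borel"
  unfolding h_def[abs_def] by measurable

text \<open>Integrability on the disc controls the integral of s u(s). Dividing by s is harmless on
  [r, 1) but leaves the case r = 0 open.\<close>

lemma tail_U_finite:
  assumes "0 < r" shows "tail U r < \<infinity>"
proof -
  have "(\<integral>\<^sup>+z. U (cmod z) * indicator (ball 0 1) z \<partial>lborel) = (\<integral>\<^sup>+z. ennreal (norm (indicator (ball (0::complex) 1) z * u (cmod z))) \<partial>lborel)"
    by (intro nn_integral_cong) (auto simp: indicator_def u_nonneg)
  also have "\<dots> < \<infinity>" using integrable_u_cmod by (simp add: integrable_iff_bounded)
  finally have fin: "(\<integral>\<^sup>+s. ennreal (2 * pi * s) * U s * indicator {0..<1} s \<partial>lborel) < \<infinity>"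
    by (subst (asm) nn_integral_radial[of U]) measurable
  have "tail U r \<le> (\<integral>\<^sup>+s. ennreal (1 / (2 * pi * r)) * (ennreal (2 * pi * s) * U s * indicator {0..<1} s) \<partial>lborel)"
    unfolding tail_def
  proof (intro nn_integral_mono)
    fix s :: real
    show "U s * indicator {r..<1} s \<le> ennreal (1 / (2 * pi * r)) * (ennreal (2 * pi * s) * U s * indicator {0..<1} s)"
    proof (cases "s \<in> {r..<1}")
      case True
      then have "1 \<le> 1 / (2 * pi * r) * (2 * pi * s)" using assms by (simp add: field_simps)
      then have "ennreal 1 \<le> ennreal (1 / (2 * pi * r) * (2 * pi * s))" by (rule ennreal_leI)
      also have "\<dots> = ennreal (1 / (2 * pi * r)) * ennreal (2 * pi * s)" using assms by (intro ennreal_mult') simp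
      finally have "1 * U s \<le> ennreal (1 / (2 * pi * r)) * ennreal (2 * pi * s) * U s" by (intro mult_right_mono) simp_all
      moreover have "s \<in> {0..<1}" using True assms by auto
      ultimately show ?thesis using True by (simp only: indicator_simps mult_1_right mult_1 mult.assoc)
    qed simp
  qed
  also have "\<dots> = ennreal (1 / (2 * pi * r)) * (\<integral>\<^sup>+s. ennreal (2 * pi * s) * U s * indicator {0..<1} s \<partial>lborel)"
    by (rule nn_integral_cmult) measurable
  also have "\<dots> < \<infinity>" using fin by (simp add: ennreal_mult_less_top)
  finally show ?thesis .
qed

text \<open>The endpoint r = 0 is included before the tail is known to be finite there: a divergent
  Bochner integral and \<open>enn2real\<close> of infinity are both 0.\<close>

lemma v_hat_eq:
  assumes "0 \<le> r" shows "v_hat v r = h r"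
proof -
  have ae: "AE s in lborel. indicat_real {r..<1} s *\<^sub>R v (complex_of_real s) = indicat_real {r..<1} s * u s"
    using u_eq AE_lborel_singleton[of 0]
  proof eventually_elim
    case (elim s)
    then show ?case using assms by (cases "s \<in> {r..<1}") auto
  qed
  have m: "(\<lambda>s. indicat_real {r..<1} s * u s) \<in> borel_measurable lborel" by measurable
  have m1: "(\<lambda>s. indicat_real {r..<1} s * u s) \<in> borel_measurable lebesgue" by (rule measurable_completion[OF m])
  have ae': "AE s in lebesgue. indicat_real {r..<1} s * u s = indicat_real {r..<1} s *\<^sub>R v (complex_of_real s)"
    using AE_completion[OF ae] by eventually_elim (rule sym)
  have "v_hat v r = (LINT s|lebesgue. indicat_real {r..<1} s * u s)"
    unfolding v_hat_def set_lebesgue_integral_def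
  proof (rule integral_cong_AE)
    show "(\<lambda>s. indicat_real {r..<1} s *\<^sub>R v (complex_of_real s)) \<in> borel_measurable lebesgue"
      by (rule borel_measurable_AE[OF m1 ae'])
  qed (use m1 AE_completion[OF ae] in auto)
  also have "\<dots> = enn2real (\<integral>\<^sup>+s. ennreal (indicat_real {r..<1} s * u s) \<partial>lebesgue)"
    by (rule integral_eq_nn_integral[OF m1]) (simp add: u_nonneg)
  also have "(\<integral>\<^sup>+s. ennreal (indicat_real {r..<1} s * u s) \<partial>lebesgue) = (\<integral>\<^sup>+s. U s * indicator {r..<1} s \<partial>lborel)"
    unfolding nn_integral_completion by (intro nn_integral_cong) (auto simp: indicator_def)
  finally show ?thesis by (simp add: h_def tail_def)
qed

lemma tail_U_pos:
  assumes "0 \<le> r" "r < 1" shows "0 < tail U r"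
proof (rule tail_pos)
  show "AE x in lborel. r < x \<and> x < 1 \<longrightarrow> U x \<noteq> 0"
    using u_eq
  proof eventually_elim
    case (elim x)
    have "0 < v (complex_of_real x)" if "r < x" "x < 1" using that assms by (intro v_pos) simp
    then show ?case using elim assms by auto
  qed
qed (use assms in simp_all)

end

locale doubling_radial = borel_radial +
  assumes doubling: "doubling_const v < \<infinity>"
begin

definition K :: real where "K = enn2real (doubling_const v)"

lemma K_nonneg: "0 \<le> K" by (simp add: K_def)

text \<open>For 0 < r < 1 doubling bounds the tail at r by \<open>K\<close> times the tail at (1 +
  r) / 2, hence at 1/2. This bound is uniform in r and survives the limit r to 0, which settles
  finiteness at 0 as well.\<close>

lemma tail_U_0_le: "tail U 0 \<le> ennreal K * tail U (1 / 2)"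
proof -
  have le: "tail U r \<le> ennreal K * tail U (1 / 2)" if r: "0 < r" "r < 1" for r
  proof -
    have "ennreal (v_hat v r / v_hat v ((1 + r) / 2)) \<le> doubling_const v"
      unfolding doubling_const_def by (rule SUP_upper) (use r in auto)
    also have "\<dots> = ennreal K" using doubling by (simp add: K_def less_top)
    finally have "h r / h ((1 + r) / 2) \<le> K" using r K_nonneg by (simp add: v_hat_eq)
    moreover have "0 < h ((1 + r) / 2)"
      using tail_U_pos[of "(1 + r) / 2"] tail_U_finite[of "(1 + r) / 2"] r by (simp add: h_def enn2real_positive_iff)
    ultimately have "h r \<le> K * h ((1 + r) / 2)" by (simp add: field_simps)
    then have "ennreal (h r) \<le> ennreal (K * h ((1 + r) / 2))" by (rule ennreal_leI)
    also have "\<dots> = ennreal K * ennreal (h ((1 + r) / 2))" by (rule ennreal_mult'[OF K_nonneg])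
    finally have "tail U r \<le> ennreal K * tail U ((1 + r) / 2)"
      using tail_U_finite[of r] tail_U_finite[of "(1 + r) / 2"] r by (simp add: h_def less_top)
    also have "\<dots> \<le> ennreal K * tail U (1 / 2)" using r by (intro mult_left_mono tail_antimono) auto
    finally show ?thesis .
  qed
  \<comment> \<open>The lower ends 1 / (n + 2) stay strictly between 0 and 1, the range of the
    doubling supremum.\<close>
  have "tail U 0 = (\<integral>\<^sup>+x. U x * indicator (\<Union>n. {1 / real (n + 2)..<1}) x \<partial>lborel)"
    unfolding tail_def
  proof (intro nn_integral_cong_AE, use AE_lborel_singleton[of 0] in eventually_elim)
    fix x :: real assume "x \<noteq> 0"
    moreover have "x \<in> (\<Union>n. {1 / real (n + 2)..<1})" if x: "0 < x" "x < 1"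
    proof -
      obtain n where "inverse (real (Suc n)) < x" using reals_Archimedean[OF x(1)] by blast
      moreover have "1 / real (n + 2) \<le> inverse (real (Suc n))" by (simp add: field_simps)
      ultimately have "x \<in> {1 / real (n + 2)..<1}" using x by simp
      then show ?thesis by blast
    qed
    moreover have "0 < x \<and> x < 1" if xU: "x \<in> (\<Union>n. {1 / real (n + 2)..<1})"
    proof -
      obtain n where "1 / real (n + 2) \<le> x" "x < 1" using xU by auto
      moreover have "0 < 1 / real (n + 2)" by simp
      ultimately show ?thesis by linarith
    qed
    ultimately have "x \<in> {0..<1} \<longleftrightarrow> x \<in> (\<Union>n. {1 / real (n + 2)..<1})"
      by (metis atLeastLessThan_iff less_eq_real_def)
    then have "indicator {0..<1} x = (indicator (\<Union>n. {1 / real (n + 2)..<1}) x :: ennreal)"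
      unfolding indicator_def by presburger
    then show "U x * indicator {0..<1} x = U x * indicator (\<Union>n. {1 / real (n + 2)..<1}) x"
      by (rule arg_cong)
  qed
  also have "\<dots> = (SUP n. \<integral>\<^sup>+x. U x * indicator {1 / real (n + 2)..<1} x \<partial>lborel)"
  proof (rule nn_integral_UN_incseq)
    show "incseq (\<lambda>n. {1 / real (n + 2)..<1})"
    proof (rule monoI)
      fix m n :: nat assume "m \<le> n"
      then have "1 / real (n + 2) \<le> 1 / real (m + 2)" by (simp add: frac_le)
      then show "{1 / real (m + 2)..<1} \<subseteq> {1 / real (n + 2)..<1}" by (metis atLeastLessThan_iff order_trans subsetI)
    qed
  qed auto
  also have "\<dots> \<le> ennreal K * tail U (1 / 2)"
  proof (rule SUP_least)
    fix n
    have "tail U (1 / real (n + 2)) \<le> ennreal K * tail U (1 / 2)" by (rule le) simp_all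
    then show "(\<integral>\<^sup>+x. U x * indicator {1 / real (n + 2)..<1} x \<partial>lborel) \<le> ennreal K * tail U (1 / 2)"
      unfolding tail_def .
  qed
  finally show ?thesis .
qed

lemma tail_U_0_finite: "tail U 0 < \<infinity>"
proof -
  have "ennreal K * tail U (1 / 2) < \<infinity>" using tail_U_finite[of "1 / 2"] by (simp add: ennreal_mult_less_top)
  with tail_U_0_le show ?thesis by (rule le_less_trans)
qed

lemma ennreal_h: "0 \<le> r \<Longrightarrow> ennreal (h r) = tail U r"
  using tail_U_0_finite tail_antimono[of 0 r U] by (simp add: h_def less_top top_unique)

lemma h_pos: "0 \<le> r \<Longrightarrow> r < 1 \<Longrightarrow> 0 < h r"
  using tail_U_pos[of r] by (simp add: ennreal_h[symmetric])

lemma h_nonneg: "0 \<le> h r" by (simp add: h_def)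

lemma h_antimono: "0 \<le> r \<Longrightarrow> r \<le> s \<Longrightarrow> h s \<le> h r"
  using tail_antimono[of r s U] by (simp add: ennreal_h[symmetric] h_nonneg)

lemma h_0_le: "h 0 \<le> K * h (1 / 2)"
  using tail_U_0_le K_nonneg by (simp add: ennreal_h[symmetric] h_nonneg ennreal_mult'[symmetric])

text \<open>On [0, 1) \<open>h\<close> is a constant minus an indefinite integral of an integrable
  function. Through it \<open>w\<close> and \<open>\<sigma>\<close> become continuous, as Hardy's
  inequality asks.\<close>

lemma h_continuous: "continuous_on {0..<1} h"
proof -
  define f where "f x = indicat_real {0..<1} x * u x" for x
  have f0: "0 \<le> f x" for x by (simp add: f_def u_nonneg)
  have m: "f \<in> borel_measurable lborel" unfolding f_def by measurable
  have "(\<integral>\<^sup>+x. ennreal (f x) \<partial>lborel) = tail U 0"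
    unfolding tail_def f_def by (intro nn_integral_cong) (auto simp: indicator_def)
  then have "integrable lborel f" using tail_U_0_finite f0 m by (intro integrableI_nonneg) auto
  then have "f integrable_on UNIV" by (rule integrable_on_lborel)
  then have int: "f integrable_on {a..b}" for a b by (rule integrable_on_subinterval) simp
  have eq: "h r = h 0 - integral {0..r} f" if r: "0 \<le> r" "r < 1" for r
  proof -
    have "(\<integral>\<^sup>+x. ennreal (f x) * indicator {0..r} x \<partial>lborel) = ennreal (integral {0..r} f)"
      by (rule nn_integral_has_integral_lebesgue'[OF _ integrable_integral[OF int]]) (rule f0)
    moreover have "(\<integral>\<^sup>+x. ennreal (f x) * indicator {0..r} x \<partial>lborel) = (\<integral>\<^sup>+x. U x * indicator {0..r} x \<partial>lborel)"
      unfolding f_def using r by (intro nn_integral_cong) (auto simp: indicator_def)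
    ultimately have "ennreal (h 0) = ennreal (integral {0..r} f) + ennreal (h r)"
      using tail_split[of U 0 r] r by (simp add: ennreal_h)
    also have "\<dots> = ennreal (integral {0..r} f + h r)"
      using f0 int by (intro ennreal_plus[symmetric] h_nonneg Henstock_Kurzweil_Integration.integral_nonneg) auto
    finally have "h 0 = integral {0..r} f + h r"
      using f0 int h_nonneg by (subst (asm) ennreal_inj) (auto intro!: add_nonneg_nonneg Henstock_Kurzweil_Integration.integral_nonneg)
    then show ?thesis by simp
  qed
  have "continuous_on {0..<1} (\<lambda>r. h 0 - integral {0..r} f)"
    by (intro continuous_intros continuous_on_subset[OF indefinite_integral_continuous_1[OF int[of 0 1]]]) auto
  then show ?thesis
  proof (rule continuous_on_eq)
    show "h 0 - integral {0..x} f = h x" if "x \<in> {0..<1}" for x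
      by (rule eq[symmetric]) (use that in auto)
  qed
qed

end

text \<open>Converts bounds on \<open>M1\<close> and \<open>M2\<close> into bounds on the products
  of the integrals themselves.\<close>

lemma ennsqrt_mult_le_iff: "ennsqrt a * ennsqrt b \<le> y \<longleftrightarrow> a * b \<le> y\<^sup>2"
  by (metis ennreal_power2_le_iff ennsqrt_power2 power_mult_distrib)

section \<open>The two Muckenhoupt quantities in terms of the profile\<close>

locale hilbert_weight = doubling_radial +
  assumes dual_finite: "(\<integral>\<^sup>+s\<in>{0..<1}. ennreal ((1 - s)\<^sup>2 / v_hat v s) \<partial>lebesgue) < \<infinity>"
begin

text \<open>On [0, 1) \<open>\<sigma>\<close> is the reciprocal of \<open>V2_hat v\<close>, the dual
  weight of Cauchy-Schwarz. \<open>W\<close> and \<open>A\<close> are the squared factors of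
  \<open>M2\<close>, while \<open>Q\<close> and \<open>P\<close> are those of
  \<open>M1\<close>.\<close>

definition \<sigma> :: "real \<Rightarrow> real" where "\<sigma> t = (1 - t)\<^sup>2 / h t"
definition w :: "real \<Rightarrow> real" where "w t = h t / (1 - t) ^ 4"
definition A :: "real \<Rightarrow> ennreal" where "A r = tail (\<lambda>t. ennreal (\<sigma> t)) r"
definition W :: "real \<Rightarrow> ennreal" where "W r = (\<integral>\<^sup>+t. ennreal (w t) * indicator {0..r} t \<partial>lborel)"
definition P :: "real \<Rightarrow> ennreal" where "P r = (\<integral>\<^sup>+t. ennreal (1 / h t) * indicator {0..r} t \<partial>lborel)"
definition Q :: "real \<Rightarrow> ennreal" where "Q r = tail (\<lambda>t. ennreal (h t / (1 - t)\<^sup>2)) r"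

lemma measurable_\<sigma> [measurable]: "\<sigma> \<in> borel_measurable borel"
  unfolding \<sigma>_def[abs_def] by measurable

lemma measurable_w [measurable]: "w \<in> borel_measurable borel"
  unfolding w_def[abs_def] by measurable

lemma \<sigma>_pos: "0 \<le> t \<Longrightarrow> t < 1 \<Longrightarrow> 0 < \<sigma> t"
  by (simp add: \<sigma>_def h_pos)

lemma w_nonneg: "0 \<le> w t"
  by (simp add: w_def h_nonneg)

lemma continuous_\<sigma>: "continuous_on {0..<1} \<sigma>"
  unfolding \<sigma>_def[abs_def] by (intro continuous_intros h_continuous) (use h_pos in force)

lemma continuous_w: "continuous_on {0..<1} w"
  unfolding w_def[abs_def] by (intro continuous_intros h_continuous) auto

lemma nn_integral_v_hat:
  assumes "S \<subseteq> {0..}"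
  shows "(\<integral>\<^sup>+s\<in>S. f (v_hat v s) s \<partial>lebesgue) = (\<integral>\<^sup>+s. f (h s) s * indicator S s \<partial>lborel)"
  unfolding nn_integral_completion
proof (intro nn_integral_cong)
  fix s
  show "f (v_hat v s) s * indicator S s = f (h s) s * indicator S s"
  proof (cases "s \<in> S")
    case True
    then have "v_hat v s = h s" using assms by (intro v_hat_eq) auto
    then show ?thesis by (simp only:)
  next
    case False
    then show ?thesis by simp
  qed
qed

lemma M2_le_iff: "M2 v \<le> y \<longleftrightarrow> (\<forall>r\<in>{0<..<1}. W r * A r \<le> y\<^sup>2)"
proof -
  have "(\<integral>\<^sup>+s\<in>{0..r}. ennreal (v_hat v s / (1 - s) ^ 4) \<partial>lebesgue) = W r" for r
    unfolding W_def w_def by (rule nn_integral_v_hat[of _ "\<lambda>y s. ennreal (y / (1 - s) ^ 4)"]) auto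
  moreover have "(\<integral>\<^sup>+s\<in>{r..<1}. ennreal ((1 - s)\<^sup>2 / v_hat v s) \<partial>lebesgue) = A r" if "0 < r" for r
    unfolding A_def \<sigma>_def tail_def by (rule nn_integral_v_hat[of _ "\<lambda>y s. ennreal ((1 - s)\<^sup>2 / y)"]) (use that in auto)
  ultimately have "M2 v = (SUP r\<in>{0<..<1}. ennsqrt (W r) * ennsqrt (A r))"
    unfolding M2_def by (intro SUP_cong refl) (simp only: greaterThanLessThan_iff)
  then show ?thesis by (simp only: SUP_le_iff ennsqrt_mult_le_iff)
qed

lemma M1_le_iff: "M1 v \<le> y \<longleftrightarrow> (\<forall>r\<in>{0<..<1}. Q r * P r \<le> y\<^sup>2)"
proof -
  have "(\<integral>\<^sup>+s\<in>{0..r}. ennreal (1 / v_hat v s) \<partial>lebesgue) = P r" for r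
    unfolding P_def by (rule nn_integral_v_hat[of _ "\<lambda>y s. ennreal (1 / y)"]) auto
  moreover have "(\<integral>\<^sup>+s\<in>{r..<1}. ennreal (v_hat v s / (1 - s)\<^sup>2) \<partial>lebesgue) = Q r" if "0 < r" for r
    unfolding Q_def tail_def by (rule nn_integral_v_hat[of _ "\<lambda>y s. ennreal (y / (1 - s)\<^sup>2)"]) (use that in auto)
  ultimately have "M1 v = (SUP r\<in>{0<..<1}. ennsqrt (Q r) * ennsqrt (P r))"
    unfolding M1_def by (intro SUP_cong refl) (simp only: greaterThanLessThan_iff)
  then show ?thesis by (simp only: SUP_le_iff ennsqrt_mult_le_iff)
qed

lemma A_0_finite: "A 0 < \<infinity>"
proof -
  have "(\<integral>\<^sup>+s\<in>{0..<1}. ennreal ((1 - s)\<^sup>2 / v_hat v s) \<partial>lebesgue) = A 0"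
    unfolding A_def \<sigma>_def tail_def by (rule nn_integral_v_hat[of _ "\<lambda>y s. ennreal ((1 - s)\<^sup>2 / y)"]) auto
  then show ?thesis using dual_finite by simp
qed

lemma A_antimono: "r \<le> s \<Longrightarrow> A s \<le> A r"
  unfolding A_def by (rule tail_antimono)

lemma A_finite: "0 \<le> r \<Longrightarrow> A r < \<infinity>"
  using A_antimono[of 0 r] A_0_finite by (rule le_less_trans)

lemma A_pos: "0 \<le> r \<Longrightarrow> r < 1 \<Longrightarrow> 0 < A r"
  unfolding A_def using \<sigma>_pos by (intro tail_pos AE_I2) (auto simp: ennreal_eq_0_iff not_le)

lemma W_mono: "r \<le> s \<Longrightarrow> W r \<le> W s"
  unfolding W_def by (intro nn_integral_mono) (auto simp: indicator_def)

lemma inverse_h_mono: "0 \<le> r \<Longrightarrow> r \<le> s \<Longrightarrow> s < 1 \<Longrightarrow> 1 / h r \<le> 1 / h s"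
  by (intro divide_left_mono h_antimono mult_pos_pos h_pos) auto

text \<open>Since \<open>h\<close> decreases, \<open>\<sigma>\<close> is at most 1 / h(1/2) on
  [0, 1/2] and at least 1 / (16 h(1/2)) on [1/2, 3/4]. The resulting integral bounds have ratio 32,
  and adding A(1/2) itself gives 33.\<close>

lemma A_0_le: "A 0 \<le> 33 * A (1 / 2)"
proof -
  have h2: "0 < h (1 / 2)" by (rule h_pos) auto
  have "(\<integral>\<^sup>+t. ennreal (\<sigma> t) * indicator {0..1 / 2} t \<partial>lborel) \<le> ennreal (1 / h (1 / 2) * (1 / 2 - 0))"
  proof (rule nn_integral_indicator_le)
    fix t :: real assume t: "t \<in> {0..1 / 2}"
    then have "(1 - t)\<^sup>2 * (1 / h t) \<le> 1 * (1 / h (1 / 2))"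
      by (intro mult_mono inverse_h_mono power_le_one) (auto simp: h_nonneg)
    then show "ennreal (\<sigma> t) \<le> ennreal (1 / h (1 / 2))" by (intro ennreal_leI) (simp add: \<sigma>_def)
  qed (use h2 in auto)
  also have "\<dots> = ennreal (32 * (1 / 16 * (1 / h (1 / 2)) * (3 / 4 - 1 / 2)))" by (rule arg_cong[where f = ennreal]) (simp add: field_simps)
  also have "\<dots> = 32 * ennreal (1 / 16 * (1 / h (1 / 2)) * (3 / 4 - 1 / 2))" by (subst ennreal_mult') simp_all
  also have "\<dots> \<le> 32 * (\<integral>\<^sup>+t. ennreal (\<sigma> t) * indicator {1 / 2..3 / 4} t \<partial>lborel)"
  proof (intro mult_left_mono nn_integral_indicator_ge)
    fix t :: real assume t: "t \<in> {1 / 2..3 / 4}"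
    have "(1 / 4)\<^sup>2 \<le> (1 - t)\<^sup>2" using t by (intro power_mono) auto
    then have "1 / 16 * (1 / h (1 / 2)) \<le> (1 - t)\<^sup>2 * (1 / h t)"
      using t h2 by (intro mult_mono inverse_h_mono) (auto simp: power2_eq_square)
    then show "ennreal (1 / 16 * (1 / h (1 / 2))) \<le> ennreal (\<sigma> t)" by (intro ennreal_leI) (simp add: \<sigma>_def)
  qed (use h2 in auto)
  also have "\<dots> \<le> 32 * A (1 / 2)"
    unfolding A_def tail_def by (intro mult_left_mono nn_integral_mono) (auto simp: indicator_def)
  finally have "(\<integral>\<^sup>+t. ennreal (\<sigma> t) * indicator {0..1 / 2} t \<partial>lborel) + A (1 / 2) \<le> 32 * A (1 / 2) + A (1 / 2)"
    by (rule add_right_mono)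
  also have "\<dots> = 33 * A (1 / 2)" using distrib_right[of 32 1 "A (1 / 2)"] by simp
  finally show ?thesis using tail_split[of "\<lambda>t. ennreal (\<sigma> t)" 0 "1 / 2"] by (simp add: A_def)
qed

lemma W_half_ge: "ennreal (h (1 / 2) / 2) \<le> W (1 / 2)"
proof -
  have "ennreal (h (1 / 2) * (1 / 2 - 0)) \<le> W (1 / 2)"
    unfolding W_def
  proof (rule nn_integral_indicator_ge)
    fix t :: real assume t: "t \<in> {0..1 / 2}"
    have "h (1 / 2) * 1 \<le> h t * (1 / (1 - t) ^ 4)"
      using t by (intro mult_mono h_antimono) (auto simp: h_nonneg power_le_one)
    then show "ennreal (h (1 / 2)) \<le> ennreal (w t)" by (intro ennreal_leI) (simp add: w_def)
  qed (auto simp: h_nonneg)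
  then show ?thesis by simp
qed

text \<open>The Muckenhoupt condition at the endpoint 0. Doubling and the lower bound for W(1/2)
  give h(0) \<le> 2 K W(1/2), and A(0) \<le> 33 A(1/2) moves the other factor to 1/2, so 66 = 2 *
  33.\<close>

lemma h_0_A_0_le:
  assumes "M2 v \<le> y"
  shows "ennreal (h 0) * A 0 \<le> ennreal (66 * K) * y\<^sup>2"
proof -
  have "ennreal (h 0) * A 0 \<le> ennreal (2 * K * (h (1 / 2) / 2)) * (33 * A (1 / 2))"
    using h_0_le by (intro mult_mono A_0_le ennreal_leI) auto
  also have "\<dots> = ennreal (2 * K) * (ennreal (h (1 / 2) / 2) * (33 * A (1 / 2)))"
  proof -
    have "0 \<le> 2 * K" using K_nonneg by simp
    then show ?thesis by (subst ennreal_mult', assumption) (rule mult.assoc)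
  qed
  also have "\<dots> \<le> ennreal (2 * K) * (W (1 / 2) * (33 * A (1 / 2)))"
    by (intro mult_left_mono mult_right_mono W_half_ge) auto
  also have "\<dots> = (ennreal (2 * K) * 33) * (W (1 / 2) * A (1 / 2))" by (simp only: mult_ac)
  also have "ennreal (2 * K) * 33 = ennreal (66 * K)"
    using ennreal_mult'[of 33 "2 * K"] by (simp add: mult.commute)
  also have "ennreal (66 * K) * (W (1 / 2) * A (1 / 2)) \<le> ennreal (66 * K) * y\<^sup>2"
    using assms by (intro mult_left_mono) (auto simp: M2_le_iff)
  finally show ?thesis .
qed

text \<open>For r < 1/2 both factors are compared with those at 1/2. Test functions are then called
  upon only for r0 \<ge> 1/2, where the factor r0^2 of the lower energy bound stays away from
  0.\<close>

lemma M2_le_if_large: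
  assumes "\<And>r. 1 / 2 \<le> r \<Longrightarrow> r < 1 \<Longrightarrow> W r * A r \<le> B"
    and that: "0 < r" "r < 1"
  shows "W r * A r \<le> 33 * B"
proof (cases "r < 1 / 2")
  case True
  have "W r * A r \<le> W (1 / 2) * (33 * A (1 / 2))"
    using True that by (intro mult_mono W_mono order_trans[OF A_antimono A_0_le]) auto
  also have "\<dots> = 33 * (W (1 / 2) * A (1 / 2))" by (simp only: mult_ac)
  also have "\<dots> \<le> 33 * B" by (intro mult_left_mono assms(1)) auto
  finally show ?thesis .
next
  case False
  then have "1 * (W r * A r) \<le> 33 * B" using that by (intro mult_mono assms(1)) auto
  then show ?thesis by simp
qed

text \<open>If \<open>M1 v\<close> were small, \<open>P\<close> would grow by a factor \<open>17\<close> whenever \<open>1 - r\<close> is divided by \<open>4\<close>, whereas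
  finiteness of the dual integral only allows the factor \<open>16\<close>.\<close>

lemma M1_ge: "ennreal (1 / 12) \<le> M1 v"
proof (rule ccontr)
  assume "\<not> ennreal (1 / 12) \<le> M1 v"
  then have "M1 v \<le> ennreal (1 / 12)" by simp
  \<comment> \<open>The square 1 / 144 is rounded up to 1 / 128, a value for which the dyadic
    computation below gains exactly a factor 16.\<close>
  then have QP: "Q r * P r \<le> ennreal (1 / 128)" if "0 < r" "r < 1" for r
  proof -
    have "Q r * P r \<le> (ennreal (1 / 12))\<^sup>2" using \<open>M1 v \<le> ennreal (1 / 12)\<close> that by (auto simp: M1_le_iff)
    also have "\<dots> = ennreal ((1 / 12)\<^sup>2)" by (rule ennreal_power) simp
    also have "\<dots> \<le> ennreal (1 / 128)" by (intro ennreal_leI) (simp add: power2_eq_square)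
    finally show ?thesis .
  qed
  \<comment> \<open>Dyadic points approaching 1. As \<open>x 0 = 0\<close> lies outside the range of
    the supremum in \<open>M1\<close>, the growth step asks for \<open>0 < k\<close>.\<close>
  define x where "x k = 1 - (1 / 2 :: real) ^ k" for k
  have x: "0 \<le> x k" "x k < 1" "x k \<le> x (Suc k)" for k by (simp_all add: x_def power_le_one)
  have d: "x (Suc k) - x k = (1 / 2) ^ Suc k" for k by (simp add: x_def)
  define p where "p k = enn2real (P (x k))" for k
  have P_fin: "P (x k) \<le> ennreal (1 / h (x k) * (x k - 0))" for k
    unfolding P_def using x[of k] by (intro nn_integral_indicator_le) (auto intro!: ennreal_leI inverse_h_mono simp: h_nonneg)
  then have "P (x k) < \<infinity>" for k by (rule le_less_trans) simp
  then have p: "P (x k) = ennreal (p k)" for k by (simp add: p_def less_top)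
  \<comment> \<open>Up to \<open>x k\<close> the factor (1 - t)^2 is at least 4^-k, so 1 / h \<le>
    4^k \<sigma>.\<close>
  have p_le: "p k \<le> 4 ^ k * enn2real (A 0)" for k
  proof -
    have "P (x k) \<le> (\<integral>\<^sup>+t. ennreal (4 ^ k) * (ennreal (\<sigma> t) * indicator {0..<1} t) \<partial>lborel)"
      unfolding P_def
    proof (intro nn_integral_mono)
      fix t :: real
      show "ennreal (1 / h t) * indicator {0..x k} t \<le> ennreal (4 ^ k) * (ennreal (\<sigma> t) * indicator {0..<1} t)"
      proof (cases "t \<in> {0..x k}")
        case True
        have "((1 / 2) ^ k)\<^sup>2 \<le> (1 - t)\<^sup>2" using True by (intro power_mono) (auto simp: x_def)
        then have "4 ^ k * ((1 / 2) ^ k)\<^sup>2 \<le> 4 ^ k * (1 - t)\<^sup>2" by (intro mult_left_mono) auto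
        moreover have "4 ^ k * ((1 / 2) ^ k)\<^sup>2 = (1::real)"
          by (simp add: power2_eq_square power_mult_distrib[symmetric])
        ultimately have "1 * (1 / h t) \<le> 4 ^ k * (1 - t)\<^sup>2 * (1 / h t)"
          by (intro mult_right_mono) (auto simp: h_nonneg)
        then have "ennreal (1 / h t) \<le> ennreal (4 ^ k * \<sigma> t)" by (intro ennreal_leI) (simp add: \<sigma>_def)
        also have "\<dots> = ennreal (4 ^ k) * ennreal (\<sigma> t)" by (rule ennreal_mult') simp
        finally have "ennreal (1 / h t) \<le> ennreal (4 ^ k) * ennreal (\<sigma> t)" .
        moreover have "t \<in> {0..<1}" using True x(2)[of k] by auto
        ultimately show ?thesis using True by (simp only: indicator_simps mult_1_right)
      qed simp
    qed
    also have "\<dots> = ennreal (4 ^ k) * A 0"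
      unfolding A_def tail_def by (rule nn_integral_cmult) measurable
    also have "A 0 = ennreal (enn2real (A 0))" using A_0_finite by (simp add: less_top)
    also have "ennreal (4 ^ k) * ennreal (enn2real (A 0)) = ennreal (4 ^ k * enn2real (A 0))" by (rule ennreal_mult'[symmetric]) simp
    finally show ?thesis unfolding p by (subst (asm) ennreal_le_iff) simp_all
  qed
  \<comment> \<open>Write y for h at \<open>x (Suc k)\<close>. The part of \<open>Q (x k)\<close> up
    to \<open>x (Suc k)\<close> is at least y 2^k / 2, so the smallness of \<open>Q * P\<close>
    forces p k \<le> 1 / (64 y 2^k). The interval from \<open>x (Suc k)\<close> to
    \<open>x (Suc (Suc k))\<close> adds to \<open>P\<close> at least 1 / (4 y 2^k), hence at least
    16 p k, and 1 + 16 = 17.\<close>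
  have step: "17 * p k \<le> p (Suc (Suc k))" if "0 < k" for k
  proof -
    let ?y = "h (x (Suc k))"
    have y: "0 < ?y" by (rule h_pos) (use x in auto)
    have "ennreal (?y * 4 ^ k * (x (Suc k) - x k)) \<le> (\<integral>\<^sup>+t. ennreal (h t / (1 - t)\<^sup>2) * indicator {x k..x (Suc k)} t \<partial>lborel)"
    proof (rule nn_integral_indicator_ge)
      fix t assume t: "t \<in> {x k..x (Suc k)}"
      then have "t < 1" using x(2)[of "Suc k"] by auto
      have "1 - t \<le> (1 / 2) ^ k" using t by (simp add: x_def)
      then have "(1 - t)\<^sup>2 \<le> ((1 / 2) ^ k)\<^sup>2" using \<open>t < 1\<close> by (intro power_mono) auto
      then have "1 / ((1 / 2) ^ k)\<^sup>2 \<le> 1 / (1 - t)\<^sup>2" using \<open>t < 1\<close> by (intro divide_left_mono) auto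
      moreover have "1 / ((1 / 2) ^ k)\<^sup>2 = (4 ^ k :: real)"
        by (simp add: power2_eq_square power_mult_distrib[symmetric] power_divide)
      ultimately have "?y * 4 ^ k \<le> h t * (1 / (1 - t)\<^sup>2)"
        using t x(1)[of k] by (intro mult_mono h_antimono) (auto simp: h_nonneg)
      then show "ennreal (?y * 4 ^ k) \<le> ennreal (h t / (1 - t)\<^sup>2)" by (intro ennreal_leI) simp
    qed (use x y in auto)
    also have "\<dots> \<le> Q (x k)"
      unfolding Q_def tail_def using x(2)[of "Suc k"] by (intro nn_integral_mono) (auto simp: indicator_def)
    finally have "ennreal (?y * 4 ^ k * (x (Suc k) - x k)) * ennreal (p k) \<le> Q (x k) * P (x k)"
      unfolding p by (rule mult_right_mono) simp
    also have "\<dots> \<le> ennreal (1 / 128)"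
    proof (rule QP)
      show "0 < x k" using \<open>0 < k\<close> by (simp add: x_def power_less_one_iff)
    qed (rule x)
    finally have "ennreal (?y * 4 ^ k * (x (Suc k) - x k) * p k) \<le> ennreal (1 / 128)"
      using y x(3)[of k] by (subst ennreal_mult') auto
    then have le: "?y * 4 ^ k * (x (Suc k) - x k) * p k \<le> 1 / 128" by (subst (asm) ennreal_le_iff) auto
    have "4 ^ k * (1 / 2) ^ k = (2 ^ k :: real)" by (simp add: power_mult_distrib[symmetric])
    then have eq: "?y * 4 ^ k * (x (Suc k) - x k) = ?y * 2 ^ k / 2" unfolding d by (simp add: mult.assoc)
    have 1: "?y * 2 ^ k * p k \<le> 1 / 64" using le unfolding eq by (simp add: mult_ac)
    have "ennreal (1 / ?y * (x (Suc (Suc k)) - x (Suc k))) \<le> (\<integral>\<^sup>+t. ennreal (1 / h t) * indicator {x (Suc k)..x (Suc (Suc k))} t \<partial>lborel)"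
    proof (rule nn_integral_indicator_ge)
      fix t assume t: "t \<in> {x (Suc k)..x (Suc (Suc k))}"
      then have "t < 1" using x(2)[of "Suc (Suc k)"] by auto
      then show "ennreal (1 / ?y) \<le> ennreal (1 / h t)" using t x(1)[of "Suc k"] by (intro ennreal_leI inverse_h_mono) auto
    qed (use x y in auto)
    then have "ennreal (p k) + ennreal (1 / ?y * (x (Suc (Suc k)) - x (Suc k)))
      \<le> P (x k) + (\<integral>\<^sup>+t. ennreal (1 / h t) * indicator {x (Suc k)..x (Suc (Suc k))} t \<partial>lborel)"
      unfolding p by (rule add_left_mono)
    also have "\<dots> = (\<integral>\<^sup>+t. ennreal (1 / h t) * indicator {0..x k} t + ennreal (1 / h t) * indicator {x (Suc k)..x (Suc (Suc k))} t \<partial>lborel)"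
      unfolding P_def by (rule nn_integral_add[symmetric]) measurable
    also have "\<dots> \<le> P (x (Suc (Suc k)))"
      unfolding P_def
    proof (intro nn_integral_mono)
      fix t
      have "x k < x (Suc k)" by (simp add: x_def)
      then show "ennreal (1 / h t) * indicator {0..x k} t + ennreal (1 / h t) * indicator {x (Suc k)..x (Suc (Suc k))} t
        \<le> ennreal (1 / h t) * indicator {0..x (Suc (Suc k))} t"
        using x(1)[of k] x(3)[of "Suc k"] by (auto simp: indicator_def)
    qed
    finally have "ennreal (p k + 1 / ?y * (x (Suc (Suc k)) - x (Suc k))) \<le> ennreal (p (Suc (Suc k)))"
      unfolding p using y x(3)[of "Suc k"] by (subst ennreal_plus) (auto simp: p_def)
    then have 2: "p k + 1 / ?y * (x (Suc (Suc k)) - x (Suc k)) \<le> p (Suc (Suc k))" by (subst (asm) ennreal_le_iff) (auto simp: p_def)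
    have "16 * p k \<le> 1 / ?y * (x (Suc (Suc k)) - x (Suc k))"
    proof -
      have "16 * p k = (?y * 2 ^ k * p k) * (16 / (?y * 2 ^ k))" using y by simp
      also have "\<dots> \<le> (1 / 64) * (16 / (?y * 2 ^ k))" using 1 y by (intro mult_right_mono) auto
      also have "\<dots> = 1 / ?y * (x (Suc (Suc k)) - x (Suc k))" unfolding d by (simp add: power_divide)
      finally show ?thesis .
    qed
    then show ?thesis using 2 by linarith
  qed
  have pow: "17 ^ j * p 1 \<le> p (1 + 2 * j)" for j
  proof (induction j)
    case (Suc j)
    have "17 ^ Suc j * p 1 \<le> 17 * p (1 + 2 * j)" using Suc by simp
    also have "\<dots> \<le> p (1 + 2 * Suc j)" using step[of "1 + 2 * j"] by simp
    finally show ?case .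
  qed simp
  have p1: "0 < p 1"
  proof -
    have "ennreal (1 / h 0 * (1 / 2 - 0)) \<le> P (x 1)"
      unfolding P_def x_def using h_pos[of 0] by (simp, intro nn_integral_indicator_ge[of 0 "1 / 2" "1 / h 0", simplified]) (auto intro!: ennreal_leI inverse_h_mono[of 0, simplified])
    then have "1 / h 0 * (1 / 2 - 0) \<le> p 1" unfolding p by (subst (asm) ennreal_le_iff) (auto simp: p_def)
    moreover have "0 < 1 / h 0 * (1 / 2 - 0)" using h_pos[of 0] by simp
    ultimately show ?thesis by linarith
  qed
  have bound: "(17 / 16) ^ j \<le> 4 * enn2real (A 0) / p 1" for j
  proof -
    have "17 ^ j * p 1 \<le> 4 ^ (1 + 2 * j) * enn2real (A 0)" using pow[of j] p_le[of "1 + 2 * j"] by linarith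
    also have "(4::real) ^ (1 + 2 * j) = 4 * 16 ^ j" by (simp add: power_mult)
    finally have "17 ^ j * p 1 \<le> 16 ^ j * (4 * enn2real (A 0))" by (simp only: mult_ac)
    then have "17 ^ j * p 1 / 16 ^ j \<le> 4 * enn2real (A 0)" by (simp add: pos_divide_le_eq mult.commute)
    then show ?thesis using p1 by (simp add: pos_le_divide_eq power_divide)
  qed
  obtain j where "4 * enn2real (A 0) / p 1 < (17 / 16) ^ j" using real_arch_pow[of "17 / 16" "4 * enn2real (A 0) / p 1"] by auto
  then show False using bound[of j] by simp
qed

end

section \<open>Norm estimates\<close>

text \<open>A Borel stand-in for |\<open>\<phi>\<close>|: \<open>\<phi>\<close> is only Lebesgue
  measurable on [0, 1) and arbitrary elsewhere, whereas the energy estimates are stated for Borel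
  functions on the line.\<close>

definition modulus_rep :: "(real \<Rightarrow> complex) \<Rightarrow> (real \<Rightarrow> ennreal) \<Rightarrow> bool" where
  "modulus_rep \<phi> g \<longleftrightarrow> g \<in> borel_measurable borel \<and> (\<forall>t. t \<notin> {0..<1} \<longrightarrow> g t = 0) \<and>
     (AE t in lborel. t \<in> {0..<1} \<longrightarrow> g t = ennreal (cmod (\<phi> t)))"

lemma modulus_rep_zero: "modulus_rep \<phi> g \<Longrightarrow> t \<notin> {0..<1} \<Longrightarrow> g t = 0"
  unfolding modulus_rep_def by blast

lemma tail_0_modulus_rep: "modulus_rep \<phi> g \<Longrightarrow> tail g 0 = (\<integral>\<^sup>+t. g t \<partial>lborel)"
  by (rule tail_0_eq) (rule modulus_rep_zero)

lemma modulus_rep_exists: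
  assumes "\<phi> \<in> borel_measurable (lebesgue_on {0..<1})"
  obtains g where "modulus_rep \<phi> g"
proof -
  have "(\<lambda>t. indicat_real {0..<1} t *\<^sub>R \<phi> t) \<in> borel_measurable lebesgue"
    using assms by (subst (asm) borel_measurable_restrict_space_iff) auto
  then have "(\<lambda>t. ennreal (cmod (indicat_real {0..<1} t *\<^sub>R \<phi> t))) \<in> borel_measurable lebesgue"
    by measurable
  from completion_ex_borel_measurable[OF this] obtain g
    where g: "g \<in> borel_measurable lborel" "AE t in lborel. ennreal (cmod (indicat_real {0..<1} t *\<^sub>R \<phi> t)) = g t"
    by blast
  have [measurable]: "g \<in> borel_measurable borel" using g(1) by simp
  have "modulus_rep \<phi> (\<lambda>t. g t * indicator {0..<1} t)"
    unfolding modulus_rep_def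
  proof (intro conjI)
    show "AE t in lborel. t \<in> {0..<1} \<longrightarrow> g t * indicator {0..<1} t = ennreal (cmod (\<phi> t))"
      using g(2)
    proof eventually_elim
      case (elim t)
      then show ?case by (cases "t \<in> {0..<1}") auto
    qed
    show "(\<lambda>t. g t * indicator {0..<1} t) \<in> borel_measurable borel" by measurable
  qed simp
  then show ?thesis by (rule that)
qed

lemma modulus_rep_norm: "modulus_rep \<phi> g \<Longrightarrow> modulus_rep (\<lambda>t. complex_of_real (cmod (\<phi> t))) g"
  by (simp add: modulus_rep_def)

text \<open>The condition \<open>f 0 = 0\<close> makes both integrands vanish off
  \<open>{0..<1}\<close>. It is applied with the identity for moments and with the square for
  norms.\<close>

lemma nn_integral_modulus_rep:
  assumes "modulus_rep \<phi> g" and "f 0 = 0"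
  shows "(\<integral>\<^sup>+t. F t * f (ennreal (cmod (\<phi> t))) * indicator {0..<1} t \<partial>lebesgue) = (\<integral>\<^sup>+t. F t * f (g t) \<partial>lborel)"
proof -
  have "(\<integral>\<^sup>+t. F t * f (ennreal (cmod (\<phi> t))) * indicator {0..<1} t \<partial>lborel) = (\<integral>\<^sup>+t. F t * f (g t) \<partial>lborel)"
  proof (rule nn_integral_cong_AE)
    have "AE t in lborel. t \<in> {0..<1} \<longrightarrow> g t = ennreal (cmod (\<phi> t))" using assms(1) by (simp add: modulus_rep_def)
    then show "AE t in lborel. F t * f (ennreal (cmod (\<phi> t))) * indicator {0..<1} t = F t * f (g t)"
    proof eventually_elim
      case (elim t)
      show ?case
      proof (cases "t \<in> {0..<1}")
        case True
        then show ?thesis using elim by simp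
      next
        case False
        then have "g t = 0" using assms(1) by (simp add: modulus_rep_def)
        then show ?thesis using False assms(2) by simp
      qed
    qed
  qed
  then show ?thesis by (simp only: nn_integral_completion)
qed

lemma nn_moment_0_eq_tail:
  assumes "modulus_rep \<phi> g" shows "nn_moment g 0 = tail g 0"
  using assms by (simp add: nn_moment_def tail_0_modulus_rep)

lemma set_integrable_modulus_rep:
  assumes \<phi>: "\<phi> \<in> borel_measurable (lebesgue_on {0..<1})" and rep: "modulus_rep \<phi> g" and fin: "tail g 0 < \<infinity>"
  shows "set_integrable lebesgue {0..<1} \<phi>"
  unfolding set_integrable_def
proof (rule integrableI_bounded)
  show "(\<lambda>t. indicat_real {0..<1} t *\<^sub>R \<phi> t) \<in> borel_measurable lebesgue"
    using \<phi> by (subst (asm) borel_measurable_restrict_space_iff) auto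
  have "(\<integral>\<^sup>+t. ennreal (norm (indicat_real {0..<1} t *\<^sub>R \<phi> t)) \<partial>lebesgue)
    = (\<integral>\<^sup>+t. 1 * ennreal (cmod (\<phi> t)) * indicator {0..<1} t \<partial>lebesgue)"
    by (intro nn_integral_cong) (auto simp: indicator_def)
  also have "\<dots> = (\<integral>\<^sup>+t. 1 * g t \<partial>lborel)" by (rule nn_integral_modulus_rep[OF rep, of "\<lambda>x. x"]) simp
  also have "\<dots> = tail g 0" using rep by (simp add: tail_0_modulus_rep)
  finally show "(\<integral>\<^sup>+t. ennreal (norm (indicat_real {0..<1} t *\<^sub>R \<phi> t)) \<partial>lebesgue) < \<infinity>" using fin by simp
qed

lemma nn_integral_moment:
  assumes rep: "modulus_rep \<phi> g"
  shows "(\<integral>\<^sup>+t. ennreal (norm (indicat_real {0..<1} t *\<^sub>R (complex_of_real (t ^ n) * \<phi> t))) \<partial>lebesgue) = nn_moment g n"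
proof -
  have "(\<integral>\<^sup>+t. ennreal (norm (indicat_real {0..<1} t *\<^sub>R (complex_of_real (t ^ n) * \<phi> t))) \<partial>lebesgue)
    = (\<integral>\<^sup>+t. ennreal (t ^ n) * ennreal (cmod (\<phi> t)) * indicator {0..<1} t \<partial>lebesgue)"
  proof (intro nn_integral_cong)
    fix t :: real
    show "ennreal (norm (indicat_real {0..<1} t *\<^sub>R (complex_of_real (t ^ n) * \<phi> t))) = ennreal (t ^ n) * ennreal (cmod (\<phi> t)) * indicator {0..<1} t"
    proof (cases "t \<in> {0..<1}")
      case True
      then have "norm (complex_of_real (t ^ n) * \<phi> t) = t ^ n * cmod (\<phi> t)" by (simp add: norm_mult norm_power)
      moreover have "ennreal (t ^ n * cmod (\<phi> t)) = ennreal (t ^ n) * ennreal (cmod (\<phi> t))" using True by (intro ennreal_mult') simp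
      ultimately show ?thesis using True by simp
    qed simp
  qed
  also have "\<dots> = nn_moment g n" unfolding nn_moment_def by (rule nn_integral_modulus_rep[OF rep, of "\<lambda>x. x"]) simp
  finally show ?thesis .
qed

lemma moment_le_nn_moment:
  assumes "set_integrable lebesgue {0..<1} \<phi>" and rep: "modulus_rep \<phi> g"
  shows "ennreal (cmod (moment \<phi> n)) \<le> nn_moment g n"
  unfolding moment_def set_lebesgue_integral_def nn_integral_moment[OF rep, symmetric]
  by (rule integral_norm_bound_ennreal) (use moment_set_integrable[OF assms(1)] in \<open>simp add: set_integrable_def\<close>)

lemma moment_eq_nn_moment:
  assumes \<phi>: "set_integrable lebesgue {0..<1} \<phi>" and rep: "modulus_rep \<phi> g" and nonneg: "\<And>t. \<phi> t = complex_of_real (cmod (\<phi> t))"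
  shows "ennreal (cmod (moment \<phi> n)) = nn_moment g n"
proof -
  let ?f = "\<lambda>t. norm (indicat_real {0..<1} t *\<^sub>R (complex_of_real (t ^ n) * \<phi> t))"
  have int: "integrable lebesgue ?f"
    using moment_set_integrable[OF \<phi>, of n] unfolding set_integrable_def by (rule integrable_norm)
  have "indicat_real {0..<1} t *\<^sub>R (complex_of_real (t ^ n) * \<phi> t) = complex_of_real (?f t)" for t
  proof (cases "t \<in> {0..<1}")
    case True
    then show ?thesis by (subst nonneg) (simp add: norm_mult norm_power)
  qed simp
  then have "moment \<phi> n = complex_of_real (LINT t|lebesgue. ?f t)"
    unfolding moment_def set_lebesgue_integral_def integral_complex_of_real[symmetric] by (intro Bochner_Integration.integral_cong refl)
  moreover have "0 \<le> (LINT t|lebesgue. ?f t)" by (rule Bochner_Integration.integral_nonneg) simp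
  ultimately have "ennreal (cmod (moment \<phi> n)) = ennreal (LINT t|lebesgue. ?f t)" by simp
  also have "\<dots> = (\<integral>\<^sup>+t. ennreal (?f t) \<partial>lebesgue)" by (rule nn_integral_eq_integral[OF int, symmetric]) simp
  also have "\<dots> = nn_moment g n" by (rule nn_integral_moment[OF rep])
  finally show ?thesis .
qed

context borel_radial
begin

text \<open>Parseval sees only the absolute values of the Taylor coefficients, and each is at most
  the corresponding moment of \<open>g\<close>. If \<open>\<phi>\<close> equals its modulus, nothing
  cancels inside the moments and equality holds.\<close>

lemma dirichlet_norm_energy:
  assumes \<phi>: "set_integrable lebesgue {0..<1} \<phi>" and rep: "modulus_rep \<phi> g"
  shows dirichlet_norm_le_energy: "(dirichlet_norm v (hilbert_op \<phi>))\<^sup>2 \<le> (tail g 0)\<^sup>2 + energy U g"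
    and dirichlet_norm_eq_energy: "(\<And>t. \<phi> t = complex_of_real (cmod (\<phi> t))) \<Longrightarrow>
      (dirichlet_norm v (hilbert_op \<phi>))\<^sup>2 = (tail g 0)\<^sup>2 + energy U g"
proof -
  have diffs: "ennreal ((cmod (diffs (moment \<phi>) n))\<^sup>2 * r ^ (2 * n))
    = ennreal ((real (Suc n))\<^sup>2 * r ^ (2 * n)) * (ennreal (cmod (moment \<phi> (Suc n))))\<^sup>2" for n r
  proof -
    have "(cmod (diffs (moment \<phi>) n))\<^sup>2 * r ^ (2 * n) = (real (Suc n))\<^sup>2 * r ^ (2 * n) * (cmod (moment \<phi> (Suc n)))\<^sup>2"
      unfolding diffs_def norm_mult norm_of_nat power_mult_distrib by (simp only: mult_ac)
    moreover have "0 \<le> (real (Suc n))\<^sup>2 * r ^ (2 * n)" by (intro mult_nonneg_nonneg) (simp_all add: power_mult)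
    ultimately show ?thesis by (simp only: ennreal_mult' ennreal_power norm_ge_zero)
  qed
  have zero: "ennreal ((cmod (moment \<phi> 0))\<^sup>2) = (ennreal (cmod (moment \<phi> 0)))\<^sup>2" by (simp add: ennreal_power)
  note eq = dirichlet_norm_hilbert_op[OF \<phi>, unfolded diffs zero]
  show "(dirichlet_norm v (hilbert_op \<phi>))\<^sup>2 \<le> (tail g 0)\<^sup>2 + energy U g"
    unfolding eq energy_def nn_moment_0_eq_tail[OF rep, symmetric]
    by (intro add_mono nn_integral_mono mult_right_mono mult_left_mono suminf_le power_mono moment_le_nn_moment[OF \<phi> rep]) auto
  show "(dirichlet_norm v (hilbert_op \<phi>))\<^sup>2 = (tail g 0)\<^sup>2 + energy U g" if "\<And>t. \<phi> t = complex_of_real (cmod (\<phi> t))"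
    unfolding eq energy_def nn_moment_0_eq_tail[OF rep, symmetric] moment_eq_nn_moment[OF \<phi> rep that] ..
qed

end

section \<open>Comparison of the two operators and bounds for the operator norm\<close>

context hilbert_weight
begin

lemma L2_norm_eq:
  assumes "modulus_rep \<phi> g"
  shows "(L2_norm v \<phi>)\<^sup>2 = (\<integral>\<^sup>+t. (g t)\<^sup>2 * ennreal (1 / \<sigma> t) * indicator {0..<1} t \<partial>lborel)"
proof -
  have "(L2_norm v \<phi>)\<^sup>2 = (\<integral>\<^sup>+t. ennreal (1 / \<sigma> t) * (ennreal (cmod (\<phi> t)))\<^sup>2 * indicator {0..<1} t \<partial>lebesgue)"
    unfolding L2_norm_def ennsqrt_power2
  proof (intro nn_integral_cong)
    fix t :: real
    show "ennreal ((cmod (\<phi> t))\<^sup>2 * V2_hat v t) * indicator {0..<1} t = ennreal (1 / \<sigma> t) * (ennreal (cmod (\<phi> t)))\<^sup>2 * indicator {0..<1} t"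
    proof (cases "t \<in> {0..<1}")
      case True
      then have "V2_hat v t = 1 / \<sigma> t" by (simp add: V2_hat_def \<sigma>_def v_hat_eq)
      moreover have "ennreal ((cmod (\<phi> t))\<^sup>2 * (1 / \<sigma> t)) = ennreal ((cmod (\<phi> t))\<^sup>2) * ennreal (1 / \<sigma> t)" by (rule ennreal_mult') simp
      ultimately show ?thesis by (simp add: ennreal_power mult.commute)
    qed simp
  qed
  also have "\<dots> = (\<integral>\<^sup>+t. ennreal (1 / \<sigma> t) * (g t)\<^sup>2 \<partial>lborel)"
    by (rule nn_integral_modulus_rep[OF assms, of "\<lambda>x. x\<^sup>2"]) simp
  also have "\<dots> = (\<integral>\<^sup>+t. (g t)\<^sup>2 * ennreal (1 / \<sigma> t) * indicator {0..<1} t \<partial>lborel)"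
  proof (intro nn_integral_cong)
    fix t
    show "ennreal (1 / \<sigma> t) * (g t)\<^sup>2 = (g t)\<^sup>2 * ennreal (1 / \<sigma> t) * indicator {0..<1} t"
      using assms by (cases "t \<in> {0..<1}") (simp_all add: modulus_rep_def mult.commute)
  qed
  finally show ?thesis .
qed

text \<open>Cauchy-Schwarz for sqrt \<sigma> against g / sqrt \<sigma>. With A(0) finite it embeds
  the weighted space into the integrable functions, so the integrals defining both operators
  converge throughout the disc.\<close>

lemma tail_0_square_le:
  assumes [measurable]: "g \<in> borel_measurable borel"
  shows "(tail g 0)\<^sup>2 \<le> A 0 * (\<integral>\<^sup>+t. (g t)\<^sup>2 * ennreal (1 / \<sigma> t) * indicator {0..<1} t \<partial>lborel)"
proof -
  have s: "0 < sqrt (\<sigma> t)" "(ennreal (sqrt (\<sigma> t)))\<^sup>2 = ennreal (\<sigma> t)" "(ennreal (1 / sqrt (\<sigma> t)))\<^sup>2 = ennreal (1 / \<sigma> t)"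
    if "t \<in> {0..<1}" for t
  proof -
    have p: "0 < \<sigma> t" using that \<sigma>_pos by auto
    then show "0 < sqrt (\<sigma> t)" "(ennreal (sqrt (\<sigma> t)))\<^sup>2 = ennreal (\<sigma> t)" by (simp_all add: ennreal_power)
    have "(ennreal (1 / sqrt (\<sigma> t)))\<^sup>2 = ennreal ((1 / sqrt (\<sigma> t))\<^sup>2)" using p by (intro ennreal_power) simp
    then show "(ennreal (1 / sqrt (\<sigma> t)))\<^sup>2 = ennreal (1 / \<sigma> t)" using p by (simp add: power_divide)
  qed
  have "(tail g 0)\<^sup>2 = (\<integral>\<^sup>+t. (ennreal (sqrt (\<sigma> t)) * indicator {0..<1} t) * (g t * ennreal (1 / sqrt (\<sigma> t)) * indicator {0..<1} t) \<partial>lborel)\<^sup>2"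
    unfolding tail_def
  proof (intro arg_cong[where f = "\<lambda>x. x\<^sup>2"] nn_integral_cong)
    fix t
    show "g t * indicator {0..<1} t = (ennreal (sqrt (\<sigma> t)) * indicator {0..<1} t) * (g t * ennreal (1 / sqrt (\<sigma> t)) * indicator {0..<1} t)"
    proof (cases "t \<in> {0..<1}")
      case True
      have "ennreal (sqrt (\<sigma> t)) * ennreal (1 / sqrt (\<sigma> t)) = 1"
        using s(1)[OF True] ennreal_mult'[of "sqrt (\<sigma> t)" "1 / sqrt (\<sigma> t)"] by simp
      then have "g t * (ennreal (sqrt (\<sigma> t)) * ennreal (1 / sqrt (\<sigma> t))) = g t" by simp
      then show ?thesis using True by (simp add: mult_ac)
    qed simp
  qed
  also have "\<dots> \<le> (\<integral>\<^sup>+t. (ennreal (sqrt (\<sigma> t)) * indicator {0..<1} t)\<^sup>2 \<partial>lborel) * (\<integral>\<^sup>+t. (g t * ennreal (1 / sqrt (\<sigma> t)) * indicator {0..<1} t)\<^sup>2 \<partial>lborel)"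
    by (rule Cauchy_Schwarz_nn_integral) measurable
  also have "(\<integral>\<^sup>+t. (ennreal (sqrt (\<sigma> t)) * indicator {0..<1} t)\<^sup>2 \<partial>lborel) = A 0"
    unfolding A_def tail_def
  proof (intro nn_integral_cong)
    fix t
    show "(ennreal (sqrt (\<sigma> t)) * indicator {0..<1} t)\<^sup>2 = ennreal (\<sigma> t) * indicator {0..<1} t"
      using s(2)[of t] by (cases "t \<in> {0..<1}") simp_all
  qed
  also have "(\<integral>\<^sup>+t. (g t * ennreal (1 / sqrt (\<sigma> t)) * indicator {0..<1} t)\<^sup>2 \<partial>lborel) = (\<integral>\<^sup>+t. (g t)\<^sup>2 * ennreal (1 / \<sigma> t) * indicator {0..<1} t \<partial>lborel)"
  proof (intro nn_integral_cong)
    fix t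
    show "(g t * ennreal (1 / sqrt (\<sigma> t)) * indicator {0..<1} t)\<^sup>2 = (g t)\<^sup>2 * ennreal (1 / \<sigma> t) * indicator {0..<1} t"
      using s(3)[of t] by (cases "t \<in> {0..<1}") (simp_all add: power_mult_distrib)
  qed
  finally show ?thesis .
qed

lemma L2_space_rep:
  assumes "\<phi> \<in> L2_space v"
  obtains g where "modulus_rep \<phi> g" "set_integrable lebesgue {0..<1} \<phi>" "(tail g 0)\<^sup>2 \<le> A 0 * (L2_norm v \<phi>)\<^sup>2"
proof -
  have \<phi>: "\<phi> \<in> borel_measurable (lebesgue_on {0..<1})" "L2_norm v \<phi> < \<infinity>" using assms by (auto simp: L2_space_def)
  from modulus_rep_exists[OF \<phi>(1)] obtain g where g: "modulus_rep \<phi> g" .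
  then have "g \<in> borel_measurable borel" by (simp add: modulus_rep_def)
  from tail_0_square_le[OF this] have le: "(tail g 0)\<^sup>2 \<le> A 0 * (L2_norm v \<phi>)\<^sup>2" unfolding L2_norm_eq[OF g] .
  also have "\<dots> < \<infinity>" using A_0_finite \<phi>(2) by (simp add: ennreal_mult_less_top power2_eq_square)
  finally have "tail g 0 < \<infinity>" by (cases "tail g 0 = \<infinity>") (auto simp: less_top power2_eq_square ennreal_mult_eq_top_iff)
  from that[OF g set_integrable_modulus_rep[OF \<phi>(1) g this] le] show ?thesis .
qed

lemma L2_norm_norm: "L2_norm v (\<lambda>t. complex_of_real (cmod (\<phi> t))) = L2_norm v \<phi>"
  by (simp add: L2_norm_def)

lemma L2_space_norm: "\<phi> \<in> L2_space v \<Longrightarrow> (\<lambda>t. complex_of_real (cmod (\<phi> t))) \<in> L2_space v"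
proof -
  assume \<phi>: "\<phi> \<in> L2_space v"
  then have [measurable]: "\<phi> \<in> borel_measurable (lebesgue_on {0..<1})" by (simp add: L2_space_def)
  have "(\<lambda>t. complex_of_real (cmod (\<phi> t))) \<in> borel_measurable (lebesgue_on {0..<1})" by measurable
  then show ?thesis using \<phi> by (simp add: L2_space_def L2_norm_norm)
qed

lemma sublinear_hilbert_op_eq: "sublinear_hilbert_op \<phi> = hilbert_op (\<lambda>t. complex_of_real (cmod (\<phi> t)))"
  by (simp add: fun_eq_iff sublinear_hilbert_op_def hilbert_op_def)

lemma hilbert_op_le_sublinear:
  assumes "\<phi> \<in> L2_space v"
  shows "dirichlet_norm v (hilbert_op \<phi>) \<le> dirichlet_norm v (sublinear_hilbert_op \<phi>)"
proof -
  from L2_space_rep[OF assms] obtain g where g: "modulus_rep \<phi> g" "set_integrable lebesgue {0..<1} \<phi>" .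
  have i: "set_integrable lebesgue {0..<1} (\<lambda>t. complex_of_real (cmod (\<phi> t)))"
    using L2_space_rep[OF L2_space_norm[OF assms]] by blast
  have "(dirichlet_norm v (hilbert_op \<phi>))\<^sup>2 \<le> (tail g 0)\<^sup>2 + energy U g"
    by (rule dirichlet_norm_le_energy[OF g(2,1)])
  also have "\<dots> = (dirichlet_norm v (sublinear_hilbert_op \<phi>))\<^sup>2"
    unfolding sublinear_hilbert_op_eq
    by (rule dirichlet_norm_eq_energy[OF i modulus_rep_norm[OF g(1)], symmetric]) simp
  finally show ?thesis by (simp add: ennreal_power2_le_iff)
qed

text \<open>The map from \<open>\<phi>\<close> to |\<open>\<phi>\<close>| preserves the unit ball,
  and the sublinear operator at \<open>\<phi>\<close> is the Hilbert operator at
  |\<open>\<phi>\<close>|. Together with the pointwise comparison of norms this gives equality, so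
  both comparison constants are 1.\<close>

lemma op_norm_eq: "op_norm v hilbert_op = op_norm v sublinear_hilbert_op"
proof (rule antisym)
  show "op_norm v hilbert_op \<le> op_norm v sublinear_hilbert_op"
    unfolding op_norm_def by (rule SUP_mono) (use hilbert_op_le_sublinear in blast)
  show "op_norm v sublinear_hilbert_op \<le> op_norm v hilbert_op"
    unfolding op_norm_def
  proof (rule SUP_mono)
    fix \<phi> assume "\<phi> \<in> {\<phi> \<in> L2_space v. L2_norm v \<phi> \<le> 1}"
    then have "(\<lambda>t. complex_of_real (cmod (\<phi> t))) \<in> {\<phi> \<in> L2_space v. L2_norm v \<phi> \<le> 1}"
      by (simp add: L2_norm_norm L2_space_norm)
    then show "\<exists>\<psi>\<in>{\<phi> \<in> L2_space v. L2_norm v \<phi> \<le> 1}. dirichlet_norm v (sublinear_hilbert_op \<phi>) \<le> dirichlet_norm v (hilbert_op \<psi>)"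
      unfolding sublinear_hilbert_op_eq by blast
  qed
qed

lemma image_dirichlet_space_iff:
  "hilbert_op ` L2_space v \<subseteq> dirichlet_space v \<longleftrightarrow> sublinear_hilbert_op ` L2_space v \<subseteq> dirichlet_space v"
proof
  assume *: "hilbert_op ` L2_space v \<subseteq> dirichlet_space v"
  show "sublinear_hilbert_op ` L2_space v \<subseteq> dirichlet_space v"
    unfolding sublinear_hilbert_op_eq using * L2_space_norm by blast
next
  assume *: "sublinear_hilbert_op ` L2_space v \<subseteq> dirichlet_space v"
  show "hilbert_op ` L2_space v \<subseteq> dirichlet_space v"
  proof (intro image_subsetI)
    fix \<phi> assume \<phi>: "\<phi> \<in> L2_space v"
    then have "set_integrable lebesgue {0..<1} \<phi>" using L2_space_rep by blast
    \<comment> \<open>The norm comparison provides finiteness only; holomorphy is read off the power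
      series.\<close>
    then have "hilbert_op \<phi> holomorphic_on ball 0 1" by (rule hilbert_op_holomorphic)
    moreover have "dirichlet_norm v (sublinear_hilbert_op \<phi>) < \<infinity>" using * \<phi> by (auto simp: dirichlet_space_def)
    ultimately show "hilbert_op \<phi> \<in> dirichlet_space v"
      using hilbert_op_le_sublinear[OF \<phi>] by (auto simp: dirichlet_space_def intro: le_less_trans)
  qed
qed

lemma bounded_op_iff: "bounded_op v hilbert_op \<longleftrightarrow> bounded_op v sublinear_hilbert_op"
  by (simp add: bounded_op_def op_norm_eq image_dirichlet_space_iff)

text \<open>The supremum in \<open>M2\<close> skips r = 0, whereas Hardy's inequality asks for the
  condition there too.\<close>

lemma W_0: "W 0 = 0"
proof -
  have "W 0 \<le> ennreal (w 0 * (0 - 0))"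
    unfolding W_def by (rule nn_integral_indicator_le) (auto simp: w_nonneg)
  then show ?thesis by simp
qed

text \<open>Three contributions, each relative to m^2 and the squared norm of \<open>\<phi>\<close>:
  |f(0)|^2 costs 66 K / h(0) through A(0); the total-integral term of the energy bound costs 4 * 66
  K; Hardy's inequality costs 12 * 4 * (66 K + 1). The last two add up to 3432 K + 48.\<close>

lemma dirichlet_norm_upper:
  assumes m: "M2 v = ennreal m" "0 \<le> m" and \<phi>: "\<phi> \<in> L2_space v"
  shows "(dirichlet_norm v (hilbert_op \<phi>))\<^sup>2 \<le> ennreal ((66 * K / h 0 + 3432 * K + 48) * m\<^sup>2) * (L2_norm v \<phi>)\<^sup>2"
proof -
  from L2_space_rep[OF \<phi>] obtain g where g: "modulus_rep \<phi> g" "set_integrable lebesgue {0..<1} \<phi>"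
    and tail: "(tail g 0)\<^sup>2 \<le> A 0 * (L2_norm v \<phi>)\<^sup>2" .
  have [measurable]: "g \<in> borel_measurable borel" and g0: "\<And>t. t \<notin> {0..<1} \<Longrightarrow> g t = 0"
    using g(1) by (simp_all add: modulus_rep_def)
  let ?N = "(L2_norm v \<phi>)\<^sup>2"
  \<comment> \<open>The summand 66 K m^2 bounds h(0) A(r) and the summand m^2 bounds W(r) A(r); thus
    \<open>h 0\<close> takes the place of the additive constant in Hardy's inequality.\<close>
  define b where "b = (66 * K + 1) * m\<^sup>2"
  have b: "0 \<le> b" using K_nonneg by (simp add: b_def)
  have h0: "0 < h 0" by (rule h_pos) auto
  have m2: "(ennreal m)\<^sup>2 = ennreal (m\<^sup>2)" using m(2) by (rule ennreal_power)
  have hA: "ennreal (h 0) * A 0 \<le> ennreal (66 * K * m\<^sup>2)"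
    using h_0_A_0_le[of "ennreal m"] m K_nonneg by (simp add: m2 ennreal_mult')
  have WA: "W r * A r \<le> ennreal (m\<^sup>2)" if "0 \<le> r" "r < 1" for r
  proof (cases "r = 0")
    case True
    then show ?thesis by (simp add: W_0)
  next
    case False
    then show ?thesis using M2_le_iff[of "ennreal m"] m that by (simp add: m2)
  qed
  have muck: "(ennreal (h 0) + W r) * A r \<le> ennreal b" if "0 \<le> r" "r < 1" for r
  proof -
    have "(ennreal (h 0) + W r) * A r = ennreal (h 0) * A r + W r * A r" by (rule distrib_right)
    also have "\<dots> \<le> ennreal (66 * K * m\<^sup>2) + ennreal (m\<^sup>2)"
      using that by (intro add_mono WA order_trans[OF mult_left_mono[OF A_antimono] hA]) auto
    also have "\<dots> = ennreal b" using K_nonneg by (subst ennreal_plus[symmetric]) (auto simp: b_def algebra_simps)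
    finally show ?thesis .
  qed
  have hardy: "(\<integral>\<^sup>+r. ennreal (w r) * (tail g r)\<^sup>2 * indicator {0..<1} r \<partial>lborel) \<le> ennreal (4 * b) * ?N"
    unfolding L2_norm_eq[OF g(1)]
  proof (rule hardy_tail_inequality)
    show "continuous_on {0..<1} w" by (rule continuous_w)
    show "continuous_on {0..<1} \<sigma>" by (rule continuous_\<sigma>)
    show "tail (\<lambda>x. ennreal (\<sigma> x)) 0 < \<infinity>" using A_0_finite by (simp add: A_def)
    show "(ennreal (h 0) + (\<integral>\<^sup>+x. ennreal (w x) * indicator {0..r} x \<partial>lborel)) * tail (\<lambda>x. ennreal (\<sigma> x)) r \<le> ennreal b"
      if "r \<in> {0..<1}" for r
      using muck[of r] that by (simp add: W_def A_def)
  qed (use b h0 \<sigma>_pos w_nonneg in auto)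
  have "(\<integral>\<^sup>+\<rho>. ennreal (1 / (1 - \<rho>) ^ 4) * (tail g \<rho>)\<^sup>2 * tail U \<rho> * indicator {0..<1} \<rho> \<partial>lborel)
    = (\<integral>\<^sup>+r. ennreal (w r) * (tail g r)\<^sup>2 * indicator {0..<1} r \<partial>lborel)"
  proof (intro nn_integral_cong)
    fix r :: real
    show "ennreal (1 / (1 - r) ^ 4) * (tail g r)\<^sup>2 * tail U r * indicator {0..<1} r = ennreal (w r) * (tail g r)\<^sup>2 * indicator {0..<1} r"
    proof (cases "r \<in> {0..<1}")
      case True
      then have "ennreal (w r) = ennreal (1 / (1 - r) ^ 4 * h r)" by (simp add: w_def)
      also have "\<dots> = ennreal (1 / (1 - r) ^ 4) * tail U r" using True by (subst ennreal_mult') (auto simp: ennreal_h)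
      finally show ?thesis by (simp only: mult_ac)
    qed simp
  qed
  then have "energy U g \<le> 4 * ennreal (h 0) * (tail g 0)\<^sup>2 + 12 * (\<integral>\<^sup>+r. ennreal (w r) * (tail g r)\<^sup>2 * indicator {0..<1} r \<partial>lborel)"
    using energy_le[of g U] g0 by (simp add: ennreal_h)
  also have "\<dots> \<le> 4 * ennreal (h 0) * (A 0 * ?N) + 12 * (ennreal (4 * b) * ?N)"
    by (intro add_mono mult_left_mono tail hardy) auto
  finally have e: "energy U g \<le> 4 * ennreal (h 0) * (A 0 * ?N) + 12 * (ennreal (4 * b) * ?N)" .
  have A0: "A 0 \<le> ennreal (66 * K * m\<^sup>2 / h 0)"
  proof -
    have "ennreal (1 / h 0) * (ennreal (h 0) * A 0) \<le> ennreal (1 / h 0) * ennreal (66 * K * m\<^sup>2)"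
      by (intro mult_left_mono hA) simp
    moreover have "ennreal (1 / h 0) * ennreal (h 0) = 1" using h0 ennreal_mult'[of "1 / h 0" "h 0"] by simp
    then have "ennreal (1 / h 0) * (ennreal (h 0) * A 0) = A 0" by (simp add: mult.assoc[symmetric])
    moreover have "ennreal (1 / h 0) * ennreal (66 * K * m\<^sup>2) = ennreal (66 * K * m\<^sup>2 / h 0)"
      using h0 ennreal_mult'[of "1 / h 0" "66 * K * m\<^sup>2"] by simp
    ultimately show ?thesis by simp
  qed
  have "(dirichlet_norm v (hilbert_op \<phi>))\<^sup>2 \<le> (tail g 0)\<^sup>2 + energy U g"
    by (rule dirichlet_norm_le_energy[OF g(2,1)])
  also have "\<dots> \<le> A 0 * ?N + (4 * ennreal (h 0) * (A 0 * ?N) + 12 * (ennreal (4 * b) * ?N))"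
    by (intro add_mono tail e)
  also have "\<dots> = (A 0 + 4 * (ennreal (h 0) * A 0) + 12 * ennreal (4 * b)) * ?N"
    by (simp only: distrib_right mult.assoc add.assoc)
  also have "\<dots> \<le> (ennreal (66 * K * m\<^sup>2 / h 0) + 4 * ennreal (66 * K * m\<^sup>2) + 12 * ennreal (4 * b)) * ?N"
    by (intro mult_right_mono add_mono A0 mult_left_mono hA) auto
  also have "ennreal (66 * K * m\<^sup>2 / h 0) + 4 * ennreal (66 * K * m\<^sup>2) + 12 * ennreal (4 * b) = ennreal ((66 * K / h 0 + 3432 * K + 48) * m\<^sup>2)"
  proof -
    have n: "0 \<le> 66 * K * m\<^sup>2 / h 0" "0 \<le> 66 * K * m\<^sup>2" using K_nonneg h0 by auto
    have "4 * ennreal (66 * K * m\<^sup>2) = ennreal (4 * (66 * K * m\<^sup>2))" "12 * ennreal (4 * b) = ennreal (12 * (4 * b))"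
      using ennreal_mult'[of 4 "66 * K * m\<^sup>2"] ennreal_mult'[of 12 "4 * b"] by simp_all
    then have "ennreal (66 * K * m\<^sup>2 / h 0) + 4 * ennreal (66 * K * m\<^sup>2) + 12 * ennreal (4 * b)
      = ennreal (66 * K * m\<^sup>2 / h 0 + 4 * (66 * K * m\<^sup>2) + 12 * (4 * b))"
      using n b by (simp only:) (subst ennreal_plus; simp)+
    also have "66 * K * m\<^sup>2 / h 0 + 4 * (66 * K * m\<^sup>2) + 12 * (4 * b) = (66 * K / h 0 + 3432 * K + 48) * m\<^sup>2"
      by (simp add: b_def algebra_simps)
    finally show ?thesis .
  qed
  finally show ?thesis .
qed

text \<open>The dual weight cut to [r0, 1) and divided by sqrt (A r0) is extremal for
  Cauchy-Schwarz: it has norm 1 and its squared integral is \<open>A r0\<close>. In the lower energy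
  bound r0^2 / 32 is at least 1 / 128.\<close>

lemma test_function_lower:
  assumes r0: "1 / 2 \<le> r0" "r0 < 1"
  shows "W r0 * A r0 \<le> 128 * (op_norm v hilbert_op)\<^sup>2"
proof -
  define a where "a = enn2real (A r0)"
  have Aa: "A r0 = ennreal a" using A_finite[of r0] r0 by (simp add: a_def less_top)
  have a: "0 < a" using A_pos[of r0] r0 unfolding Aa by simp
  define f where "f t = indicat_real {r0..<1} t * (\<sigma> t / sqrt a)" for t
  have f0: "0 \<le> f t" for t using \<sigma>_pos[of t] r0 a by (cases "t \<in> {r0..<1}") (auto simp: f_def intro!: divide_nonneg_nonneg less_imp_le)
  have [measurable]: "f \<in> borel_measurable borel" unfolding f_def[abs_def] by measurable
  let ?g = "\<lambda>t. ennreal (f t)" and ?\<phi> = "\<lambda>t. complex_of_real (f t)"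
  have fz: "f t = 0" if "t \<notin> {r0..<1}" for t using that by (simp add: f_def)
  have rep: "modulus_rep ?\<phi> ?g"
    unfolding modulus_rep_def
  proof (intro conjI allI impI AE_I2)
    fix t :: real assume "t \<notin> {0..<1}"
    then have "t \<notin> {r0..<1}" using r0 by auto
    then show "?g t = 0" by (simp add: fz)
  qed (use f0 in \<open>measurable, simp\<close>)
  have meas: "?\<phi> \<in> borel_measurable (lebesgue_on {0..<1})"
    by (intro measurable_restrict_space1 borel_measurable_lebesgueI) measurable
  have "(L2_norm v ?\<phi>)\<^sup>2 = (\<integral>\<^sup>+t. ennreal (1 / a) * (ennreal (\<sigma> t) * indicator {r0..<1} t) \<partial>lborel)"
    unfolding L2_norm_eq[OF rep]
  proof (intro nn_integral_cong)
    fix t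
    show "(ennreal (f t))\<^sup>2 * ennreal (1 / \<sigma> t) * indicator {0..<1} t = ennreal (1 / a) * (ennreal (\<sigma> t) * indicator {r0..<1} t)"
    proof (cases "t \<in> {r0..<1}")
      case True
      then have s: "0 < \<sigma> t" "t \<in> {0..<1}" using \<sigma>_pos[of t] r0 by auto
      have "(ennreal (f t))\<^sup>2 * ennreal (1 / \<sigma> t) = ennreal ((f t)\<^sup>2 * (1 / \<sigma> t))"
      proof -
        have "ennreal ((f t)\<^sup>2 * (1 / \<sigma> t)) = ennreal ((f t)\<^sup>2) * ennreal (1 / \<sigma> t)" by (rule ennreal_mult') simp
        then show ?thesis using f0[of t] by (simp only: ennreal_power)
      qed
      also have "(f t)\<^sup>2 * (1 / \<sigma> t) = 1 / a * \<sigma> t" using True s a by (simp add: f_def power_divide power2_eq_square)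
      also have "ennreal (1 / a * \<sigma> t) = ennreal (1 / a) * ennreal (\<sigma> t)" using a by (intro ennreal_mult') simp
      finally show ?thesis using True s(2) by simp
    next
      case False
      then show ?thesis by (simp add: fz)
    qed
  qed
  also have "\<dots> = ennreal (1 / a) * A r0" unfolding A_def tail_def by (rule nn_integral_cmult) measurable
  also have "\<dots> = 1" unfolding Aa using a ennreal_mult'[of "1 / a" a] by simp
  finally have N: "(L2_norm v ?\<phi>)\<^sup>2 = 1" .
  have "(L2_norm v ?\<phi>)\<^sup>2 \<le> 1\<^sup>2" using N by simp
  then have N1: "L2_norm v ?\<phi> \<le> 1" by (simp only: ennreal_power2_le_iff)
  then have L2: "?\<phi> \<in> L2_space v" using meas by (auto simp: L2_space_def intro: le_less_trans)
  then have int: "set_integrable lebesgue {0..<1} ?\<phi>" using L2_space_rep by blast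
  have "tail ?g 0 = (\<integral>\<^sup>+t. ennreal (1 / sqrt a) * (ennreal (\<sigma> t) * indicator {r0..<1} t) \<partial>lborel)"
    unfolding tail_def
  proof (intro nn_integral_cong)
    fix t
    show "ennreal (f t) * indicator {0..<1} t = ennreal (1 / sqrt a) * (ennreal (\<sigma> t) * indicator {r0..<1} t)"
    proof (cases "t \<in> {r0..<1}")
      case True
      have "f t = 1 / sqrt a * \<sigma> t" using True by (simp add: f_def)
      then have "ennreal (f t) = ennreal (1 / sqrt a) * ennreal (\<sigma> t)" using a by (simp only: ennreal_mult' real_sqrt_ge_0_iff divide_nonneg_nonneg zero_le_one less_imp_le)
      moreover have "t \<in> {0..<1}" using True r0 by auto
      ultimately show ?thesis using True by simp
    qed (simp add: fz)
  qed
  also have "\<dots> = ennreal (1 / sqrt a) * A r0" unfolding A_def tail_def by (rule nn_integral_cmult) measurable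
  also have "\<dots> = ennreal (1 / sqrt a * a)" unfolding Aa using a by (intro ennreal_mult'[symmetric]) simp
  finally have "(tail ?g 0)\<^sup>2 = ennreal ((1 / sqrt a * a)\<^sup>2)" using a by (simp add: ennreal_power)
  also have "(1 / sqrt a * a)\<^sup>2 = a" using a by (simp add: power_mult_distrib power_divide power2_eq_square)
  finally have tail: "(tail ?g 0)\<^sup>2 = A r0" unfolding Aa .
  have W: "(\<integral>\<^sup>+\<rho>. ennreal (1 / (1 - \<rho>) ^ 4) * tail U \<rho> * indicator {0..r0} \<rho> \<partial>lborel) = W r0"
    unfolding W_def
  proof (intro nn_integral_cong)
    fix r :: real
    show "ennreal (1 / (1 - r) ^ 4) * tail U r * indicator {0..r0} r = ennreal (w r) * indicator {0..r0} r"
    proof (cases "r \<in> {0..r0}")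
      case True
      then have "ennreal (w r) = ennreal (1 / (1 - r) ^ 4 * h r)" by (simp add: w_def)
      also have "\<dots> = ennreal (1 / (1 - r) ^ 4) * tail U r" using True by (subst ennreal_mult') (auto simp: ennreal_h)
      finally show ?thesis by (simp only: mult_ac)
    qed simp
  qed
  have "ennreal (1 / 128) * (W r0 * A r0) \<le> ennreal (r0\<^sup>2 / 32) * (W r0 * A r0)"
  proof (intro mult_right_mono ennreal_leI)
    have "(1 / 2)\<^sup>2 \<le> r0\<^sup>2" using r0 by (intro power_mono) auto
    then show "1 / 128 \<le> r0\<^sup>2 / 32" by (simp add: power2_eq_square)
  qed simp
  also have "\<dots> = ennreal (r0\<^sup>2 / 32) * (tail ?g 0)\<^sup>2 * (\<integral>\<^sup>+\<rho>. ennreal (1 / (1 - \<rho>) ^ 4) * tail U \<rho> * indicator {0..r0} \<rho> \<partial>lborel)"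
    unfolding W tail by (simp only: mult_ac)
  also have "\<dots> \<le> energy U ?g"
    by (rule energy_ge) (use r0 fz in \<open>auto\<close>)
  also have "\<dots> \<le> (tail ?g 0)\<^sup>2 + energy U ?g" by simp
  also have "\<dots> = (dirichlet_norm v (hilbert_op ?\<phi>))\<^sup>2"
    by (rule dirichlet_norm_eq_energy[OF int rep, symmetric]) (simp add: f0)
  also have "\<dots> \<le> (op_norm v hilbert_op)\<^sup>2"
    unfolding ennreal_power2_le_iff op_norm_def by (rule SUP_upper) (use L2 N1 in simp)
  finally have "128 * (ennreal (1 / 128) * (W r0 * A r0)) \<le> 128 * (op_norm v hilbert_op)\<^sup>2"
    by (rule mult_left_mono) simp
  moreover have "128 * ennreal (1 / 128) = 1" using ennreal_mult'[of 128 "1 / 128"] by simp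
  then have "128 * (ennreal (1 / 128) * (W r0 * A r0)) = W r0 * A r0" by (simp add: mult.assoc[symmetric])
  ultimately show ?thesis by simp
qed

text \<open>The loss is 33 for radii below 1/2 times 128 from the test functions, and 33 * 128 =
  4224 is just below 65^2.\<close>

lemma M2_le_op_norm: "M2 v \<le> ennreal 65 * op_norm v hilbert_op"
  unfolding M2_le_iff
proof
  fix r :: real assume "r \<in> {0<..<1}"
  then have "W r * A r \<le> 33 * (128 * (op_norm v hilbert_op)\<^sup>2)"
    by (intro M2_le_if_large test_function_lower) auto
  also have "\<dots> = ennreal 4224 * (op_norm v hilbert_op)\<^sup>2" by (simp add: mult.assoc[symmetric])
  also have "\<dots> \<le> ennreal (65\<^sup>2) * (op_norm v hilbert_op)\<^sup>2" by (intro mult_right_mono ennreal_leI) auto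
  also have "\<dots> = (ennreal 65 * op_norm v hilbert_op)\<^sup>2" by (simp only: power_mult_distrib) (simp add: ennreal_power)
  finally show "W r * A r \<le> (ennreal 65 * op_norm v hilbert_op)\<^sup>2" .
qed

lemma op_norm_le:
  assumes m: "M2 v = ennreal m" "0 \<le> m"
  shows "op_norm v hilbert_op \<le> ennreal (sqrt (66 * K / h 0 + 3432 * K + 48)) * M2 v"
  unfolding op_norm_def
proof (rule SUP_least)
  let ?D = "66 * K / h 0 + 3432 * K + 48"
  have D: "0 \<le> ?D" using K_nonneg h_nonneg by (intro add_nonneg_nonneg divide_nonneg_nonneg) auto
  fix \<phi> assume \<phi>: "\<phi> \<in> {\<phi> \<in> L2_space v. L2_norm v \<phi> \<le> 1}"
  then have "(L2_norm v \<phi>)\<^sup>2 \<le> 1\<^sup>2" by (simp only: ennreal_power2_le_iff mem_Collect_eq)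
  then have "ennreal (?D * m\<^sup>2) * (L2_norm v \<phi>)\<^sup>2 \<le> ennreal (?D * m\<^sup>2) * 1" by (intro mult_left_mono) auto
  with dirichlet_norm_upper[OF m] \<phi> have "(dirichlet_norm v (hilbert_op \<phi>))\<^sup>2 \<le> ennreal (?D * m\<^sup>2)"
    by (auto intro: order_trans)
  also have "ennreal (?D * m\<^sup>2) = (ennreal (sqrt ?D) * M2 v)\<^sup>2"
    using D m by (simp only: power_mult_distrib ennreal_power real_sqrt_ge_zero real_sqrt_pow2 ennreal_mult')
  finally show "dirichlet_norm v (hilbert_op \<phi>) \<le> ennreal (sqrt ?D) * M2 v" by (simp only: ennreal_power2_le_iff)
qed

lemma bounded_iff_M2_finite: "bounded_op v hilbert_op \<longleftrightarrow> M2 v < \<infinity>"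
proof
  assume "bounded_op v hilbert_op"
  then have "ennreal 65 * op_norm v hilbert_op < \<infinity>" by (simp add: bounded_op_def ennreal_mult_less_top)
  with M2_le_op_norm show "M2 v < \<infinity>" by (rule le_less_trans)
next
  assume "M2 v < \<infinity>"
  then obtain m where m: "M2 v = ennreal m" "0 \<le> m" by (cases "M2 v") auto
  show "bounded_op v hilbert_op"
    unfolding bounded_op_def
  proof
    show "op_norm v hilbert_op < \<infinity>" using op_norm_le[OF m] m by (auto simp: ennreal_mult_less_top intro: le_less_trans)
    \<comment> \<open>The operator norm concerns the unit ball alone; images of arbitrary elements
      are handled by the bound with their own norm.\<close>
    show "hilbert_op ` L2_space v \<subseteq> dirichlet_space v"
    proof (intro image_subsetI)
      fix \<phi> assume \<phi>: "\<phi> \<in> L2_space v"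
      then have "set_integrable lebesgue {0..<1} \<phi>" using L2_space_rep by blast
      then have "hilbert_op \<phi> holomorphic_on ball 0 1" by (rule hilbert_op_holomorphic)
      moreover have "(L2_norm v \<phi>)\<^sup>2 < \<infinity>" using \<phi> by (simp add: L2_space_def power2_eq_square ennreal_mult_less_top)
      then have "ennreal ((66 * K / h 0 + 3432 * K + 48) * m\<^sup>2) * (L2_norm v \<phi>)\<^sup>2 < \<infinity>" by (simp add: ennreal_mult_less_top)
      with dirichlet_norm_upper[OF m \<phi>] have "(dirichlet_norm v (hilbert_op \<phi>))\<^sup>2 < \<infinity>" by (rule le_less_trans)
      then have "dirichlet_norm v (hilbert_op \<phi>) < \<infinity>"
        by (cases "dirichlet_norm v (hilbert_op \<phi>) = \<infinity>") (auto simp: less_top power2_eq_square ennreal_mult_eq_top_iff)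
      ultimately show "hilbert_op \<phi> \<in> dirichlet_space v" by (simp add: dirichlet_space_def)
    qed
  qed
qed

end

section \<open>From a weight of the doubling class to the final estimates\<close>

lemma hilbert_weight_exists:
  assumes "v \<in> D_hat" and "(\<integral>\<^sup>+s\<in>{0..<1}. ennreal ((1 - s)\<^sup>2 / v_hat v s) \<partial>lebesgue) < \<infinity>"
  obtains u where "hilbert_weight v u"
proof -
  have v: "set_integrable lebesgue (ball 0 1) v" "\<And>z. z \<in> ball 0 1 \<Longrightarrow> 0 < v z"
    "\<And>z. z \<in> ball 0 1 \<Longrightarrow> v z = v (complex_of_real (cmod z))" "doubling_const v < \<infinity>"
    using assms(1) unfolding D_hat_def radial_weight_def weight_def by blast+
  have "(\<lambda>z. indicator (ball 0 1) z * v z) \<in> borel_measurable lebesgue"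
    using borel_measurable_integrable[OF v(1)[unfolded set_integrable_def]] by simp
  from radial_borel_representative[OF this v(3,2)] obtain u where "u \<in> borel_measurable borel" "\<And>r. 0 \<le> u r"
    "AE r in lborel. 0 < r \<and> r < 1 \<longrightarrow> v (complex_of_real r) = u r"
    "AE z in lborel. z \<in> ball 0 1 \<longrightarrow> v z = u (cmod z)" by blast
  then have "hilbert_weight v u"
    by unfold_locales (use v assms(2) in blast)+
  then show ?thesis by (rule that)
qed

theorem theorem3:
  shows "\<exists>(c1::real) (c2::real) (c3::real) (C :: ennreal \<Rightarrow> real \<Rightarrow> real).
     0 < c1 \<and> 0 < c2 \<and> 0 < c3 \<and> (\<forall>K m. 0 < C K m) \<and>
     (\<forall>v\<in>D_hat.
        (\<integral>\<^sup>+s\<in>{0..<1}. ennreal ((1 - s)\<^sup>2 / v_hat v s) \<partial>lebesgue) < \<infinity> \<longrightarrow>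
        M1 v < \<infinity> \<longrightarrow>
          (bounded_op v hilbert_op \<longleftrightarrow> bounded_op v sublinear_hilbert_op) \<and>
          (bounded_op v sublinear_hilbert_op \<longleftrightarrow> M2 v < \<infinity>) \<and>
          (M2 v < \<infinity> \<longrightarrow>
             M2 v / M1 v \<le> ennreal c1 * op_norm v hilbert_op \<and>
             op_norm v hilbert_op \<le> ennreal c2 * op_norm v sublinear_hilbert_op \<and>
             op_norm v sublinear_hilbert_op \<le> ennreal c3 * op_norm v hilbert_op \<and>
             op_norm v sublinear_hilbert_op
               \<le> ennreal (C (doubling_const v) (v_hat v 0)) * (M1 v * M2 v)))"
proof -
  \<comment> \<open>The 12 is the reciprocal of the lower bound for \<open>M1 v\<close>, and the
    root is the bound of the operator norm relative to \<open>M2 v\<close>. The absolute value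
    secures positivity for every real argument; \<open>v_hat v 0\<close> itself is
    nonnegative.\<close>
  define C :: "ennreal \<Rightarrow> real \<Rightarrow> real" where
    "C K m = 12 * sqrt (66 * enn2real K / \<bar>m\<bar> + 3432 * enn2real K + 48)" for K m
  have C: "0 < C K m" for K m
    unfolding C_def by (intro mult_pos_pos real_sqrt_gt_zero add_nonneg_pos add_nonneg_nonneg) auto
  have main: "(bounded_op v hilbert_op \<longleftrightarrow> bounded_op v sublinear_hilbert_op) \<and>
          (bounded_op v sublinear_hilbert_op \<longleftrightarrow> M2 v < \<infinity>) \<and>
          (M2 v < \<infinity> \<longrightarrow>
             M2 v / M1 v \<le> ennreal 780 * op_norm v hilbert_op \<and>
             op_norm v hilbert_op \<le> ennreal 1 * op_norm v sublinear_hilbert_op \<and>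
             op_norm v sublinear_hilbert_op \<le> ennreal 1 * op_norm v hilbert_op \<and>
             op_norm v sublinear_hilbert_op
               \<le> ennreal (C (doubling_const v) (v_hat v 0)) * (M1 v * M2 v))"
    if v: "v \<in> D_hat" and dual: "(\<integral>\<^sup>+s\<in>{0..<1}. ennreal ((1 - s)\<^sup>2 / v_hat v s) \<partial>lebesgue) < \<infinity>" for v
  proof -
    from hilbert_weight_exists[OF v dual] obtain u where "hilbert_weight v u" .
    then interpret hilbert_weight v u .
    \<comment> \<open>The lower bound for \<open>M1 v\<close> removes it from the denominator at the
      cost of 12, and 780 = 12 * 65.\<close>
    have lower: "M2 v / M1 v \<le> ennreal 780 * op_norm v hilbert_op"
    proof -
      have "inverse (M1 v) \<le> 12"
      proof (cases "M1 v")
        case (real r)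
        then have r: "1 / 12 \<le> r" using M1_ge by simp
        have "inverse (M1 v) = ennreal (inverse r)" unfolding real using r by (intro inverse_ennreal) linarith
        also have "\<dots> \<le> ennreal (inverse (1 / 12))" using r by (intro ennreal_leI le_imp_inverse_le) auto
        finally show ?thesis by simp
      qed simp
      then have "M2 v / M1 v \<le> M2 v * 12"
        unfolding divide_ennreal_def by (rule mult_left_mono) simp
      also have "\<dots> = 12 * M2 v" by (rule mult.commute)
      also have "\<dots> \<le> 12 * (ennreal 65 * op_norm v hilbert_op)" by (intro mult_left_mono M2_le_op_norm) simp
      also have "\<dots> = ennreal 780 * op_norm v hilbert_op" by (simp add: mult.assoc[symmetric])
      finally show ?thesis .
    qed
    have upper: "op_norm v hilbert_op \<le> ennreal (C (doubling_const v) (v_hat v 0)) * (M1 v * M2 v)" if fin: "M2 v < \<infinity>"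
    proof -
      obtain m where m: "M2 v = ennreal m" "0 \<le> m" using fin by (cases "M2 v") auto
      let ?D = "sqrt (66 * K / h 0 + 3432 * K + 48)"
      have CD: "C (doubling_const v) (v_hat v 0) = 12 * ?D"
        using h_nonneg[of 0] by (simp add: C_def K_def v_hat_eq)
      have "12 * ennreal (1 / 12) \<le> 12 * M1 v" by (intro mult_left_mono M1_ge) simp
      moreover have "12 * ennreal (1 / 12) = 1" using ennreal_mult'[of 12 "1 / 12"] by simp
      ultimately have one: "1 \<le> 12 * M1 v" by simp
      have "op_norm v hilbert_op \<le> 1 * (ennreal ?D * M2 v)" using op_norm_le[OF m] by simp
      also have "\<dots> \<le> (12 * M1 v) * (ennreal ?D * M2 v)" by (intro mult_right_mono one) simp
      also have "\<dots> = (12 * ennreal ?D) * (M1 v * M2 v)" by (simp only: mult_ac)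
      also have "12 * ennreal ?D = ennreal (C (doubling_const v) (v_hat v 0))"
        unfolding CD using ennreal_mult'[of 12 ?D] by simp
      finally show ?thesis .
    qed
    show ?thesis
      using lower upper bounded_op_iff bounded_iff_M2_finite op_norm_eq by simp
  qed
  show ?thesis
    by (rule exI[of _ 780], rule exI[of _ 1], rule exI[of _ 1], rule exI[of _ C]) (use C main in simp)
qed

end
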